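(* Let $\alpha\in[0,1]$ and $\beta\in(0,1]$. Let $(\bar u,\bar\mu)\in\mathcal{D}$ with $\bar u_x\in B_2^{\beta}$ and $\bar\mu_{\mathrm{sc}}=0$ (the singular continuous part of $\bar\mu$ vanishes), and let $0<\Delta x\le 1$. Set $\bar X=L((\bar u,\bar\mu))$ and $\bar X_{\Delta x}=L\circ P_{\Delta x}((\bar u,\bar\mu))$, and for $t\in(0,\infty)$ let $(y,U,V)(t)=S_t(\bar X)$ and $(y_{\Delta x},U_{\Delta x},V_{\Delta x})(t)=S_t(\bar X_{\Delta x})$. Then, for every $t\in(0,\infty)$, $$\|U(t)-U_{\Delta x}(t)\|_\infty\le (1+t)\,C_1\,\Delta x^{\beta/4},$$ $$\|y(t)-y_{\Delta x}(t)\|_\infty\le (1+t)\,t\,C_2\,\Delta x^{\beta/4}+2\Delta x^{\beta/4},$$ where $C_1$ and $C_2$ depend only on $\beta$, $\bar F_\infty$ and $|\bar u_x|_{2,\beta}$. Furthermore, let $(u,\mu)(t)=T_t((\bar u,\bar\mu))$ and $(u_{\Delta x},\mu_{\Delta x})(t)=T_t\circ P_{\Delta x}((\bar u,\bar\mu))$. Then $$\|u(t)-u_{\Delta x}(t)\|_\infty\le D\,(1+\sqrt t+t)\,\Delta x^{\beta/8}$$ for a constant $D$ which depends only on $\beta$, $\bar F_\infty$ and $|\bar u_x|_{2,\beta}$.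
   Context: Norms: $\|\cdot\|_p$ is the $L^p(\mathbb{R})$ norm. The parameter $\alpha\in[0,1]$ is fixed. Eulerian set $\mathcal{D}$. Let $\chi^\pm\in C^\infty(\mathbb{R})$ satisfy $\chi^++\chi^-=1$, $0\le\chi^\pm\le1$, $\mathrm{supp}\,\chi^+\subset(-1,\infty)$, $\mathrm{supp}\,\chi^-\subset(-\infty,1)$. Let $E_2=\{\bar f+a\chi^++b\chi^-:\bar f\in H^1(\mathbb{R}),a,b\in\mathbb{R}\}$ and $E_1^0=\{\bar f+a\chi^+:\bar f\in L^2(\mathbb{R}),a\in\mathbb{R}\}$ (independent of the choice of $\chi^\pm$). $\mathcal{D}$ is the set of pairs $(u,\mu)$ such that $u\in E_2$, $\mu$ is a nonnegative finite Radon measure on $\mathbb{R}$, $\mu((-\infty,\cdot))\in E_1^0$, and $d\mu_{\mathrm{ac}}=u_x^2\,dx$, where $\mu=\mu_{\mathrm{ac}}+\mu_{\mathrm{sing}}$ is the Lebesgue decomposition; further $\mu_{\mathrm{sing}}=\mu_{\mathrm{sc}}+\mu_{\mathrm{d}}$ with $\mu_{\mathrm{sc}}$ singular continuous and $\mu_{\mathrm{d}}$ purely discrete. Write $F(x)=\mu((-\infty,x))$, $F_{\mathrm{ac}}(x)=\mu_{\mathrm{ac}}((-\infty,x))$, $F_{\mathrm{sing}}(x)=\mu_{\mathrm{sing}}((-\infty,x))$, $F_\infty=\mu(\mathbb{R})$, $F_{\mathrm{ac},\infty}=\mu_{\mathrm{ac}}(\mathbb{R})$; $(u,\mu)$ and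 $(u,F)$ are used interchangeably. Bars ($\bar u,\bar\mu,\bar F,\bar F_\infty,\dots$) denote initial data. Map $L$: $(\bar y,\bar U,\bar V)=L((\bar u,\bar\mu))$ with $\bar y(\xi)=\sup\{x\in\mathbb{R}: x+\bar\mu((-\infty,x))<\xi\}$, $\bar U(\xi)=\bar u(\bar y(\xi))$, $\bar V(\xi)=\xi-\bar y(\xi)$. Solution operator $S_t$: for $\bar X=(\bar y,\bar U,\bar V)$ in the image of $L$, $S_t(\bar X)=(y,U,V)(t)$ is the unique solution with initial data $\bar X$ of $y_t(t,\xi)=U(t,\xi)$, $U_t(t,\xi)=\tfrac12V(t,\xi)-\tfrac14V_\infty(t)$, $V(t,\xi)=\int_{-\infty}^{\xi}\bigl(1-\alpha\,\chi_{\{\omega:\,t\ge\tau(\omega)>0\}}(\eta)\bigr)\bar V_\xi(\eta)\,d\eta$, with $V_\infty(t)=\lim_{\xi\to\infty}V(t,\xi)$, where $\tau(\xi)=0$ if $\bar U_\xi(\xi)=\bar y_\xi(\xi)=0$, $\tau(\xi)=-2\bar y_\xi(\xi)/\bar U_\xi(\xi)$ if $\bar U_\xi(\xi)<0$, and $\tau(\xi)=\infty$ otherwise (for $\bar X_{\Delta x}$, $\tau$ is computed from $\bar X_{\Delta x}$). Map $M$: $(u,\mu)=M((y,U,V))$ with $u(x)=U(\xi)$ for any $\xi$ with $x=y(\xi)$, and $\mu=y_\#(V_\xi\,d\xi)$ (pushforward). The $\alpha$-dissipative solution operator for the Hunter–Saxton equation is $T_t=M\circ S_t\circ L$. Projection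 $P_{\Delta x}:\mathcal{D}\to\mathcal{D}$: for $\Delta x>0$ let $x_j=j\Delta x$, $j\in\mathbb{Z}$, $f_j=f(x_j)$, $Df_{2j}=(f_{2j+2}-f_{2j})/(2\Delta x)$, $q_{2j}=\sqrt{DF_{\mathrm{ac},2j}-(Du_{2j})^2}$. Then $P_{\Delta x}((u,F))=(u_{\Delta x},F_{\Delta x})$, $F_{\Delta x}=F_{\Delta x,\mathrm{ac}}+F_{\Delta x,\mathrm{sing}}$, where for each $j$ (with either the upper or the lower signs chosen, consistently within $(x_{2j},x_{2j+2}]$; the choice is arbitrary): on $(x_{2j},x_{2j+1}]$: $u_{\Delta x}(x)=u_{2j}+(Du_{2j}\mp q_{2j})(x-x_{2j})$, $F_{\Delta x,\mathrm{ac}}(x)=F_{\mathrm{ac},2j}+(Du_{2j}\mp q_{2j})^2(x-x_{2j})$; on $(x_{2j+1},x_{2j+2}]$: $u_{\Delta x}(x)=u_{2j+2}+(Du_{2j}\pm q_{2j})(x-x_{2j+2})$, $F_{\Delta x,\mathrm{ac}}(x)=\tfrac12(F_{\mathrm{ac},2j+2}+F_{\mathrm{ac},2j})\mp2q_{2j}Du_{2j}\Delta x+(Du_{2j}\pm q_{2j})^2(x-x_{2j+1})$; on $(x_{2j},x_{2j+2}]$: $F_{\Delta x,\mathrm{sing}}(x)=F_{\mathrm{sing},2j+2}$. Space $B_2^\beta$: with $\delta_hf(x)=f(x+h)-f(x)$, $B_2^\beta=\{f\in L^2(\mathbb{R}):\exists C>0 \text{ with }\|\delta_hf\|_2\le Ch^\beta\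 \forall h\in(0,2]\}$, and $|f|_{2,\beta}=\sup_{t\in(0,2]}\bigl(t^{-\beta}\sup_{h\in[0,t]}\|\delta_hf\|_2\bigr)$ is the smallest admissible constant $C$. *)

theory Defs
  imports "HOL-Analysis.Analysis" "HOL-Probability.Essential_Supremum"
begin

section \<open>Function spaces on the real line\<close>

definition square_integrable :: "(real \<Rightarrow> real) \<Rightarrow> bool" where
  "square_integrable f \<longleftrightarrow>
     f \<in> borel_measurable borel \<and> integrable lborel (\<lambda>x. (f x)\<^sup>2)"

definition l2norm :: "(real \<Rightarrow> real) \<Rightarrow> real" where
  "l2norm f = sqrt (LINT x|lborel. (f x)\<^sup>2)"

definition linfnorm :: "(real \<Rightarrow> real) \<Rightarrow> ereal" where
  "linfnorm f = esssup lborel (\<lambda>x. ereal \<bar>f x\<bar>)"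

definition supp :: "(real \<Rightarrow> real) \<Rightarrow> real set" where
  "supp f = closure {x. f x \<noteq> 0}"

definition smooth :: "(real \<Rightarrow> real) \<Rightarrow> bool" where
  "smooth f \<longleftrightarrow> (\<forall>n. (deriv ^^ n) f differentiable_on UNIV)"

definition locally_integrable :: "(real \<Rightarrow> real) \<Rightarrow> bool" where
  "locally_integrable f \<longleftrightarrow> (\<forall>a b. set_integrable lborel {a..b} f)"

definition has_weak_deriv :: "(real \<Rightarrow> real) \<Rightarrow> (real \<Rightarrow> real) \<Rightarrow> bool" where
  "has_weak_deriv f g \<longleftrightarrow> locally_integrable f \<and> locally_integrable g \<and>
     (\<forall>\<phi>. smooth \<phi> \<and> compact (supp \<phi>) \<longrightarrow>
        (LINT x|lborel. f x * deriv \<phi> x) = - (LINT x|lborel. g x * \<phi> x))"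

text \<open>
  Subscripts \<open>x\<close> and \<open>\<xi>\<close> denote weak derivatives, which are determined only up to null sets.
  \<open>wderiv f\<close> is some representative; it occurs below only in expressions that do not depend,
  or depend only up to null sets, on this choice.
\<close>

definition wderiv :: "(real \<Rightarrow> real) \<Rightarrow> real \<Rightarrow> real" where
  "wderiv f = (SOME g. has_weak_deriv f g)"

text \<open>Elements of \<open>H\<^sup>1\<close> are identified with their continuous representatives.\<close>

definition H1 :: "(real \<Rightarrow> real) set" where
  "H1 = {f. continuous_on UNIV f \<and> square_integrable f \<and>
            (\<exists>g. has_weak_deriv f g \<and> square_integrable g)}"

definition cutoff_pair :: "(real \<Rightarrow> real) \<Rightarrow> (real \<Rightarrow> real) \<Rightarrow> bool" where
  "cutoff_pair \<chi>p \<chi>m \<longleftrightarrow> smooth \<chi>p \<and> smooth \<chi>m \<and>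
     (\<forall>x. \<chi>p x + \<chi>m x = 1 \<and> 0 \<le> \<chi>p x \<and> \<chi>p x \<le> 1 \<and> 0 \<le> \<chi>m x \<and> \<chi>m x \<le> 1) \<and>
     supp \<chi>p \<subseteq> {-1<..} \<and> supp \<chi>m \<subseteq> {..<1}"

text \<open>Neither of the next two spaces depends on the choice of the cut-off functions.\<close>

definition E2 :: "(real \<Rightarrow> real) set" where
  "E2 = {u. \<exists>\<chi>p \<chi>m f a b. cutoff_pair \<chi>p \<chi>m \<and> f \<in> H1 \<and>
              u = (\<lambda>x. f x + a * \<chi>p x + b * \<chi>m x)}"

definition E10 :: "(real \<Rightarrow> real) set" where
  "E10 = {F. \<exists>\<chi>p \<chi>m f a. cutoff_pair \<chi>p \<chi>m \<and> square_integrable f \<and>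
               F = (\<lambda>x. f x + a * \<chi>p x)}"

definition shift_diff :: "real \<Rightarrow> (real \<Rightarrow> real) \<Rightarrow> real \<Rightarrow> real" where
  "shift_diff h f x = f (x + h) - f x"

definition B2 :: "real \<Rightarrow> (real \<Rightarrow> real) set" where
  "B2 \<beta> = {f. square_integrable f \<and>
              (\<exists>C>0. \<forall>h\<in>{0<..2}. l2norm (shift_diff h f) \<le> C * h powr \<beta>)}"

definition B2_seminorm :: "real \<Rightarrow> (real \<Rightarrow> real) \<Rightarrow> real" where
  "B2_seminorm \<beta> f =
     (SUP t\<in>{0<..2}. t powr (-\<beta>) * (SUP h\<in>{0..t}. l2norm (shift_diff h f)))"

section \<open>Decomposition of measures and the Eulerian set\<close>

definition lebesgue_decomposition :: "real measure \<Rightarrow> real measure \<Rightarrow> real measure \<Rightarrow> bool" where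
  "lebesgue_decomposition \<mu> \<mu>ac \<mu>sing \<longleftrightarrow>
     sets \<mu>ac = sets borel \<and> sets \<mu>sing = sets borel \<and>
     (\<forall>A\<in>sets borel. emeasure \<mu> A = emeasure \<mu>ac A + emeasure \<mu>sing A) \<and>
     absolutely_continuous lborel \<mu>ac \<and>
     (\<exists>N\<in>null_sets lborel. emeasure \<mu>sing (- N) = 0)"

definition ac_part :: "real measure \<Rightarrow> real measure" where
  "ac_part \<mu> = (THE \<nu>. \<exists>\<sigma>. lebesgue_decomposition \<mu> \<nu> \<sigma>)"

definition sing_part :: "real measure \<Rightarrow> real measure" where
  "sing_part \<mu> = (THE \<sigma>. \<exists>\<nu>. lebesgue_decomposition \<mu> \<nu> \<sigma>)"

definition atomic_decomposition :: "real measure \<Rightarrow> real measure \<Rightarrow> real measure \<Rightarrow> bool" where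
  "atomic_decomposition \<mu> \<mu>c \<mu>d \<longleftrightarrow>
     sets \<mu>c = sets borel \<and> sets \<mu>d = sets borel \<and>
     (\<forall>A\<in>sets borel. emeasure \<mu> A = emeasure \<mu>c A + emeasure \<mu>d A) \<and>
     (\<forall>x. emeasure \<mu>c {x} = 0) \<and>
     (\<exists>S. countable S \<and> emeasure \<mu>d (- S) = 0)"

definition sc_part :: "real measure \<Rightarrow> real measure" where
  "sc_part \<mu> = (THE \<nu>. \<exists>\<delta>. atomic_decomposition (sing_part \<mu>) \<nu> \<delta>)"

text \<open>The function \<open>F\<close> associated with a measure; it is left continuous.\<close>

definition distr_fun :: "real measure \<Rightarrow> real \<Rightarrow> real" where
  "distr_fun \<mu> x = measure \<mu> {..<x}"

definition measure_of_distr_fun :: "(real \<Rightarrow> real) \<Rightarrow> real measure" where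
  "measure_of_distr_fun F =
     (THE \<mu>. sets \<mu> = sets borel \<and> finite_measure \<mu> \<and> distr_fun \<mu> = F)"

text \<open>A finite Borel measure on the real line is automatically a Radon measure.\<close>

definition eulerian :: "((real \<Rightarrow> real) \<times> real measure) set" where
  "eulerian = {(u, \<mu>). u \<in> E2 \<and> sets \<mu> = sets borel \<and> finite_measure \<mu> \<and>
     distr_fun \<mu> \<in> E10 \<and>
     (\<exists>\<mu>ac \<mu>sing. lebesgue_decomposition \<mu> \<mu>ac \<mu>sing \<and>
        \<mu>ac = density lborel (\<lambda>x. ennreal ((wderiv u x)\<^sup>2)))}"

section \<open>The alpha-dissipative solution operator\<close>

type_synonym lagr = "(real \<Rightarrow> real) \<times> (real \<Rightarrow> real) \<times> (real \<Rightarrow> real)"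

definition L_map :: "(real \<Rightarrow> real) \<times> real measure \<Rightarrow> lagr" where
  "L_map = (\<lambda>(u, \<mu>).
     let y = (\<lambda>\<xi>. Sup {x. x + measure \<mu> {..<x} < \<xi>})
     in (y, (\<lambda>\<xi>. u (y \<xi>)), (\<lambda>\<xi>. \<xi> - y \<xi>)))"

definition breaking_time :: "lagr \<Rightarrow> real \<Rightarrow> ereal" where
  "breaking_time = (\<lambda>(y, U, V) \<xi>.
     if wderiv U \<xi> = 0 \<and> wderiv y \<xi> = 0 then 0
     else if wderiv U \<xi> < 0 then ereal (- 2 * wderiv y \<xi> / wderiv U \<xi>)
     else \<infinity>)"

text \<open>
  \<open>V\<close> may jump in time (a set of positive measure may break simultaneously), so the equation for
  \<open>U\<^sub>t\<close> is understood in integrated form, i.e. for almost every time.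
\<close>

definition is_solution ::
  "real \<Rightarrow> lagr \<Rightarrow> (real \<Rightarrow> real \<Rightarrow> real) \<Rightarrow> (real \<Rightarrow> real \<Rightarrow> real) \<Rightarrow> (real \<Rightarrow> real \<Rightarrow> real) \<Rightarrow> bool"
  where
  "is_solution \<alpha> X y U V \<longleftrightarrow> (case X of (y0, U0, V0) \<Rightarrow>
     (\<exists>Vinf :: real \<Rightarrow> real.
       (\<forall>\<xi>. y 0 \<xi> = y0 \<xi>) \<and>
       (\<forall>t\<ge>0. \<forall>\<xi>. ((\<lambda>s. y s \<xi>) has_real_derivative U t \<xi>) (at t within {0..})) \<and>
       (\<forall>t\<ge>0. \<forall>\<xi>. ((\<lambda>s. V s \<xi> / 2 - Vinf s / 4) has_integral (U t \<xi> - U0 \<xi>)) {0..t}) \<and>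
       (\<forall>t\<ge>0. \<forall>\<xi>. V t \<xi> = (LINT \<eta>:{..\<xi>}|lborel.
          (1 - \<alpha> * indicator {\<omega>. ereal t \<ge> breaking_time X \<omega> \<and> breaking_time X \<omega> > 0} \<eta>)
            * wderiv V0 \<eta>)) \<and>
       (\<forall>t\<ge>0. (V t \<longlongrightarrow> Vinf t) at_top)))"

definition S_op :: "real \<Rightarrow> real \<Rightarrow> lagr \<Rightarrow> lagr" where
  "S_op \<alpha> t X = (THE Z. \<exists>y U V. is_solution \<alpha> X y U V \<and> Z = (y t, U t, V t))"

definition M_map :: "lagr \<Rightarrow> (real \<Rightarrow> real) \<times> real measure" where
  "M_map = (\<lambda>(y, U, V).
     ((\<lambda>x. THE v. \<forall>\<xi>. x = y \<xi> \<longrightarrow> v = U \<xi>),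
      distr (density lborel (\<lambda>\<xi>. ennreal (wderiv V \<xi>))) borel y))"

definition T_op ::
  "real \<Rightarrow> real \<Rightarrow> (real \<Rightarrow> real) \<times> real measure \<Rightarrow> (real \<Rightarrow> real) \<times> real measure" where
  "T_op \<alpha> t = M_map \<circ> S_op \<alpha> t \<circ> L_map"

section \<open>The projection operator\<close>

definition grid :: "real \<Rightarrow> int \<Rightarrow> real" where
  "grid dx j = of_int j * dx"

definition D_even :: "real \<Rightarrow> (real \<Rightarrow> real) \<Rightarrow> int \<Rightarrow> real" where
  "D_even dx f j = (f (grid dx (2*j + 2)) - f (grid dx (2*j))) / (2 * dx)"

definition q_even :: "real \<Rightarrow> (real \<Rightarrow> real) \<Rightarrow> (real \<Rightarrow> real) \<Rightarrow> int \<Rightarrow> real" where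
  "q_even dx u Fac j = sqrt (D_even dx Fac j - (D_even dx u j)\<^sup>2)"

text \<open>The unique \<open>j\<close> with \<open>x \<in> (2 j \<Delta>x, (2 j + 2) \<Delta>x]\<close>.\<close>

definition cell :: "real \<Rightarrow> real \<Rightarrow> int" where
  "cell dx x = \<lceil>x / (2 * dx)\<rceil> - 1"

text \<open>The sign \<open>s j = 1\<close> selects the upper, \<open>s j = -1\<close> the lower signs in cell \<open>j\<close>.\<close>

definition proj_u ::
  "(int \<Rightarrow> real) \<Rightarrow> real \<Rightarrow> (real \<Rightarrow> real) \<Rightarrow> (real \<Rightarrow> real) \<Rightarrow> real \<Rightarrow> real" where
  "proj_u s dx u Fac x =
     (let j = cell dx x; Du = D_even dx u j; q = q_even dx u Fac j in
      if x \<le> grid dx (2*j + 1)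
      then u (grid dx (2*j)) + (Du - s j * q) * (x - grid dx (2*j))
      else u (grid dx (2*j + 2)) + (Du + s j * q) * (x - grid dx (2*j + 2)))"

definition proj_Fac ::
  "(int \<Rightarrow> real) \<Rightarrow> real \<Rightarrow> (real \<Rightarrow> real) \<Rightarrow> (real \<Rightarrow> real) \<Rightarrow> real \<Rightarrow> real" where
  "proj_Fac s dx u Fac x =
     (let j = cell dx x; Du = D_even dx u j; q = q_even dx u Fac j in
      if x \<le> grid dx (2*j + 1)
      then Fac (grid dx (2*j)) + (Du - s j * q)\<^sup>2 * (x - grid dx (2*j))
      else (Fac (grid dx (2*j + 2)) + Fac (grid dx (2*j))) / 2 - s j * (2 * q * Du * dx)
             + (Du + s j * q)\<^sup>2 * (x - grid dx (2*j + 1)))"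

definition proj_Fsing :: "real \<Rightarrow> (real \<Rightarrow> real) \<Rightarrow> real \<Rightarrow> real" where
  "proj_Fsing dx Fsing x = Fsing (grid dx (2 * cell dx x + 2))"

definition P_op ::
  "(int \<Rightarrow> real) \<Rightarrow> real \<Rightarrow> (real \<Rightarrow> real) \<times> real measure \<Rightarrow> (real \<Rightarrow> real) \<times> real measure" where
  "P_op s dx = (\<lambda>(u, \<mu>).
     let Fac = distr_fun (ac_part \<mu>); Fsing = distr_fun (sing_part \<mu>) in
     (proj_u s dx u Fac,
      measure_of_distr_fun (\<lambda>x. proj_Fac s dx u Fac x + proj_Fsing dx Fsing x)))"

end

theory Submission
  imports Defs "HOL-Probability.Distribution_Functions"
begin

text \<open>
  In Lagrangian coordinates the solution is explicit. With \<open>v = u\<^sub>x\<close> and \<open>y0, U0, V0\<close> the initial data, the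
  energy dissipated to the left of \<open>\<xi>\<close> by time \<open>t\<close> is \<open>\<alpha>\<close> times the integral of \<open>v\<^sup>2\<close> over
  \<open>{x \<le> y0 \<xi>. t v x \<le> -2}\<close>. This is discontinuous in \<open>v\<close>, but its time integral is the integral of
  \<open>k1 t \<circ> v\<close> with \<open>k1 t a = - a max 0 (- t a - 2)\<close>, and \<open>k1\<close> satisfies
  \<open>\<bar>k1 t a - k1 t b\<bar> \<le> t \<bar>a - b\<bar> (\<bar>a\<bar> + \<bar>b\<bar>)\<close>. So \<open>U\<close> and \<open>y\<close> depend on the initial slopes in a locally Lipschitz
  way with respect to the \<open>L\<^sup>2\<close> norm.

  On every cell the projected slope has the same mean and the same energy as \<open>v\<close>, so its \<open>L\<^sup>2\<close> distance
  to \<open>v\<close> is controlled by the oscillation of \<open>v\<close> on the cells, hence by the translation bound, and is of order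
  \<open>dx powr \<beta>\<close>. Both initial characteristics lie in a common cell, and the energy of \<open>v\<close> in one cell is small by
  averaging over translations. Finally the Eulerian solution is Hoelder continuous of exponent \<open>1/2\<close>, because
  \<open>(\<Delta>U)\<^sup>2 \<le> \<Delta>y \<Delta>V\<close> persists in time, which costs a square root in the last estimate.
\<close>

section \<open>Weak derivatives and primitives\<close>

text \<open>The breaking time is defined through \<open>wderiv\<close>, an arbitrary representative,
  so it can only be computed almost everywhere. This is why everything passes through
  \<open>primitive_of\<close>: for continuous functions it is equivalent to having a weak
  derivative, it determines that derivative almost everywhere, and it can be read off from a change
  of variables. With the densities \<open>w (y0 \<xi>)\<close> of \<open>y0\<close> and
  \<open>v (y0 \<xi>) * w (y0 \<xi>)\<close> of \<open>U0\<close>, the breaking time is -2 / v where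
  v < 0. Labels carrying singular mass have \<open>w = 0\<close>, hence breaking time 0, and never
  dissipate. The original and the projected data are two instances of one locale, so each fact about
  the explicit solution is proved once and used twice. The errors that occur are of order dx powr
  \<beta> (slopes), sqrt dx (Hoelder bound inside a cell) and the larger of these two (energy of one
  cell). The exponent \<beta>/4 is a common weaker one.\<close>

definition primitive_of :: "(real \<Rightarrow> real) \<Rightarrow> (real \<Rightarrow> real) \<Rightarrow> bool" where
  "primitive_of f g \<longleftrightarrow> locally_integrable g \<and>
     (\<forall>a b. a \<le> b \<longrightarrow> f b - f a = (LINT x:{a..b}|lborel. g x))"

lemma locally_integrableD: "locally_integrable g \<Longrightarrow> set_integrable lborel {a..b} g"
  by (simp add: locally_integrable_def)

lemma locally_integrable_measurable:
  assumes "locally_integrable g"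
  shows "g \<in> borel_measurable borel"
proof (rule borel_measurable_LIMSEQ_real)
  show "(\<lambda>x. indicator {- real n..real n} x *\<^sub>R g x) \<in> borel_measurable borel" for n
    using assms[unfolded locally_integrable_def set_integrable_def, rule_format, of "- real n" "real n"]
    by (auto dest: borel_measurable_integrable)
  fix x
  obtain m :: nat where m: "\<bar>x\<bar> \<le> real m" using real_arch_simple by blast
  have "eventually (\<lambda>n. indicator {- real n..real n} x *\<^sub>R g x = g x) sequentially"
    using eventually_ge_at_top[of m]
  proof eventually_elim
    case (elim n)
    then have "real m \<le> real n" by simp
    with m have "x \<in> {- real n..real n}" by auto
    then show ?case by simp
  qed
  then show "(\<lambda>n. indicator {- real n..real n} x *\<^sub>R g x) \<longlonglongrightarrow> g x"
    by (rule tendsto_eventually)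
qed

lemma continuous_imp_locally_integrable:
  "continuous_on UNIV f \<Longrightarrow> locally_integrable f"
  unfolding locally_integrable_def
  by (meson borel_integrable_atLeastAtMost' continuous_on_subset subset_UNIV)

lemma square_integrable_imp_locally_integrable:
  assumes "square_integrable f"
  shows "locally_integrable f"
  unfolding locally_integrable_def
proof (intro allI)
  fix a b :: real
  have m [measurable]: "f \<in> borel_measurable borel" and i: "integrable lborel (\<lambda>x. (f x)\<^sup>2)"
    using assms by (auto simp: square_integrable_def)
  have "integrable lborel (\<lambda>x. indicator {a..b} x + (f x)\<^sup>2)"
    by (intro Bochner_Integration.integrable_add i integrable_real_indicator) (auto simp: emeasure_lborel_Icc_eq)
  then show "set_integrable lborel {a..b} f"
    unfolding set_integrable_def
  proof (rule Bochner_Integration.integrable_bound)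
    have "\<bar>f x\<bar> \<le> 1 + (f x)\<^sup>2" for x
    proof -
      have "0 \<le> (\<bar>f x\<bar> - 1/2)\<^sup>2" by simp
      then show ?thesis by (simp add: power2_eq_square algebra_simps)
    qed
    then show "AE x in lborel. norm (indicat_real {a..b} x *\<^sub>R f x)
        \<le> norm (indicat_real {a..b} x + (f x)\<^sup>2)"
      by (auto simp: indicator_def)
  qed simp
qed

lemma primitive_ofD:
  "primitive_of f g \<Longrightarrow> a \<le> b \<Longrightarrow> f b - f a = (LINT x:{a..b}|lborel. g x)"
  by (simp add: primitive_of_def)

lemma primitive_of_continuous:
  assumes "primitive_of f g"
  shows "continuous_on UNIV f"
proof -
  have "isCont f x" for x
  proof -
    have g: "set_integrable lborel {x-1..x+1} g"
      using assms by (auto simp: primitive_of_def locally_integrable_def)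
    have "continuous_on {x-1..x+1} (\<lambda>z. f (x-1) + integral {x-1..z} g)"
      by (intro continuous_intros indefinite_integral_continuous_1 set_borel_integral_eq_integral(1) g)
    moreover have "f z = f (x-1) + integral {x-1..z} g" if "z \<in> {x-1..x+1}" for z
    proof -
      have "set_integrable lborel {x-1..z} g"
        using assms by (auto simp: primitive_of_def locally_integrable_def)
      then show ?thesis
        using primitive_ofD[OF assms, of "x-1" z] that set_borel_integral_eq_integral(2)[of "{x-1..z}" g]
        by auto
    qed
    ultimately have "continuous_on {x-1..x+1} f"
      using continuous_on_cong by (metis (no_types, lifting))
    then show ?thesis
      by (rule continuous_on_interior) (auto simp: interior_atLeastAtMost_real)
  qed
  then show ?thesis by (simp add: continuous_at_imp_continuous_on)
qed

text \<open>On a bounded interval the positive parts of g - h and of h - g are densities of two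
  measures that agree on all half-lines, since both integrals of g and h are increments of f. So the
  measures agree, then the densities do, and equal positive parts of z and -z force z = 0.\<close>

lemma primitive_of_AE_unique:
  assumes 1: "primitive_of f g" and 2: "primitive_of f h"
  shows "AE x in lborel. g x = h x"
proof -
  have [measurable]: "g \<in> borel_measurable borel" "h \<in> borel_measurable borel"
    using assms by (auto simp: primitive_of_def intro: locally_integrable_measurable)
  have gi: "set_integrable lborel {a..b} g" and hi: "set_integrable lborel {a..b} h" for a b
    using assms by (auto simp: primitive_of_def locally_integrable_def)
  have *: "AE x\<in>{a..b} in lborel. g x = h x" if ab: "a \<le> b" for a b :: real
  proof -
    let ?M = "\<lambda>G. density lborel (\<lambda>x. ennreal (max 0 (G x)) * indicator {a..b} x)"
    have d: "set_integrable lborel {c..d} (\<lambda>x. g x - h x)" "set_integrable lborel {c..d} (\<lambda>x. h x - g x)" for c d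
      using gi hi by (auto intro: set_integral_diff)
    have e: "emeasure (?M G) {x<..} = ennreal (LINT z:{max a x..b}|lborel. max 0 (G z))"
      and ip: "set_integrable lborel {c..d} (\<lambda>x. max 0 (G x))"
      if G: "\<And>c d. set_integrable lborel {c..d} G" and [measurable]: "G \<in> borel_measurable borel" for G x c d
    proof -
      show ip: "set_integrable lborel {c..d} (\<lambda>x. max 0 (G x))" for c d
        by (rule set_integrable_bound[OF G[of c d]]) (auto simp: set_borel_measurable_def)
      have "emeasure (?M G) {x<..} = (\<integral>\<^sup>+z. ennreal (indicator {max a x..b} z *\<^sub>R max 0 (G z)) \<partial>lborel)"
        by (subst emeasure_density, simp, simp, rule nn_integral_cong_AE)
          (use AE_lborel_singleton[of x] in \<open>eventually_elim, auto simp: indicator_def\<close>)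
      also have "\<dots> = ennreal (LINT z:{max a x..b}|lborel. max 0 (G z))"
        using ip unfolding set_lebesgue_integral_def set_integrable_def
        by (intro nn_integral_eq_integral) auto
      finally show "emeasure (?M G) {x<..} = ennreal (LINT z:{max a x..b}|lborel. max 0 (G z))" .
    qed
    have eq: "?M (\<lambda>x. g x - h x) = ?M (\<lambda>x. h x - g x)"
    proof (rule measure_eqI_lessThan)
      show "emeasure (?M (\<lambda>x. g x - h x)) {x<..} < \<infinity>" for x using d by (simp add: e)
      show "emeasure (?M (\<lambda>x. g x - h x)) {x<..} = emeasure (?M (\<lambda>x. h x - g x)) {x<..}" for x
      proof (cases "max a x \<le> b")
        case True
        have "(LINT z:{max a x..b}|lborel. max 0 (g z - h z)) - (LINT z:{max a x..b}|lborel. max 0 (h z - g z))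
            = (LINT z:{max a x..b}|lborel. g z - h z)"
          by (subst set_integral_diff(2)[symmetric, OF ip ip]) (use d in \<open>auto intro!: set_lebesgue_integral_cong\<close>)
        also have "\<dots> = 0"
          using set_integral_diff(2)[OF gi hi] primitive_ofD[OF 1 True] primitive_ofD[OF 2 True] by simp
        finally show ?thesis using d by (simp add: e)
      qed (use d in \<open>auto simp: e set_lebesgue_integral_def\<close>)
    qed simp_all
    have "AE x in lborel. ennreal (max 0 (g x - h x)) * indicator {a..b} x = ennreal (max 0 (h x - g x)) * indicator {a..b} x"
      by (rule sigma_finite_measure.density_unique[OF sigma_finite_lborel _ _ eq]) auto
    then show ?thesis
      by eventually_elim (auto simp: indicator_def max_def split: if_splits)
  qed
  have "AE x in lborel. \<forall>n::nat. x \<in> {- real n..real n} \<longrightarrow> g x = h x"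
    unfolding AE_all_countable using * by auto
  then show ?thesis
  proof eventually_elim
    case (elim x)
    obtain m :: nat where m: "\<bar>x\<bar> \<le> real m" using real_arch_simple by blast
    then have "x \<in> {- real m..real m}" by auto
    then show ?case using elim by blast
  qed
qed

lemma primitive_of_add:
  assumes 1: "primitive_of f g" and 2: "primitive_of f' g'"
  shows "primitive_of (\<lambda>x. f x + f' x) (\<lambda>x. g x + g' x)"
proof -
  have gi: "set_integrable lborel {a..b} g" and hi: "set_integrable lborel {a..b} g'" for a b
    using assms by (auto simp: primitive_of_def locally_integrable_def)
  show ?thesis unfolding primitive_of_def locally_integrable_def
    using gi hi by (auto simp: set_integral_add primitive_ofD[OF 1,symmetric] primitive_ofD[OF 2,symmetric])
qed

lemma primitive_of_cmult:
  assumes 1: "primitive_of f g"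
  shows "primitive_of (\<lambda>x. c * f x) (\<lambda>x. c * g x)"
proof -
  have gi: "set_integrable lborel {a..b} g" for a b
    using assms by (auto simp: primitive_of_def locally_integrable_def)
  show ?thesis unfolding primitive_of_def locally_integrable_def
    using gi by (auto simp: primitive_ofD[OF 1,symmetric] right_diff_distrib)
qed

section \<open>Smooth functions and cut-offs\<close>

lemma smooth_deriv:
  assumes "smooth f"
  shows "(f has_real_derivative deriv f x) (at x)" "continuous_on A (deriv f)" "continuous_on A f"
proof -
  have "f differentiable_on UNIV" "deriv f differentiable_on UNIV"
    using assms[unfolded smooth_def, rule_format, of 0] assms[unfolded smooth_def, rule_format, of 1] by auto
  then show "(f has_real_derivative deriv f x) (at x)" "continuous_on A (deriv f)" "continuous_on A f"
    by (auto simp: differentiable_on_def DERIV_deriv_iff_real_differentiable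
       intro: differentiable_imp_continuous_within continuous_at_imp_continuous_on)
qed

lemma FTC_LINT:
  fixes f :: "real \<Rightarrow> real"
  assumes "\<And>x. (f has_real_derivative f' x) (at x)" "continuous_on UNIV f'" "a \<le> b"
  shows "(LINT x:{a..b}|lborel. f' x) = f b - f a"
  unfolding set_lebesgue_integral_def
  by (rule integral_FTC_atLeastAtMost[OF assms(3)])
    (auto simp: has_real_derivative_iff_has_vector_derivative[symmetric]
       intro: DERIV_subset[OF assms(1)] continuous_on_subset[OF assms(2)])

lemma smooth_primitive_of: "smooth f \<Longrightarrow> primitive_of f (deriv f)"
  unfolding primitive_of_def
  by (auto intro!: FTC_LINT[symmetric] smooth_deriv(1) smooth_deriv(2) continuous_imp_locally_integrable)

text \<open>The n-th derivative only picks up a factor \<open>c ^ n\<close>. The rescaled cut-offs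
  used as test functions are of this form.\<close>

lemma smooth_affine:
  assumes "smooth f"
  shows "smooth (\<lambda>x. f (c * x + d))"
proof -
  have d: "((deriv ^^ n) f has_real_derivative (deriv ^^ Suc n) f x) (at x)" for n x
    using assms[unfolded smooth_def, rule_format, of n]
    by (auto simp: differentiable_on_def DERIV_deriv_iff_real_differentiable)
  have e: "((\<lambda>x. c ^ n * (deriv ^^ n) f (c * x + d)) has_real_derivative
      c ^ Suc n * (deriv ^^ Suc n) f (c * x + d)) (at x)" for n x
    by (rule derivative_eq_intros DERIV_chain2[OF d] refl | simp)+
  have "(deriv ^^ n) (\<lambda>x. f (c * x + d)) = (\<lambda>x. c ^ n * (deriv ^^ n) f (c * x + d))" for n
  proof (induction n)
    case (Suc n)
    have "deriv (\<lambda>x. c ^ n * (deriv ^^ n) f (c * x + d)) = (\<lambda>x. c ^ Suc n * (deriv ^^ Suc n) f (c * x + d))"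
      using e by (intro ext DERIV_imp_deriv)
    then show ?case by (simp add: Suc)
  qed simp
  then show ?thesis
    unfolding smooth_def differentiable_on_def using e real_differentiable_def by fastforce
qed

lemma smooth_diff:
  assumes "smooth f" "smooth g"
  shows "smooth (\<lambda>x. f x - g x)"
proof -
  have df: "((deriv ^^ n) f has_real_derivative (deriv ^^ Suc n) f x) (at x)" for n x
    using assms(1)[unfolded smooth_def, rule_format, of n]
    by (auto simp: differentiable_on_def DERIV_deriv_iff_real_differentiable)
  have dg: "((deriv ^^ n) g has_real_derivative (deriv ^^ Suc n) g x) (at x)" for n x
    using assms(2)[unfolded smooth_def, rule_format, of n]
    by (auto simp: differentiable_on_def DERIV_deriv_iff_real_differentiable)
  have e: "((\<lambda>x. (deriv ^^ n) f x - (deriv ^^ n) g x) has_real_derivative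
      (deriv ^^ Suc n) f x - (deriv ^^ Suc n) g x) (at x)" for n x
    by (rule DERIV_diff df dg)+
  have "(deriv ^^ n) (\<lambda>x. f x - g x) = (\<lambda>x. (deriv ^^ n) f x - (deriv ^^ n) g x)" for n
  proof (induction n)
    case (Suc n)
    have "deriv (\<lambda>x. (deriv ^^ n) f x - (deriv ^^ n) g x) = (\<lambda>x. (deriv ^^ Suc n) f x - (deriv ^^ Suc n) g x)"
      using e by (intro ext DERIV_imp_deriv)
    then show ?case by (simp add: Suc)
  qed simp
  then show ?thesis
    unfolding smooth_def differentiable_on_def using e real_differentiable_def by fastforce
qed


text \<open>The supports are closed sets inside open half-lines, so the constant values are attained
  at -1 and 1 as well.\<close>

lemma cutoff_pair_values:
  assumes "cutoff_pair \<psi> \<psi>'"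
  shows "smooth \<psi>" "x \<le> -1 \<Longrightarrow> \<psi> x = 0" "1 \<le> x \<Longrightarrow> \<psi> x = 1" "\<bar>\<psi> x\<bar> \<le> 1"
    "\<bar>x\<bar> > 1 \<Longrightarrow> deriv \<psi> x = 0"
proof -
  have c: "smooth \<psi>" "\<psi> x + \<psi>' x = 1" "0 \<le> \<psi> x" "\<psi> x \<le> 1" "supp \<psi> \<subseteq> {-1<..}" "supp \<psi>' \<subseteq> {..<1}" for x
    using assms by (auto simp: cutoff_pair_def)
  have z: "\<psi> x = 0" if "x \<le> -1" for x
    using c(5) that closure_subset[of "{x. \<psi> x \<noteq> 0}"] by (force simp: supp_def)
  have z': "\<psi> x = 1" if "1 \<le> x" for x
  proof -
    have "\<psi>' x = 0" using c(6) that closure_subset[of "{x. \<psi>' x \<noteq> 0}"] by (force simp: supp_def)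
    then show ?thesis using c(2)[of x] by simp
  qed
  show "smooth \<psi>" "x \<le> -1 \<Longrightarrow> \<psi> x = 0" "1 \<le> x \<Longrightarrow> \<psi> x = 1" "\<bar>\<psi> x\<bar> \<le> 1"
    using c z z' by auto
  assume "\<bar>x\<bar> > 1"
  then consider "x < -1" | "x > 1" by linarith
  then show "deriv \<psi> x = 0"
  proof cases
    case 1
    have "((\<lambda>x. 0) has_field_derivative 0) (at x)" by simp
    then have "(\<psi> has_field_derivative 0) (at x)"
      by (rule has_field_derivative_transform_within_open[of _ _ _ "{..<-1}"]) (use 1 z in auto)
    then show ?thesis by (rule DERIV_imp_deriv)
  next
    case 2
    have "((\<lambda>x. 1) has_field_derivative 0) (at x)" by simp
    then have "(\<psi> has_field_derivative 0) (at x)"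
      by (rule has_field_derivative_transform_within_open[of _ _ _ "{1<..}"]) (use 2 z' in auto)
    then show ?thesis by (rule DERIV_imp_deriv)
  qed
qed

lemma integrable_tensor:
  fixes p q :: "real \<Rightarrow> real"
  assumes "integrable lborel p" "integrable lborel q"
  shows "integrable (lborel \<Otimes>\<^sub>M lborel) (\<lambda>(x, y). p x * q y)"
proof (rule lborel_pair.Fubini_integrable)
  show "(\<lambda>(x, y). p x * q y) \<in> borel_measurable (lborel \<Otimes>\<^sub>M lborel)"
    using assms[THEN borel_measurable_integrable] by measurable
  show "integrable lborel (\<lambda>x. LINT y|lborel. norm (case (x, y) of (x, y) \<Rightarrow> p x * q y))"
    using assms(1) by (simp add: abs_mult)
  show "AE x in lborel. integrable lborel (\<lambda>y. case (x, y) of (x, y) \<Rightarrow> p x * q y)"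
    using assms(2) by simp
qed

text \<open>Integration by parts through Fubini: the kernel \<phi>'(x) g(z) on z \<le> x, integrated
  first in z, gives \<phi>'(x) (f(x) - f(-b)), and integrated first in x gives -g(z) \<phi>(z). The
  constant f(-b) drops out because \<phi>' has integral 0.\<close>

lemma primitive_of_imp_weak_deriv:
  assumes fg: "primitive_of f g"
  shows "has_weak_deriv f g"
  unfolding has_weak_deriv_def
proof (intro conjI allI impI)
  have cf: "continuous_on UNIV f" using fg by (rule primitive_of_continuous)
  show "locally_integrable f" using cf by (rule continuous_imp_locally_integrable)
  show gl: "locally_integrable g" using fg by (simp add: primitive_of_def)
  have [measurable]: "f \<in> borel_measurable borel" "g \<in> borel_measurable borel"
    using cf gl by (auto intro: locally_integrable_measurable borel_measurable_continuous_onI)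
  fix \<phi> :: "real \<Rightarrow> real" assume \<phi>: "smooth \<phi> \<and> compact (supp \<phi>)"
  then obtain R where R: "\<And>x. x \<in> supp \<phi> \<Longrightarrow> \<bar>x\<bar> \<le> R"
    using compact_imp_bounded bounded_real by metis
  \<comment> \<open>The extra 1 puts -b and b strictly outside the support, so \<phi> vanishes
    there.\<close>
  define b where "b = \<bar>R\<bar> + 1"
  have b: "0 < b" by (simp add: b_def)
  have s: "smooth \<phi>" using \<phi> by auto
  have d\<phi>: "(\<phi> has_real_derivative deriv \<phi> x) (at x)" and c': "continuous_on UNIV (deriv \<phi>)" for x
    using smooth_deriv[OF s] by auto
  have [measurable]: "\<phi> \<in> borel_measurable borel" "deriv \<phi> \<in> borel_measurable borel"
    using smooth_deriv[OF s] by (auto intro: borel_measurable_continuous_onI)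
  have z: "\<phi> x = 0" if "\<bar>x\<bar> > \<bar>R\<bar>" for x
    using that R[of x] closure_subset[of "{x. \<phi> x \<noteq> 0}"] by (force simp: supp_def)
  have z': "deriv \<phi> x = 0" if "\<bar>x\<bar> > \<bar>R\<bar>" for x
  proof (rule DERIV_imp_deriv)
    have "((\<lambda>x. 0) has_field_derivative 0) (at x)" by simp
    then show "(\<phi> has_field_derivative 0) (at x)"
      by (rule has_field_derivative_transform_within_open[of _ _ _ "- {-\<bar>R\<bar>..\<bar>R\<bar>}"]) (use that z in \<open>auto simp: open_Compl\<close>)
  qed
  let ?p = "\<lambda>x. indicator {-b..b} x * deriv \<phi> x" and ?q = "\<lambda>x. indicator {-b..b} x * g x"
  have p: "integrable lborel ?p"
    using continuous_imp_locally_integrable[OF c'] by (simp add: locally_integrable_def set_integrable_def)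
  have q: "integrable lborel ?q"
    using gl by (simp add: locally_integrable_def set_integrable_def)
  let ?K = "\<lambda>x z. ?p x * ?q z * (if z \<le> x then 1 else 0)"
  have K: "integrable (lborel \<Otimes>\<^sub>M lborel) (case_prod ?K)"
    by (rule Bochner_Integration.integrable_bound[OF integrable_tensor[OF p q]]) auto
  have in1: "(LINT z|lborel. ?K x z) = ?p x * f x - ?p x * f (-b)" for x
  proof (cases "x \<in> {-b..b}")
    case True
    have "(LINT z|lborel. ?K x z) = ?p x * (LINT z:{-b..x}|lborel. g z)"
      unfolding set_lebesgue_integral_def integral_mult_right_zero[symmetric]
      by (rule Bochner_Integration.integral_cong) (use True in \<open>auto simp: indicator_def\<close>)
    then show ?thesis using primitive_ofD[OF fg, of "-b" x, symmetric] True by (simp add: right_diff_distrib)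
  qed simp
  have in2: "(LINT x|lborel. ?K x z) = - (g z * \<phi> z)" for z
  proof (cases "z \<in> {-b..b}")
    case True
    have "(LINT x|lborel. ?K x z) = g z * (LINT x:{z..b}|lborel. deriv \<phi> x)"
      unfolding set_lebesgue_integral_def integral_mult_right_zero[symmetric]
      by (rule Bochner_Integration.integral_cong) (use True in \<open>auto simp: indicator_def\<close>)
    also have "(LINT x:{z..b}|lborel. deriv \<phi> x) = \<phi> b - \<phi> z"
      by (rule FTC_LINT[OF d\<phi> c']) (use True in auto)
    also have "\<phi> b = 0" by (rule z) (simp add: b_def)
    finally show ?thesis by simp
  next
    case False
    then have "\<phi> z = 0" by (intro z) (auto simp: b_def)
    then show ?thesis using False by simp
  qed
  have pf: "integrable lborel (\<lambda>x. ?p x * f x)"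
    using borel_integrable_atLeastAtMost'[of "-b" b "\<lambda>x. deriv \<phi> x * f x"]
    by (auto simp: set_integrable_def mult.assoc intro!: continuous_intros continuous_on_subset[OF cf] continuous_on_subset[OF c'])
  have "(LINT x|lborel. f x * deriv \<phi> x) = (LINT x|lborel. ?p x * f x)"
    by (rule Bochner_Integration.integral_cong) (auto simp: indicator_def b_def intro: z')
  also have "\<dots> = (LINT x|lborel. ?p x * f x - ?p x * f (-b))"
  proof -
    have "(LINT x|lborel. ?p x) = 0"
      using FTC_LINT[OF d\<phi> c', of "-b" b] z[of b] z[of "-b"] by (simp add: set_lebesgue_integral_def b_def)
    then show ?thesis
      using p pf by simp
  qed
  also have "\<dots> = (LINT x|lborel. LINT z|lborel. ?K x z)"
    by (simp only: in1)
  also have "\<dots> = (LINT z|lborel. LINT x|lborel. ?K x z)"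
    by (rule lborel_pair.Fubini_integral[OF K, symmetric])
  also have "\<dots> = - (LINT z|lborel. g z * \<phi> z)"
    by (simp only: in2 Bochner_Integration.integral_minus)
  finally show "(LINT x|lborel. f x * deriv \<phi> x) = - (LINT x|lborel. g x * \<phi> x)" .
qed

text \<open>The test functions are differences of rescaled copies of the cut-off function; they
  converge to the indicator function of \<open>[a, b]\<close>.\<close>

lemma weak_deriv_imp_primitive_of:
  assumes cp: "cutoff_pair \<psi> \<psi>'" and w: "has_weak_deriv f g" and cf: "continuous_on UNIV f"
  shows "primitive_of f g"
  unfolding primitive_of_def
proof (intro conjI allI impI)
  show gl: "locally_integrable g" using w by (simp add: has_weak_deriv_def)
  have [measurable]: "f \<in> borel_measurable borel" "g \<in> borel_measurable borel"
    using cf gl by (auto intro: locally_integrable_measurable borel_measurable_continuous_onI)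
  note \<psi> = cutoff_pair_values[OF cp]
  have d\<psi>: "(\<psi> has_real_derivative deriv \<psi> x) (at x)" and c': "continuous_on A (deriv \<psi>)" for x A
    using smooth_deriv[OF \<psi>(1)] by auto
  have [measurable]: "\<psi> \<in> borel_measurable borel" "deriv \<psi> \<in> borel_measurable borel"
    using smooth_deriv[OF \<psi>(1)] by (auto intro: borel_measurable_continuous_onI)
  fix a b :: real assume "a \<le> b"
  define h where "h n = 1 / real (Suc n)" for n
  have h: "0 < h n" "h n \<le> 1" for n by (auto simp: h_def)
  have h0: "h \<longlonglongrightarrow> 0" unfolding h_def by (rule LIMSEQ_Suc[OF lim_1_over_n])
  define S where "S c n x = \<psi> ((x - c) / h n)" for c n x
  define \<phi> where "\<phi> n x = S a n x - S b n x" for n x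
  have smS: "smooth (S c n)" for c n
    using smooth_affine[OF \<psi>(1), of "1 / h n" "- c / h n"]
    by (simp add: S_def[abs_def] diff_divide_distrib)
  have dS: "deriv (S c n) = (\<lambda>x. deriv \<psi> ((x - c) / h n) / h n)" for c n
  proof (rule ext, rule DERIV_imp_deriv)
    show "(S c n has_real_derivative deriv \<psi> ((x - c) / h n) / h n) (at x)" for x
    proof -
      have "((\<lambda>x. (x - c) / h n) has_real_derivative 1 / h n) (at x)"
        using h(1)[of n] by (auto intro!: derivative_eq_intros)
      from DERIV_chain2[OF d\<psi> this] show ?thesis by (simp add: S_def[abs_def])
    qed
  qed
  have sm: "smooth (\<phi> n)" for n
    unfolding \<phi>_def[abs_def] by (intro smooth_diff smS)
  have \<phi>z: "\<phi> n x = 0" if "x \<le> a - h n \<or> b + h n \<le> x" for n x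
    using that h[of n] \<open>a \<le> b\<close> by (auto simp: \<phi>_def S_def \<psi> field_simps)
  have "supp (\<phi> n) \<subseteq> {a - 1..b + 1}" for n
    unfolding supp_def
  proof (rule closure_minimal)
    show "{x. \<phi> n x \<noteq> 0} \<subseteq> {a - 1..b + 1}"
    proof
      fix x assume "x \<in> {x. \<phi> n x \<noteq> 0}"
      then have "\<not> (x \<le> a - h n \<or> b + h n \<le> x)" using \<phi>z by blast
      then show "x \<in> {a - 1..b + 1}" using h(2)[of n] by auto
    qed
  qed simp
  then have cmp: "compact (supp (\<phi> n))" for n
    unfolding compact_eq_bounded_closed
    by (auto simp: supp_def intro: bounded_subset[OF bounded_closed_interval])
  have id: "(LINT x|lborel. f x * deriv (\<phi> n) x) = - (LINT x|lborel. g x * \<phi> n x)" for n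
    using w sm cmp by (auto simp: has_weak_deriv_def)
  have d\<phi>: "deriv (\<phi> n) x = deriv (S a n) x - deriv (S b n) x" for n x
    unfolding \<phi>_def[abs_def]
    by (rule DERIV_imp_deriv, rule DERIV_diff; rule smooth_deriv(1)[OF smS])
  \<comment> \<open>The derivative of \<open>S c n\<close> is an approximate identity at c:
    substituting x = c + h n * z turns the integral into that of f (c + h n * z) times \<psi>'(z),
    and \<psi>' has integral 1 and lives on [-1, 1].\<close>
  have fc: "(\<lambda>n. LINT x|lborel. f x * deriv (S c n) x) \<longlonglongrightarrow> f c"
    and fi: "integrable lborel (\<lambda>x. f x * deriv (S c n) x)" for c n
  proof -
    have "compact (f ` {c-1..c+1})"
      by (intro compact_continuous_image continuous_on_subset[OF cf]) auto
    then obtain B where B: "\<And>x. x \<in> {c-1..c+1} \<Longrightarrow> \<bar>f x\<bar> \<le> B"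
      by (metis bounded_real compact_imp_bounded imageI)
    have sub: "f x * deriv (S c n) x = (\<lambda>z. f (c + h n * z) * deriv \<psi> z / h n) (- c / h n + (1 / h n) * x)" for n x
    proof -
      have "c + h n * (- c / h n + (1 / h n) * x) = x" "(x - c) / h n = - c / h n + (1 / h n) * x"
        using h(1)[of n] by (auto simp: field_simps)
      then show ?thesis by (simp only: dS times_divide_eq_right)
    qed
    have bd: "\<bar>f (c + h n * z) * deriv \<psi> z\<bar> \<le> B * (indicator {-1..1} z * \<bar>deriv \<psi> z\<bar>)" for n z
    proof (cases "\<bar>z\<bar> > 1")
      case False
      then have "\<bar>h n * z\<bar> \<le> 1" using h[of n] by (auto simp: abs_mult intro: mult_le_one)
      then have "\<bar>f (c + h n * z)\<bar> \<le> B" by (intro B) auto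
      then show ?thesis using False by (auto simp: abs_mult indicator_def intro: mult_right_mono)
    qed (simp add: \<psi>)
    have i1: "integrable lborel (\<lambda>z. B * (indicator {-1..1} z * \<bar>deriv \<psi> z\<bar>))"
      using borel_integrable_atLeastAtMost'[of "-1" 1 "\<lambda>x. \<bar>deriv \<psi> x\<bar>"] c'
      by (auto simp: set_integrable_def intro!: continuous_intros)
    have i2: "integrable lborel (\<lambda>z. f (c + h n * z) * deriv \<psi> z)" for n
      by (rule Bochner_Integration.integrable_bound[OF i1]) (simp, rule AE_I2, unfold real_norm_def, rule order_trans[OF bd abs_ge_self])
    show "integrable lborel (\<lambda>x. f x * deriv (S c n) x)"
      unfolding sub
    proof (rule lborel_integrable_real_affine)
      show "integrable lborel (\<lambda>z. f (c + h n * z) * deriv \<psi> z / h n)"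
        by (rule integrable_divide) (rule i2)
    qed (use h(1)[of n] in simp)
    have e: "(LINT x|lborel. f x * deriv (S c n) x) = (LINT z|lborel. f (c + h n * z) * deriv \<psi> z)" for n
    proof -
      have "(LINT x|lborel. f x * deriv (S c n) x) = h n * (LINT z|lborel. f (c + h n * z) * deriv (S c n) (c + h n * z))"
        using lborel_integral_real_affine[of "h n" "\<lambda>x. f x * deriv (S c n) x" c] h(1)[of n] by simp
      also have "\<dots> = (LINT z|lborel. h n * (f (c + h n * z) * deriv (S c n) (c + h n * z)))"
        by simp
      also have "\<dots> = (LINT z|lborel. f (c + h n * z) * deriv \<psi> z)"
        by (rule Bochner_Integration.integral_cong) (use h(1)[of n] in \<open>auto simp: dS\<close>)
      finally show ?thesis .
    qed
    have "(\<lambda>n. LINT z|lborel. f (c + h n * z) * deriv \<psi> z) \<longlonglongrightarrow> (LINT z|lborel. f c * deriv \<psi> z)"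
    proof (rule integral_dominated_convergence[OF _ _ i1])
      show "AE x in lborel. (\<lambda>n. f (c + h n * x) * deriv \<psi> x) \<longlonglongrightarrow> f c * deriv \<psi> x"
      proof (rule AE_I2)
        fix x
        have "(\<lambda>n. c + h n * x) \<longlonglongrightarrow> c + 0 * x" by (intro tendsto_intros h0)
        moreover have "isCont f (c + 0 * x)" using cf by (simp add: continuous_on_eq_continuous_at)
        ultimately have "(\<lambda>n. f (c + h n * x)) \<longlonglongrightarrow> f (c + 0 * x)"
          by (intro isCont_tendsto_compose[of _ f])
        then have "(\<lambda>n. f (c + h n * x)) \<longlonglongrightarrow> f c" by simp
        then show "(\<lambda>n. f (c + h n * x) * deriv \<psi> x) \<longlonglongrightarrow> f c * deriv \<psi> x"
          by (intro tendsto_intros)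
      qed
    next
      show "AE z in lborel. norm (f (c + h n * z) * deriv \<psi> z) \<le> B * (indicator {-1..1} z * \<bar>deriv \<psi> z\<bar>)" for n
        by (rule AE_I2) (simp only: real_norm_def bd)
    qed simp_all
    also have "(LINT z|lborel. f c * deriv \<psi> z) = f c * (LINT z:{-1..1}|lborel. deriv \<psi> z)"
      unfolding set_lebesgue_integral_def integral_mult_right_zero[symmetric]
      by (rule Bochner_Integration.integral_cong) (auto simp: indicator_def intro: \<psi>(5))
    also have "\<dots> = f c"
      using FTC_LINT[OF d\<psi> c', of "-1" 1] by (simp add: \<psi>)
    finally show "(\<lambda>n. LINT x|lborel. f x * deriv (S c n) x) \<longlonglongrightarrow> f c" by (simp add: e)
  qed
  have "(\<lambda>n. LINT x|lborel. f x * deriv (\<phi> n) x) \<longlonglongrightarrow> f a - f b"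
    using tendsto_diff[OF fc[of a] fc[of b]] fi by (simp add: d\<phi> right_diff_distrib)
  then have "(\<lambda>n. - (LINT x|lborel. f x * deriv (\<phi> n) x)) \<longlonglongrightarrow> - (f a - f b)"
    by (rule tendsto_minus)
  then have 1: "(\<lambda>n. LINT x|lborel. g x * \<phi> n x) \<longlonglongrightarrow> f b - f a"
    by (simp add: id)
  \<comment> \<open>At every x other than a and b the value of \<open>\<phi> n x\<close> is
    eventually equal to the indicator, because the transition layers have half-width
    \<open>h n\<close>.\<close>
  have "(\<lambda>n. LINT x|lborel. g x * \<phi> n x) \<longlonglongrightarrow> (LINT x|lborel. indicator {a..b} x * g x)"
  proof (rule integral_dominated_convergence)
    show "integrable lborel (\<lambda>x. 2 * (indicator {a-1..b+1} x * \<bar>g x\<bar>))"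
      using set_integrable_abs[OF locally_integrableD[OF gl, of "a-1" "b+1"]] by (simp add: set_integrable_def)
    show "AE x in lborel. norm (g x * \<phi> n x) \<le> 2 * (indicator {a-1..b+1} x * \<bar>g x\<bar>)" for n
    proof (rule AE_I2)
      fix x
      have "\<bar>\<phi> n x\<bar> \<le> 2" unfolding \<phi>_def S_def
        using \<psi>(4)[of "(x - a) / h n"] \<psi>(4)[of "(x - b) / h n"] by linarith
      moreover have "\<phi> n x = 0" if "x \<notin> {a-1..b+1}"
        using that h(2)[of n] by (intro \<phi>z) auto
      ultimately show "norm (g x * \<phi> n x) \<le> 2 * (indicator {a-1..b+1} x * \<bar>g x\<bar>)"
        using mult_left_mono[of "\<bar>\<phi> n x\<bar>" 2 "\<bar>g x\<bar>"] by (simp add: indicator_def abs_mult)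
    qed
    have ev: "eventually (\<lambda>n. h n < d) sequentially" if "d > 0" for d
      using h0 that by (rule order_tendstoD)
    show "AE x in lborel. (\<lambda>n. g x * \<phi> n x) \<longlonglongrightarrow> indicator {a..b} x * g x"
      using AE_lborel_singleton[of a] AE_lborel_singleton[of b]
    proof eventually_elim
      case (elim x)
      consider "x < a" | "x > b" | "a < x" "x < b" using elim by linarith
      then have "eventually (\<lambda>n. \<phi> n x = indicator {a..b} x) sequentially"
      proof cases
        case 1
        then have "\<phi> n x = indicator {a..b} x" if "h n < a - x" for n
          using that \<phi>z[of x n] by auto
        then show ?thesis using ev[of "a - x"] 1 by (auto elim: eventually_mono)
      next
        case 2
        then have "\<phi> n x = indicator {a..b} x" if "h n < x - b" for n
          using that \<phi>z[of x n] by auto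
        then show ?thesis using ev[of "x - b"] 2 by (auto elim: eventually_mono)
      next
        case 3
        have "eventually (\<lambda>n. h n < min (x - a) (b - x)) sequentially" using 3 by (intro ev) auto
        then show ?thesis
        proof eventually_elim
          case (elim n)
          then show ?case using h(1)[of n] 3 by (simp add: \<phi>_def S_def \<psi> field_simps)
        qed
      qed
      then have "eventually (\<lambda>n. g x * \<phi> n x = indicator {a..b} x * g x) sequentially"
        by (rule eventually_mono) simp
      then show ?case by (rule tendsto_eventually)
    qed
    show "(\<lambda>x. g x * \<phi> n x) \<in> borel_measurable lborel" for n
      by (simp add: \<phi>_def S_def)
  qed simp
  then show "f b - f a = (LINT x:{a..b}|lborel. g x)"
    using LIMSEQ_unique[OF 1] by (simp add: set_lebesgue_integral_def)
qed

text \<open>Since \<open>wderiv\<close> is a choice, it is identified in two moves: some weak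
  derivative exists, and every weak derivative of a continuous function is a density of its
  increments. The cut-off pair supplies the test functions for the second move.\<close>

lemma wderiv_primitive_of:
  assumes "cutoff_pair \<psi> \<psi>'" "primitive_of f g"
  shows "primitive_of f (wderiv f)" "AE x in lborel. wderiv f x = g x"
proof -
  have "has_weak_deriv f (wderiv f)"
    using primitive_of_imp_weak_deriv[OF assms(2)] unfolding wderiv_def
    by (intro someI_ex[of "has_weak_deriv f"] exI)
  then show "primitive_of f (wderiv f)"
    by (rule weak_deriv_imp_primitive_of[OF assms(1) _ primitive_of_continuous[OF assms(2)]])
  then show "AE x in lborel. wderiv f x = g x"
    using assms(2) by (rule primitive_of_AE_unique)
qed

text \<open>Membership in \<open>E2\<close> also provides the cut-off pair that later facts about
  \<open>wderiv\<close> rely on; none is constructed.\<close>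

lemma E2_primitive_of:
  assumes "u \<in> E2"
  shows "\<exists>\<psi> \<psi>'. cutoff_pair \<psi> \<psi>'" "primitive_of u (wderiv u)"
proof -
  obtain \<psi> \<psi>' f a b where c: "cutoff_pair \<psi> \<psi>'" "f \<in> H1" and u: "u = (\<lambda>x. f x + a * \<psi> x + b * \<psi>' x)"
    using assms by (auto simp: E2_def)
  obtain g where "has_weak_deriv f g" "continuous_on UNIV f" using c(2) by (auto simp: H1_def)
  then have f: "primitive_of f g" by (rule weak_deriv_imp_primitive_of[OF c(1)])
  have "smooth \<psi>" "smooth \<psi>'" using c(1) by (auto simp: cutoff_pair_def)
  then have "primitive_of u (\<lambda>x. g x + a * deriv \<psi> x + b * deriv \<psi>' x)"
    unfolding u by (intro primitive_of_add primitive_of_cmult smooth_primitive_of f)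
  with c(1) show "\<exists>\<psi> \<psi>'. cutoff_pair \<psi> \<psi>'" "primitive_of u (wderiv u)"
    by (auto intro: wderiv_primitive_of(1)[OF c(1)])
qed

section \<open>The change to Lagrangian coordinates\<close>

lemma measure_eqI_Ico:
  fixes M N :: "real measure"
  assumes sets: "sets M = sets borel" "sets N = sets borel"
    and fin: "\<And>a b. a < b \<Longrightarrow> emeasure M {a..<b} \<noteq> \<infinity>"
    and eq: "\<And>a b. a < b \<Longrightarrow> emeasure M {a..<b} = emeasure N {a..<b}"
  shows "M = N"
proof (rule measure_eqI_generator_eq)
  let ?E = "range (\<lambda>(a, b). {a..<b::real})"
  show "Int_stable ?E" by (auto simp: Int_stable_def)
  show "?E \<subseteq> Pow UNIV" by auto
  show "emeasure M X = emeasure N X" if "X \<in> ?E" for X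
    using that eq by (auto, metis atLeastLessThan_empty emeasure_empty not_less)
  show "sets M = sigma_sets UNIV ?E" "sets N = sigma_sets UNIV ?E"
    by (simp_all add: sets borel_eq_atLeastLessThan)
  show "range (\<lambda>n::nat. {- real n - 1..<real n + 1}) \<subseteq> ?E" by auto
  show "(\<Union>n::nat. {- real n - 1..<real n + 1}) = UNIV"
  proof (rule equalityI)
    show "UNIV \<subseteq> (\<Union>n::nat. {- real n - 1..<real n + 1})"
    proof
      fix x :: real
      obtain n :: nat where "\<bar>x\<bar> \<le> real n" using real_arch_simple by blast
      then have "x \<in> {- real n - 1..<real n + 1}" by auto
      then show "x \<in> (\<Union>n::nat. {- real n - 1..<real n + 1})" by blast
    qed
  qed simp
  show "emeasure M {- real n - 1..<real n + 1} \<noteq> \<infinity>" for n :: nat by (rule fin) simp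
qed

text \<open>Needed for Lebesgue measure plus \<open>\<mu>\<close>, which is the image of Lebesgue
  measure under \<open>y0\<close>, and for assembling the projected measure.\<close>

definition measure_add :: "'a measure \<Rightarrow> 'a measure \<Rightarrow> 'a measure" where
  "measure_add M N = measure_of (space M) (sets M) (\<lambda>A. emeasure M A + emeasure N A)"

lemma measure_add:
  assumes "sets N = sets M"
  shows sets_measure_add: "sets (measure_add M N) = sets M"
    and emeasure_measure_add: "A \<in> sets M \<Longrightarrow> emeasure (measure_add M N) A = emeasure M A + emeasure N A"
proof -
  show s: "sets (measure_add M N) = sets M"
    by (simp add: measure_add_def sets.sigma_sets_eq)
  assume A: "A \<in> sets M"
  show "emeasure (measure_add M N) A = emeasure M A + emeasure N A"
  proof (rule emeasure_measure_of[OF measure_add_def])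
    show "sets M \<subseteq> Pow (space M)" by (rule sets.space_closed)
    show "A \<in> sets (measure_add M N)" using A s by simp
    show "positive (sets (measure_add M N)) (\<lambda>A. emeasure M A + emeasure N A)"
      by (simp add: positive_def)
    show "countably_additive (sets (measure_add M N)) (\<lambda>A. emeasure M A + emeasure N A)"
      unfolding countably_additive_def s using assms
      by (auto simp: suminf_add[symmetric] suminf_emeasure)
  qed
qed

text \<open>Monotone convergence along [b - n, b]: the finite limit of H at minus infinity bounds
  the integrals of the nonnegative density, so integrability comes with the value.\<close>

lemma primitive_of_integral_atMost:
  assumes H: "primitive_of H f" and nn: "\<And>x. 0 \<le> f x" and lim: "(H \<longlongrightarrow> L) at_bot"
  shows "set_integrable lborel {..b} f" "(LINT x:{..b}|lborel. f x) = H b - L"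
proof -
  have fi: "set_integrable lborel {a..b} f" for a b
    using H by (auto simp: primitive_of_def locally_integrable_def)
  have [measurable]: "f \<in> borel_measurable borel"
    using H by (auto simp: primitive_of_def intro: locally_integrable_measurable)
  let ?f = "\<lambda>n x. indicator {b - real n..b} x *\<^sub>R f x"
  have 1: "integrable lborel (?f n)" for n
    using fi[of "b - real n" b] by (simp add: set_integrable_def)
  have 2: "AE x in lborel. mono (\<lambda>n. ?f n x)"
  proof (intro AE_I2 monoI)
    fix x :: real and m n :: nat assume "m \<le> n"
    then have "real m \<le> real n" by simp
    then show "?f m x \<le> ?f n x" using nn[of x] by (auto simp: indicator_def)
  qed
  have 3: "AE x in lborel. (\<lambda>n. ?f n x) \<longlonglongrightarrow> indicator {..b} x *\<^sub>R f x"
  proof (rule AE_I2)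
    fix x
    obtain m :: nat where m: "b - x \<le> real m" using real_arch_simple by blast
    have "eventually (\<lambda>n. ?f n x = indicator {..b} x *\<^sub>R f x) sequentially"
      using eventually_ge_at_top[of m]
    proof eventually_elim
      case (elim n)
      then have "real m \<le> real n" by simp
      with m show ?case by (auto simp: indicator_def)
    qed
    then show "(\<lambda>n. ?f n x) \<longlonglongrightarrow> indicator {..b} x *\<^sub>R f x" by (rule tendsto_eventually)
  qed
  have e: "integral\<^sup>L lborel (?f n) = H b - H (b - real n)" for n
    using primitive_ofD[OF H, of "b - real n" b] by (simp add: set_lebesgue_integral_def)
  have t: "filterlim (\<lambda>n. b - real n) at_bot sequentially"
    by real_asymp
  have 4: "(\<lambda>n. integral\<^sup>L lborel (?f n)) \<longlonglongrightarrow> H b - L"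
    unfolding e by (intro tendsto_intros filterlim_compose[OF lim t])
  show "set_integrable lborel {..b} f"
    unfolding set_integrable_def by (rule integrable_monotone_convergence[OF 1 2 3 4]) simp
  show "(LINT x:{..b}|lborel. f x) = H b - L"
    unfolding set_lebesgue_integral_def by (rule integral_monotone_convergence[OF 1 2 3 4]) simp
qed

text \<open>Left continuity of the distribution function, from continuity of the measure along
  increasing open half-lines.\<close>

lemma finite_measure_lessThan_left:
  fixes M :: "real measure"
  assumes "finite_measure M" "sets M = sets borel" "c < measure M {..<x}"
  shows "\<exists>z<x. c < measure M {..<z}"
proof -
  interpret finite_measure M by fact
  have "(\<lambda>n. measure M {..<x - 1 / real (Suc n)}) \<longlonglongrightarrow> measure M (\<Union>n. {..<x - 1 / real (Suc n)})"
  proof (rule finite_Lim_measure_incseq)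
    show "incseq (\<lambda>n. {..<x - 1 / real (Suc n)})"
    proof (rule incseq_SucI)
      fix n
      have "1 / real (Suc (Suc n)) \<le> 1 / real (Suc n)" by (simp add: field_simps)
      then show "{..<x - 1 / real (Suc n)} \<le> {..<x - 1 / real (Suc (Suc n))}" by auto
    qed
  qed (auto simp: assms)
  also have "(\<Union>n. {..<x - 1 / real (Suc n)}) = {..<x}"
  proof (rule equalityI)
    show "{..<x} \<subseteq> (\<Union>n. {..<x - 1 / real (Suc n)})"
    proof
      fix z assume "z \<in> {..<x}"
      then obtain n where "inverse (real (Suc n)) < x - z" using reals_Archimedean[of "x - z"] by auto
      then show "z \<in> (\<Union>n. {..<x - 1 / real (Suc n)})" by (auto simp: inverse_eq_divide intro!: exI[of _ n])
    qed
    show "(\<Union>n. {..<x - 1 / real (Suc n)}) \<subseteq> {..<x}"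
    proof
      fix z assume "z \<in> (\<Union>n. {..<x - 1 / real (Suc n)})"
      then obtain n where "z < x - 1 / real (Suc n)" by blast
      also have "\<dots> < x" by simp
      finally show "z \<in> {..<x}" by simp
    qed
  qed
  finally have "eventually (\<lambda>n. c < measure M {..<x - 1 / real (Suc n)}) sequentially"
    using assms(3) by (rule order_tendstoD)
  then obtain n where "c < measure M {..<x - 1 / real (Suc n)}"
    by (auto simp: eventually_sequentially)
  then show ?thesis by (intro exI[of _ "x - 1 / real (Suc n)"]) simp
qed

lemma measure_lessThan_limits:
  fixes M :: "real measure"
  assumes "finite_measure M" "sets M = sets borel"
  shows "((\<lambda>x. measure M {..<x}) \<longlongrightarrow> 0) at_bot"
    "((\<lambda>x. measure M {..<x}) \<longlongrightarrow> measure M UNIV) at_top"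
proof -
  have sp: "space M = UNIV" using assms(2) by (simp add: sets_eq_imp_space_eq)
  interpret finite_borel_measure M
    using assms sp by (simp add: finite_borel_measure_def finite_borel_measure_axioms_def)
  have 1: "measure M {..<x} \<le> cdf M x" for x unfolding cdf_def by (rule finite_measure_mono) (auto simp: assms)
  have 2: "cdf M (x - 1) \<le> measure M {..<x}" for x unfolding cdf_def by (rule finite_measure_mono) (auto simp: assms)
  have 3: "measure M {..<x} \<le> measure M UNIV" for x by (rule finite_measure_mono) (auto simp: assms)
  show "((\<lambda>x. measure M {..<x}) \<longlongrightarrow> 0) at_bot"
    by (rule tendsto_sandwich[OF _ _ tendsto_const cdf_lim_at_bot]) (auto simp: 1)
  have "filterlim (\<lambda>x::real. x - 1) at_top at_top" by real_asymp
  then have "((\<lambda>x. cdf M (x - 1)) \<longlongrightarrow> measure M UNIV) at_top"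
    using cdf_lim_at_top unfolding sp by (rule filterlim_compose[rotated])
  then show "((\<lambda>x. measure M {..<x}) \<longlongrightarrow> measure M UNIV) at_top"
    by (rule tendsto_sandwich[OF _ _ _ tendsto_const, rotated 2]) (auto simp: 2 3)
qed

text \<open>The slope \<open>v\<close> is a parameter, not \<open>wderiv u\<close>, so that the
  projected data with their explicit step-function slope form an instance as well. The absolutely
  continuous part has density v^2, and \<open>\<sigma>\<close> is carried by the null set
  \<open>N\<close>.\<close>

locale eulerian_pair =
  fixes u v :: "real \<Rightarrow> real" and \<mu> \<sigma> :: "real measure" and N :: "real set"
  assumes u_v: "primitive_of u v"
    and cutoff: "\<exists>\<psi> \<psi>'. cutoff_pair \<psi> \<psi>'"
    and v_L2: "square_integrable v"
    and sets_\<sigma>: "sets \<sigma> = sets borel"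
    and sets_\<mu>: "sets \<mu> = sets borel"
    and fin_\<mu>: "finite_measure \<mu>"
    and N_null: "N \<in> null_sets lborel"
    and \<sigma>_N: "emeasure \<sigma> (- N) = 0"
    and \<mu>_split: "A \<in> sets borel \<Longrightarrow>
      emeasure \<mu> A = (\<integral>\<^sup>+x. ennreal ((v x)\<^sup>2) * indicator A x \<partial>lborel) + emeasure \<sigma> A"
begin

interpretation \<mu>: finite_measure \<mu> by (rule fin_\<mu>)

lemma v_measurable [measurable]: "v \<in> borel_measurable borel"
  using v_L2 by (simp add: square_integrable_def)

lemma v2_integrable: "integrable lborel (\<lambda>x. (v x)\<^sup>2)"
  using v_L2 by (simp add: square_integrable_def)

lemma N_sets [measurable]: "N \<in> sets borel"
  using N_null by auto

definition Ftot :: real where "Ftot = measure \<mu> UNIV"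

lemma F_nonneg: "0 \<le> Ftot" by (simp add: Ftot_def)

definition G :: "real \<Rightarrow> real" where "G x = x + measure \<mu> {..<x}"

definition y0 :: "real \<Rightarrow> real" where "y0 \<xi> = Sup {x. x + measure \<mu> {..<x} < \<xi>}"

lemma space_\<mu>: "space \<mu> = UNIV"
  using sets_\<mu> by (simp add: sets_eq_imp_space_eq)

lemma G_bounds: "x \<le> G x" "G x \<le> x + Ftot"
  using \<mu>.bounded_measure[of "{..<x}"] by (auto simp: G_def Ftot_def space_\<mu>)

lemma G_diff: "a \<le> b \<Longrightarrow> G b - G a = (b - a) + measure \<mu> {a..<b}"
proof -
  assume "a \<le> b"
  then have "{a..<b} = {..<b} - {..<a}" by auto
  then have "measure \<mu> {a..<b} = measure \<mu> {..<b} - measure \<mu> {..<a}"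
    using \<open>a \<le> b\<close> by (simp only:) (rule \<mu>.finite_measure_Diff, auto simp: sets_\<mu>)
  then show ?thesis by (simp add: G_def)
qed

lemma G_increase: "a \<le> b \<Longrightarrow> b - a \<le> G b - G a"
  by (simp add: G_diff)

text \<open>\<open>y0\<close> is the generalised inverse of the strictly increasing, left-continuous
  \<open>G\<close>. This equivalence is the source of all order properties of \<open>y0\<close>;
  left continuity makes the inequality on the left strict.\<close>

lemma y_less_iff: "y0 \<xi> < x \<longleftrightarrow> \<xi> < G x"
proof -
  let ?S = "{x. x + measure \<mu> {..<x} < \<xi>}"
  have S: "z \<in> ?S \<longleftrightarrow> G z < \<xi>" for z by (simp add: G_def)
  have ne: "\<xi> - Ftot - 1 \<in> ?S" unfolding S using G_bounds(2)[of "\<xi> - Ftot - 1"] by linarith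
  have bd: "bdd_above ?S"
  proof (rule bdd_aboveI)
    fix z assume "z \<in> ?S"
    then show "z \<le> \<xi>" unfolding S using G_bounds(1)[of z] by linarith
  qed
  show ?thesis
  proof
    assume "y0 \<xi> < x"
    then obtain z where z: "y0 \<xi> < z" "z < x" using dense by blast
    then have "z \<notin> ?S" using cSup_upper[OF _ bd, of z] unfolding y0_def by linarith
    then have "\<xi> \<le> G z" unfolding S by simp
    also have "G z < G x" using G_increase[of z x] z by simp
    finally show "\<xi> < G x" .
  next
    assume "\<xi> < G x"
    then have "\<xi> - x < measure \<mu> {..<x}" by (simp add: G_def)
    then obtain d where d: "\<xi> - x < d" "d < measure \<mu> {..<x}" using dense by blast
    obtain z where z: "z < x" "d < measure \<mu> {..<z}"
      using finite_measure_lessThan_left[OF fin_\<mu> sets_\<mu> d(2)] by blast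
    \<comment> \<open>Any point at or beyond both z and \<xi> - d has G \<ge> (\<xi> - d) + d =
      \<xi>, so it bounds the supremum; both numbers lie below x.\<close>
    define w where "w = max z (\<xi> - d)"
    have w: "w < x" using z d by (simp add: w_def)
    have "measure \<mu> {..<z} \<le> measure \<mu> {..<w}"
      by (rule \<mu>.finite_measure_mono) (auto simp: w_def sets_\<mu>)
    then have "\<xi> \<le> G w" using z by (simp add: G_def w_def)
    then have "q \<le> w" if "q \<in> ?S" for q
      using that G_increase[of w q] unfolding S by linarith
    then have "y0 \<xi> \<le> w" unfolding y0_def using ne by (intro cSup_least) blast+
    with w show "y0 \<xi> < x" by simp
  qed
qed

lemma y_bounds: "\<xi> - Ftot \<le> y0 \<xi>" "y0 \<xi> \<le> \<xi>"
proof -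
  show "\<xi> - Ftot \<le> y0 \<xi>"
    using y_less_iff[of \<xi> "\<xi> - Ftot"] G_bounds(2)[of "\<xi> - Ftot"] by linarith
  have "y0 \<xi> < x" if "\<xi> < x" for x using that G_bounds(1)[of x] by (simp add: y_less_iff)
  from this[of "y0 \<xi>"] show "y0 \<xi> \<le> \<xi>" by linarith
qed

lemma y_mono: "a \<le> b \<Longrightarrow> y0 a \<le> y0 b"
  using y_less_iff[of b "y0 a"] y_less_iff[of a "y0 a"] by linarith

text \<open>\<open>G\<close> grows at least at unit rate, so its inverse grows at most at unit
  rate.\<close>

lemma y_Lipschitz: assumes "a \<le> b" shows "y0 b - y0 a \<le> b - a"
proof (rule ccontr)
  assume "\<not> ?thesis"
  then have "y0 a < y0 b - (b - a)" by simp
  then obtain x where x: "y0 a < x" "x < y0 b - (b - a)" using dense by blast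
  then have 1: "a < G x" by (simp add: y_less_iff)
  have "G (x + (b - a)) \<le> b" using x y_less_iff[of b "x + (b - a)"] by linarith
  with G_increase[of x "x + (b - a)"] assms 1 show False by simp
qed

lemma y_continuous: "continuous_on UNIV y0"
proof (rule lipschitz_on_continuous_on[of 1])
  have "\<bar>y0 a - y0 b\<bar> \<le> \<bar>a - b\<bar>" for a b
    using y_Lipschitz[of a b] y_Lipschitz[of b a] y_mono[of a b] y_mono[of b a] by linarith
  then show "1-lipschitz_on UNIV y0" by (auto intro!: lipschitz_onI simp: dist_real_def)
qed

lemma y_measurable [measurable]: "y0 \<in> borel_measurable borel"
  using y_continuous by (rule borel_measurable_continuous_onI)

lemma y_at_top: "filterlim y0 at_top at_top"
proof -
  have "filterlim (\<lambda>x. x - Ftot) at_top at_top" by real_asymp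
  then show ?thesis by (rule filterlim_at_top_mono) (auto simp: y_bounds)
qed

text \<open>The preimage of [a, b) under \<open>y0\<close> is [G a, G b), whose length is b - a plus
  the mass of [a, b). Half-open intervals generate the Borel sets.\<close>

lemma emeasure_push:
  assumes "A \<in> sets borel"
  shows "emeasure lborel (y0 -` A) = emeasure lborel A + emeasure \<mu> A"
proof -
  have "distr lborel borel y0 = measure_add lborel \<mu>"
  proof (rule measure_eqI_Ico)
    show "sets (measure_add lborel \<mu>) = sets borel" by (simp add: sets_measure_add sets_\<mu>)
    fix a b :: real assume ab: "a < b"
    have "y0 -` {a..<b} = {G a..<G b}"
      by (auto simp: y_less_iff not_less[symmetric])
    then have e: "emeasure (distr lborel borel y0) {a..<b} = ennreal (G b - G a)"
      using ab G_increase[of a b] by (simp add: emeasure_distr)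
    then show "emeasure (distr lborel borel y0) {a..<b} \<noteq> \<infinity>" by simp
    show "emeasure (distr lborel borel y0) {a..<b} = emeasure (measure_add lborel \<mu>) {a..<b}"
      unfolding e using ab by (simp add: emeasure_measure_add sets_\<mu> G_diff \<mu>.emeasure_eq_measure ennreal_plus)
  qed simp
  then have "emeasure (distr lborel borel y0) A = emeasure (measure_add lborel \<mu>) A" by simp
  with assms show ?thesis by (simp add: emeasure_distr emeasure_measure_add sets_\<mu>)
qed

text \<open>The reciprocal of the density 1 + v^2 of the image measure. The value 0 on
  \<open>N\<close> makes the densities of \<open>y0\<close> and \<open>U0\<close> vanish at labels
  of singular mass, which therefore have breaking time 0.\<close>

definition w :: "real \<Rightarrow> real" where "w x = (if x \<in> N then 0 else 1 / (1 + (v x)\<^sup>2))"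

lemma w_measurable [measurable]: "w \<in> borel_measurable borel"
  unfolding w_def by measurable

lemma w_bounds: "0 \<le> w x" "w x \<le> 1"
  by (auto simp: w_def divide_le_eq_1 add_pos_nonneg)

text \<open>The density \<open>w \<circ> y0\<close> is the derivative of \<open>y0\<close>: off \<open>N\<close>, the image of Lebesgue measure
  under \<open>y0\<close> is \<open>(1 + v\<^sup>2) dx\<close>.\<close>

lemma push_w: "distr (density lborel (\<lambda>\<xi>. ennreal (w (y0 \<xi>)))) borel y0 = lborel" (is "?D = _")
proof (rule measure_eqI)
  fix A assume "A \<in> sets (?D)"
  then have A [measurable]: "A \<in> sets borel" by simp
  have eq: "density (distr lborel borel y0) (indicator (-N)) = density lborel (\<lambda>x. ennreal (1 + (v x)\<^sup>2) * indicator (-N) x)"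
  proof (rule measure_eqI)
    fix B assume "B \<in> sets (density (distr lborel borel y0) (indicator (-N)))"
    then have B [measurable]: "B \<in> sets borel" by simp
    have "emeasure \<sigma> (B - N) \<le> emeasure \<sigma> (- N)"
      by (rule emeasure_mono) (auto simp: sets_\<sigma>)
    then have s: "emeasure \<sigma> (B - N) = 0" using \<sigma>_N by simp
    have "emeasure (density (distr lborel borel y0) (indicator (-N))) B
        = (\<integral>\<^sup>+x. indicator (B - N) x \<partial>distr lborel borel y0)"
      by (subst emeasure_density, simp, simp, rule nn_integral_cong) (simp split: split_indicator)
    also have "\<dots> = emeasure (distr lborel borel y0) (B - N)"
      by (rule nn_integral_indicator) simp
    also have "\<dots> = emeasure lborel (y0 -` (B - N))" by (simp add: emeasure_distr)
    also have "\<dots> = emeasure lborel (B - N) + emeasure \<mu> (B - N)" by (rule emeasure_push) simp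
    also have "\<dots> = (\<integral>\<^sup>+x. indicator (B - N) x \<partial>lborel) + (\<integral>\<^sup>+x. ennreal ((v x)\<^sup>2) * indicator (B - N) x \<partial>lborel)"
      by (simp add: \<mu>_split s)
    also have "\<dots> = (\<integral>\<^sup>+x. indicator (B - N) x + ennreal ((v x)\<^sup>2) * indicator (B - N) x \<partial>lborel)"
      by (rule nn_integral_add[symmetric]) auto
    also have "\<dots> = (\<integral>\<^sup>+x. ennreal (1 + (v x)\<^sup>2) * indicator (-N) x * indicator B x \<partial>lborel)"
      by (rule nn_integral_cong) (auto simp: indicator_def ennreal_plus)
    finally show "emeasure (density (distr lborel borel y0) (indicator (-N))) B
        = emeasure (density lborel (\<lambda>x. ennreal (1 + (v x)\<^sup>2) * indicator (-N) x)) B"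
      by (simp add: emeasure_density)
  qed simp
  have [measurable]: "y0 -` A \<in> sets borel"
    using measurable_sets[OF y_measurable A] by simp
  have "emeasure (?D) A
      = (\<integral>\<^sup>+\<xi>. ennreal (w (y0 \<xi>)) * indicator A (y0 \<xi>) \<partial>lborel)"
    by (simp add: emeasure_distr emeasure_density indicator_def)
  also have "\<dots> = (\<integral>\<^sup>+x. ennreal (w x) * indicator A x \<partial>distr lborel borel y0)"
    by (simp add: nn_integral_distr)
  also have "\<dots> = (\<integral>\<^sup>+x. indicator (-N) x * (ennreal (w x) * indicator A x) \<partial>distr lborel borel y0)"
    by (rule nn_integral_cong) (auto simp: indicator_def w_def)
  also have "\<dots> = (\<integral>\<^sup>+x. ennreal (w x) * indicator A x \<partial>density (distr lborel borel y0) (indicator (-N)))"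
    by (simp add: nn_integral_density)
  also have "\<dots> = (\<integral>\<^sup>+x. (ennreal (1 + (v x)\<^sup>2) * indicator (-N) x) * (ennreal (w x) * indicator A x) \<partial>lborel)"
    unfolding eq by (simp add: nn_integral_density)
  also have "\<dots> = (\<integral>\<^sup>+x. indicator A x \<partial>lborel)"
  proof (rule nn_integral_cong_AE)
    show "AE x in lborel. (ennreal (1 + (v x)\<^sup>2) * indicator (-N) x) * (ennreal (w x) * indicator A x) = indicator A x"
      using AE_not_in[OF N_null]
    proof eventually_elim
      case (elim x)
      have "1 + (v x)\<^sup>2 \<noteq> 0" by (smt (verit) zero_le_power2)
      then have "(1 + (v x)\<^sup>2) * w x = 1" using elim by (simp add: w_def)
      then have "ennreal (1 + (v x)\<^sup>2) * ennreal (w x) = 1"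
        using ennreal_mult''[OF w_bounds(1), of "1 + (v x)\<^sup>2" x] by (metis ennreal_1)
      then show ?case using elim by (simp add: mult.assoc[symmetric])
    qed
  qed
  finally show "emeasure (?D) A = emeasure lborel A" by simp
qed simp

lemma integral_push:
  fixes h :: "real \<Rightarrow> real"
  assumes "integrable lborel h"
  shows "integrable lborel (\<lambda>\<xi>. h (y0 \<xi>) * w (y0 \<xi>))"
    "(LINT \<xi>|lborel. h (y0 \<xi>) * w (y0 \<xi>)) = (LINT x|lborel. h x)"
proof -
  have [measurable]: "h \<in> borel_measurable borel" using assms by auto
  have "integrable (distr (density lborel (\<lambda>\<xi>. ennreal (w (y0 \<xi>)))) borel y0) h"
    using assms by (simp add: push_w)
  then show "integrable lborel (\<lambda>\<xi>. h (y0 \<xi>) * w (y0 \<xi>))"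
    by (simp add: integrable_distr_eq integrable_real_density w_bounds mult.commute)
  have "(LINT x|lborel. h x) = (LINT x|distr (density lborel (\<lambda>\<xi>. ennreal (w (y0 \<xi>)))) borel y0. h x)"
    by (simp only: push_w)
  also have "\<dots> = (LINT \<xi>|lborel. h (y0 \<xi>) * w (y0 \<xi>))"
    by (simp add: integral_distr integral_real_density w_bounds mult.commute)
  finally show "(LINT \<xi>|lborel. h (y0 \<xi>) * w (y0 \<xi>)) = (LINT x|lborel. h x)" ..
qed

text \<open>An atom at x is spread over a whole interval of labels. The weighted image measure is
  Lebesgue measure and has no atoms, so the weight vanishes almost everywhere on that
  interval.\<close>

lemma AE_w_eq_0: "AE \<eta> in lborel. y0 \<eta> = x \<longrightarrow> w (y0 \<eta>) = 0"
proof -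
  have "AE z in distr (density lborel (\<lambda>\<xi>. ennreal (w (y0 \<xi>)))) borel y0. z \<noteq> x"
    unfolding push_w by (rule AE_lborel_singleton)
  then have "AE \<eta> in lborel. 0 < ennreal (w (y0 \<eta>)) \<longrightarrow> y0 \<eta> \<noteq> x"
    by (simp add: AE_distr_iff AE_density)
  then show ?thesis
  proof eventually_elim
    case (elim \<eta>)
    then show ?case using w_bounds(1)[of "y0 \<eta>"] by (cases "w (y0 \<eta>) = 0") (auto simp: less_le)
  qed
qed

text \<open>By monotonicity a label outside [a, b] can reach [y0 a, y0 b] only at an endpoint, where
  the weight is almost everywhere 0. With h = 1 and h = v this yields the derivatives of
  \<open>y0\<close> and \<open>U0\<close> without any pointwise chain rule.\<close>

lemma set_integral_push:
  fixes h :: "real \<Rightarrow> real"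
  assumes h: "set_integrable lborel {y0 a..y0 b} h" and ab: "a \<le> b"
  shows "set_integrable lborel {a..b} (\<lambda>\<xi>. h (y0 \<xi>) * w (y0 \<xi>))" (is ?A)
    and "(LINT \<xi>:{a..b}|lborel. h (y0 \<xi>) * w (y0 \<xi>)) = (LINT x:{y0 a..y0 b}|lborel. h x)" (is ?B)
proof -
  let ?h = "\<lambda>x. indicator {y0 a..y0 b} x * h x"
  have i: "integrable lborel ?h" using h by (simp add: set_integrable_def)
  then have [measurable]: "?h \<in> borel_measurable borel" by auto
  have e: "AE \<xi> in lborel. ?h (y0 \<xi>) * w (y0 \<xi>) = indicator {a..b} \<xi> * (h (y0 \<xi>) * w (y0 \<xi>))"
    using AE_w_eq_0[of "y0 a"] AE_w_eq_0[of "y0 b"]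
  proof eventually_elim
    case (elim \<xi>)
    show ?case
    proof (cases "\<xi> \<in> {a..b}")
      case True
      then show ?thesis by (auto simp: indicator_def y_mono)
    next
      case False
      then have "\<xi> < a \<or> b < \<xi>" by auto
      then have "w (y0 \<xi>) = 0 \<or> y0 \<xi> \<notin> {y0 a..y0 b}"
        using y_mono[of \<xi> a] y_mono[of b \<xi>] elim by auto
      then show ?thesis using False by auto
    qed
  qed
  have m: "(\<lambda>\<xi>. indicator {a..b} \<xi> * (h (y0 \<xi>) * w (y0 \<xi>))) \<in> borel_measurable lborel"
  proof -
    have "(\<lambda>\<xi>. indicator {a..b} \<xi> * (?h (y0 \<xi>) * w (y0 \<xi>))) \<in> borel_measurable lborel" by measurable
    moreover have "indicator {a..b} \<xi> * (?h (y0 \<xi>) * w (y0 \<xi>)) = indicator {a..b} \<xi> * (h (y0 \<xi>) * w (y0 \<xi>))" for \<xi>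
      by (auto simp: indicator_def y_mono)
    ultimately show ?thesis by simp
  qed
  have m': "(\<lambda>\<xi>. ?h (y0 \<xi>) * w (y0 \<xi>)) \<in> borel_measurable lborel" by measurable
  show ?A unfolding set_integrable_def real_scaleR_def
    using integral_push(1)[OF i] integrable_cong_AE[OF m' m e] by simp
  show ?B unfolding set_lebesgue_integral_def real_scaleR_def
    using integral_push(2)[OF i] integral_cong_AE[OF m' m e] by simp
qed

lemma set_integral_push_atMost:
  fixes h :: "real \<Rightarrow> real"
  assumes i: "integrable lborel h"
  shows "(LINT \<xi>:{..b}|lborel. h (y0 \<xi>) * w (y0 \<xi>)) = (LINT x:{..y0 b}|lborel. h x)"
proof -
  have [measurable]: "h \<in> borel_measurable borel" using i by auto
  have e: "AE \<xi> in lborel. indicator {..y0 b} (y0 \<xi>) * h (y0 \<xi>) * w (y0 \<xi>) = indicator {..b} \<xi> * (h (y0 \<xi>) * w (y0 \<xi>))"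
    using AE_w_eq_0[of "y0 b"]
  proof eventually_elim
    case (elim \<xi>)
    show ?case
    proof (cases "\<xi> \<le> b")
      case True
      then show ?thesis by (auto simp: indicator_def y_mono)
    next
      case False
      then have "w (y0 \<xi>) = 0 \<or> y0 \<xi> \<notin> {..y0 b}"
        using y_mono[of b \<xi>] elim by auto
      then show ?thesis using False by auto
    qed
  qed
  have i': "integrable lborel (\<lambda>x. indicator {..y0 b} x * h x)"
    using integrable_mult_indicator[OF _ i, of "{..y0 b}"] by simp
  show ?thesis
    unfolding set_lebesgue_integral_def real_scaleR_def integral_push(2)[OF i', symmetric]
    by (rule integral_cong_AE[OF _ _ e, symmetric]) measurable
qed

lemma y_primitive: "primitive_of y0 (\<lambda>\<xi>. w (y0 \<xi>))"
  unfolding primitive_of_def locally_integrable_def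
proof (intro conjI allI impI)
  have one: "set_integrable lborel {a..b} (\<lambda>x. 1)" for a b :: real
    by (simp add: set_integrable_def emeasure_lborel_Icc_eq)
  show "set_integrable lborel {a..b} (\<lambda>\<xi>. w (y0 \<xi>))" for a b
    using set_integral_push(1)[OF one, of a b] by (cases "a \<le> b") (auto simp: set_integrable_def)
  fix a b :: real assume "a \<le> b"
  then show "y0 b - y0 a = (LINT \<xi>:{a..b}|lborel. w (y0 \<xi>))"
    using set_integral_push(2)[OF one, of a b] y_mono[of a b] by (simp add: set_lebesgue_integral_def)
qed

definition V0 :: "real \<Rightarrow> real" where "V0 \<xi> = \<xi> - y0 \<xi>"

definition U0 :: "real \<Rightarrow> real" where "U0 \<xi> = u (y0 \<xi>)"

lemma id_primitive: "primitive_of (\<lambda>x. x) (\<lambda>x. 1)"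
  using smooth_deriv by (auto simp: primitive_of_def set_lebesgue_integral_def intro!: continuous_imp_locally_integrable)

lemma V_primitive: "primitive_of V0 (\<lambda>\<xi>. 1 - w (y0 \<xi>))"
proof -
  have "primitive_of (\<lambda>\<xi>. \<xi> + (-1) * y0 \<xi>) (\<lambda>\<xi>. 1 + (-1) * w (y0 \<xi>))"
    by (intro primitive_of_add primitive_of_cmult id_primitive y_primitive)
  then show ?thesis by (simp add: V0_def[abs_def])
qed

lemma U_primitive: "primitive_of U0 (\<lambda>\<xi>. v (y0 \<xi>) * w (y0 \<xi>))"
  unfolding primitive_of_def locally_integrable_def
proof (intro conjI allI impI)
  have vi: "set_integrable lborel {a..b} v" for a b :: real
    using u_v by (simp add: primitive_of_def locally_integrable_def)
  show "set_integrable lborel {a..b} (\<lambda>\<xi>. v (y0 \<xi>) * w (y0 \<xi>))" for a b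
    using set_integral_push(1)[OF vi, of a b] by (cases "a \<le> b") (auto simp: set_integrable_def)
  fix a b :: real assume "a \<le> b"
  then show "U0 b - U0 a = (LINT \<xi>:{a..b}|lborel. v (y0 \<xi>) * w (y0 \<xi>))"
    using set_integral_push(2)[OF vi, of a b] y_mono[of a b] primitive_ofD[OF u_v, of "y0 a" "y0 b"]
    by (simp add: U0_def)
qed

text \<open>At a label inside an atom, \<open>V0\<close> lies between the left and right limits of
  the distribution function. Pinching it this way gives its limits at both infinities.\<close>

lemma V_bounds: "measure \<mu> {..<y0 \<xi>} \<le> V0 \<xi>" "0 < \<delta> \<Longrightarrow> V0 \<xi> \<le> \<delta> + measure \<mu> {..<y0 \<xi> + \<delta>}"
  "0 \<le> V0 \<xi>" "V0 \<xi> \<le> Ftot"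
proof -
  have "G (y0 \<xi>) \<le> \<xi>" using y_less_iff[of \<xi> "y0 \<xi>"] by linarith
  then show "measure \<mu> {..<y0 \<xi>} \<le> V0 \<xi>" by (simp add: G_def V0_def)
  show "V0 \<xi> \<le> \<delta> + measure \<mu> {..<y0 \<xi> + \<delta>}" if "0 < \<delta>"
    using y_less_iff[of \<xi> "y0 \<xi> + \<delta>"] that by (simp add: G_def V0_def)
qed (use y_bounds[of \<xi>] in \<open>auto simp: V0_def\<close>)

lemma V_mono: "a \<le> b \<Longrightarrow> V0 a \<le> V0 b"
  using y_Lipschitz[of a b] by (simp add: V0_def)

lemma V_at_bot: "(V0 \<longlongrightarrow> 0) at_bot"
proof (rule decreasing_tendsto)
  show "eventually (\<lambda>\<xi>. 0 \<le> V0 \<xi>) at_bot" by (simp add: V_bounds)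
  fix e :: real assume "0 < e"
  have "eventually (\<lambda>x. measure \<mu> {..<x} < e / 2) at_bot"
    using measure_lessThan_limits(1)[OF fin_\<mu> sets_\<mu>] \<open>0 < e\<close> by (intro order_tendstoD) auto
  moreover have "filterlim (\<lambda>\<xi>. y0 \<xi> + e / 2) at_bot at_bot"
  proof (rule filterlim_at_bot_mono)
    show "filterlim (\<lambda>\<xi>. \<xi> + e / 2) at_bot at_bot" by real_asymp
  qed (simp add: y_bounds)
  ultimately have "eventually (\<lambda>\<xi>. measure \<mu> {..<y0 \<xi> + e / 2} < e / 2) at_bot"
    by (rule eventually_compose_filterlim)
  then show "eventually (\<lambda>\<xi>. V0 \<xi> < e) at_bot"
  proof eventually_elim
    case (elim \<xi>)
    then show ?case using V_bounds(2)[of "e / 2" \<xi>] \<open>0 < e\<close> by simp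
  qed
qed

lemma V_at_top: "(V0 \<longlongrightarrow> Ftot) at_top"
proof (rule tendsto_sandwich[OF _ _ _ tendsto_const])
  show "((\<lambda>\<xi>. measure \<mu> {..<y0 \<xi>}) \<longlongrightarrow> Ftot) at_top"
    unfolding Ftot_def by (rule filterlim_compose[OF measure_lessThan_limits(2)[OF fin_\<mu> sets_\<mu>] y_at_top])
qed (auto simp: V_bounds)

lemma V_integral:
  "set_integrable lborel {..b} (\<lambda>\<xi>. 1 - w (y0 \<xi>))" "(LINT \<xi>:{..b}|lborel. 1 - w (y0 \<xi>)) = V0 b"
  using primitive_of_integral_atMost[OF V_primitive _ V_at_bot] w_bounds(2) by auto

end

section \<open>The explicit solution\<close>

lemma discriminant_le:
  fixes A P B :: real
  assumes "\<And>l. 0 \<le> A - 2 * l * P + l\<^sup>2 * B" and "0 \<le> B"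
  shows "P\<^sup>2 \<le> A * B" "0 \<le> A"
proof -
  show "0 \<le> A" using assms(1)[of 0] by simp
  show "P\<^sup>2 \<le> A * B"
  proof (cases "B = 0")
    case True
    have "P = 0"
    proof (rule ccontr)
      assume P: "P \<noteq> 0"
      \<comment> \<open>For B = 0 the form is affine in l; this l gives it the value -1.\<close>
      have "0 \<le> A - 2 * ((A + 1) / (2 * P)) * P" using assms(1)[of "(A + 1) / (2 * P)"] True by simp
      also have "\<dots> = -1" using P by (simp add: field_simps)
      finally show False by simp
    qed
    then show ?thesis using True by simp
  next
    case False
    have B: "0 < B" using False assms(2) by simp
    have "0 \<le> (A - 2 * (P / B) * P + (P / B)\<^sup>2 * B) * B"
      using assms(1)[of "P / B"] B by (intro mult_nonneg_nonneg) auto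
    also have "\<dots> = A * B - P\<^sup>2" using B by (simp add: power2_eq_square field_simps)
    finally show ?thesis by simp
  qed
qed

text \<open>\<open>k1\<close> and \<open>k2\<close> are the first and second time integrals of the energy
  \<open>a\<^sup>2 * indicator {s. s * a \<le> -2} t\<close> that a particle with initial slope \<open>a\<close> has exposed to dissipation by
  time \<open>t\<close>; its breaking time is \<open>-2 / a\<close> if \<open>a < 0\<close>.\<close>

definition k1 :: "real \<Rightarrow> real \<Rightarrow> real" where "k1 t a = - a * max 0 (- (t * a) - 2)"

definition k2 :: "real \<Rightarrow> real \<Rightarrow> real" where "k2 t a = (max 0 (- (t * a) - 2))\<^sup>2 / 2"

lemma k_measurable [measurable]: "k1 t \<in> borel_measurable borel" "k2 t \<in> borel_measurable borel"
  by (simp_all add: k1_def[abs_def] k2_def[abs_def])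

lemma k1_bound: "\<bar>k1 t a\<bar> \<le> \<bar>t\<bar> * a\<^sup>2"
proof -
  have "\<bar>k1 t a\<bar> = \<bar>a\<bar> * max 0 (- (t * a) - 2)" by (simp add: k1_def abs_mult)
  also have "\<dots> \<le> \<bar>a\<bar> * (\<bar>t\<bar> * \<bar>a\<bar>)"
    using abs_ge_minus_self[of "t * a"] by (intro mult_left_mono) (auto simp: abs_mult)
  also have "\<dots> = \<bar>t\<bar> * a\<^sup>2" by (simp add: power2_eq_square mult.left_commute)
  finally show ?thesis .
qed

lemma k2_bound: "0 \<le> k2 t a" "k2 t a \<le> t\<^sup>2 * a\<^sup>2 / 2"
proof -
  have "(max 0 (- (t * a) - 2))\<^sup>2 \<le> \<bar>t * a\<bar>\<^sup>2"
    by (rule power_mono) auto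
  then show "k2 t a \<le> t\<^sup>2 * a\<^sup>2 / 2" by (simp add: k2_def power_mult_distrib)
qed (simp add: k2_def)

text \<open>Half the square of the positive part has a Lipschitz derivative, so its first-order
  Taylor remainder is at most half the squared increment. In the variable -(t * a) - 2 the increment
  is -(s - t) * a, and \<open>k1\<close> is the derivative in t.\<close>

lemma k2_expansion: "\<bar>k2 s a - k2 t a - (s - t) * k1 t a\<bar> \<le> (s - t)\<^sup>2 * a\<^sup>2 / 2"
proof -
  define m n where "m = - (t * a) - 2" and "n = - (s * a) - 2"
  have "\<bar>(max 0 n)\<^sup>2 - (max 0 m)\<^sup>2 - 2 * (n - m) * max 0 m\<bar> \<le> (n - m)\<^sup>2"
  proof -
    consider "0 \<le> m" "0 \<le> n" | "0 \<le> m" "n < 0" | "m < 0" "0 \<le> n" | "m < 0" "n < 0" by linarith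
    then show ?thesis
    proof cases
      case 1
      then have "(max 0 n)\<^sup>2 - (max 0 m)\<^sup>2 - 2 * (n - m) * max 0 m = (n - m)\<^sup>2"
        by (simp add: power2_eq_square algebra_simps)
      then show ?thesis by simp
    next
      case 2
      have e: "(max 0 n)\<^sup>2 - (max 0 m)\<^sup>2 - 2 * (n - m) * max 0 m = m\<^sup>2 - 2 * (n * m)"
        using 2 by (simp add: power2_eq_square algebra_simps)
      have "n * m \<le> 0" using 2 by (simp add: mult_nonpos_nonneg)
      moreover have "(n - m)\<^sup>2 = m\<^sup>2 - 2 * (n * m) + n\<^sup>2" by (simp add: power2_eq_square algebra_simps)
      ultimately show ?thesis unfolding e using zero_le_power2[of m] zero_le_power2[of n] by linarith
    next
      case 3
      have "n\<^sup>2 \<le> (n - m)\<^sup>2" using 3 by (intro power_mono) auto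
      then show ?thesis using 3 by simp
    qed simp
  qed
  moreover have "n - m = - ((s - t) * a)" by (simp add: m_def n_def algebra_simps)
  ultimately have "\<bar>(max 0 n)\<^sup>2 - (max 0 m)\<^sup>2 + 2 * ((s - t) * a) * max 0 m\<bar> \<le> (s - t)\<^sup>2 * a\<^sup>2"
    by (simp add: power_mult_distrib)
  moreover have "k2 s a - k2 t a - (s - t) * k1 t a = ((max 0 n)\<^sup>2 - (max 0 m)\<^sup>2 + 2 * ((s - t) * a) * max 0 m) / 2"
    by (simp add: k1_def k2_def m_def n_def)
  ultimately show ?thesis by (simp only: abs_divide) simp
qed

text \<open>The factor \<open>max 0 (- (t * a) - 2)\<close> vanishes at the breaking threshold, so
  \<open>k1\<close> has no jump there. If both slopes have broken, \<open>k1\<close> is quadratic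
  and the difference factors. If only a has broken, then t * b > -2, so the excess - (t * a) - 2 is
  at most t * (b - a).\<close>

lemma k1_diff:
  assumes "0 \<le> t"
  shows "\<bar>k1 t a - k1 t b\<bar> \<le> t * \<bar>a - b\<bar> * (\<bar>a\<bar> + \<bar>b\<bar>)"
proof -
  have main: "\<bar>k1 t a - k1 t b\<bar> \<le> t * \<bar>a - b\<bar> * (\<bar>a\<bar> + \<bar>b\<bar>)" if ab: "t * a \<le> t * b" for a b
  proof (cases "t * b \<le> -2")
    case True
    have tp: "0 < t" using assms True by (cases "t = 0") auto
    have "a \<le> b" using ab tp by (simp add: mult_le_cancel_left_pos)
    moreover have "b < 0"
    proof (rule ccontr)
      assume "\<not> b < 0"
      then have "0 \<le> t * b" using tp by simp
      then show False using True by simp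
    qed
    ultimately have neg: "a < 0" "b < 0" "0 < t" "a \<le> b" using tp by auto
    have "k1 t a - k1 t b = (b - a) * (- (t * (a + b)) - 2)"
      using True ab by (simp add: k1_def algebra_simps)
    moreover have "0 \<le> - (t * (a + b)) - 2" unfolding distrib_left using True ab by linarith
    ultimately have "\<bar>k1 t a - k1 t b\<bar> = (b - a) * (- (t * (a + b)) - 2)" using neg by simp
    also have "\<dots> \<le> (b - a) * (t * (\<bar>a\<bar> + \<bar>b\<bar>))"
      using neg by (intro mult_left_mono) (auto simp: algebra_simps)
    finally show ?thesis using neg by (simp add: mult_ac)
  next
    case False
    then have b: "k1 t b = 0" by (simp add: k1_def)
    show ?thesis
    proof (cases "t * a \<le> -2")
      case True
      have neg: "a < 0"
      proof (rule ccontr)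
        assume "\<not> a < 0"
        then have "0 \<le> t * a" using assms by simp
        then show False using True by simp
      qed
      have "\<bar>k1 t a\<bar> = (-a) * (- (t * a) - 2)" using True neg by (simp add: k1_def abs_mult)
      also have "\<dots> \<le> (-a) * (t * \<bar>a - b\<bar>)"
      proof (rule mult_left_mono)
        have "- (t * a) - 2 \<le> t * (b - a)" using False by (simp add: algebra_simps)
        also have "\<dots> \<le> t * \<bar>a - b\<bar>" using assms by (intro mult_left_mono) auto
        finally show "- (t * a) - 2 \<le> t * \<bar>a - b\<bar>" .
      qed (use neg in simp)
      also have "\<dots> \<le> (\<bar>a\<bar> + \<bar>b\<bar>) * (t * \<bar>a - b\<bar>)" using assms by (intro mult_right_mono) auto
      finally show ?thesis using b by (simp add: mult_ac)
    next
      case False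
      then have "k1 t a = 0" by (simp add: k1_def)
      then show ?thesis using b assms by simp
    qed
  qed
  show ?thesis
  proof (cases "t * a \<le> t * b")
    case False
    then show ?thesis using main[of b a] by (simp add: abs_minus_commute add.commute)
  qed (rule main)
qed

text \<open>For a < 0 the exposed times form the interval from -2 / a to t, of length max 0 (t + 2 /
  a); for a \<ge> 0 there are none.\<close>

lemma exposure_integral:
  assumes "0 \<le> t"
  shows "a\<^sup>2 * (LINT s|lborel. indicator {0..t} s * (if s * a \<le> -2 then 1 else 0)) = k1 t a"
proof (cases "a < 0")
  case True
  have "(\<lambda>s. indicator {0..t} s * (if s * a \<le> -2 then 1 else 0)) = (indicator {- 2 / a..t} :: real \<Rightarrow> real)"
  proof
    fix s :: real
    have "s * a \<le> -2 \<longleftrightarrow> - 2 / a \<le> s" using True by (simp add: field_simps)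
    moreover have "0 < - 2 / a" using True by (simp add: field_simps)
    then have "0 \<le> s" if "- 2 / a \<le> s" using that by linarith
    ultimately show "indicator {0..t} s * (if s * a \<le> -2 then 1 else 0) = (indicator {- 2 / a..t} s :: real)"
      by (auto simp: indicator_def simp del: minus_divide_left)
  qed
  then have "(LINT s|lborel. indicator {0..t} s * (if s * a \<le> -2 then 1 else 0)) = max 0 (t + 2 / a)"
    by (simp add: max_def not_le)
  moreover have "a\<^sup>2 * max 0 (t + 2 / a) = (-a) * ((-a) * max 0 (t + 2 / a))" by (simp add: power2_eq_square)
  moreover have "(-a) * max 0 (t + 2 / a) = max 0 (- (t * a) - 2)"
    using True by (subst max_mult_distrib_left) (simp add: algebra_simps)
  ultimately show ?thesis by (simp only: k1_def)
next
  case False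
  have "\<not> s * a \<le> -2" if "s \<in> {0..t}" for s
  proof -
    have "0 \<le> s * a" using that False by simp
    then show ?thesis by linarith
  qed
  then have "(\<lambda>s. indicator {0..t} s * (if s * a \<le> -2 then 1 else 0)) = (\<lambda>s. 0::real)"
    by (auto simp: indicator_def)
  moreover have "0 \<le> t * a" using False assms by simp
  then have "k1 t a = 0" by (simp add: k1_def max_def)
  ultimately show ?thesis by simp
qed

section \<open>Exposed energy and its time integrals\<close>

context eulerian_pair
begin

text \<open>\<open>W\<close> is the energy in S that has been exposed to dissipation by time t. The
  sets used are the half-lines up to \<open>y0 \<xi>\<close>, for V, and the whole line, for the
  limit of V.\<close>

definition W :: "real set \<Rightarrow> real \<Rightarrow> real" where
  "W S t = (LINT z|lborel. indicator S z * ((v z)\<^sup>2 * (if t * v z \<le> -2 then 1 else 0)))"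

definition K1 :: "real set \<Rightarrow> real \<Rightarrow> real" where
  "K1 S t = (LINT z|lborel. indicator S z * k1 t (v z))"

definition K2 :: "real set \<Rightarrow> real \<Rightarrow> real" where
  "K2 S t = (LINT z|lborel. indicator S z * k2 t (v z))"

lemma set_v2_integrable: "S \<in> sets borel \<Longrightarrow> integrable lborel (\<lambda>z. indicator S z * (v z)\<^sup>2)"
  using integrable_mult_indicator[OF _ v2_integrable, of S] by simp

lemma W_integrable:
  "S \<in> sets borel \<Longrightarrow> integrable lborel (\<lambda>z. indicator S z * ((v z)\<^sup>2 * (if t * v z \<le> -2 then 1 else 0)))"
  by (rule Bochner_Integration.integrable_bound[OF v2_integrable]) (auto simp: indicator_def)

lemma K1_integrable:
  assumes [measurable]: "S \<in> sets borel"
  shows "integrable lborel (\<lambda>z. indicator S z * k1 t (v z))"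
proof (rule Bochner_Integration.integrable_bound)
  show "integrable lborel (\<lambda>z. \<bar>t\<bar> * (v z)\<^sup>2)" using v2_integrable by simp
  show "AE z in lborel. norm (indicator S z * k1 t (v z)) \<le> norm (\<bar>t\<bar> * (v z)\<^sup>2)"
    using k1_bound[of t] by (intro AE_I2) (auto simp: indicator_def abs_mult)
qed simp

lemma K2_integrable:
  assumes [measurable]: "S \<in> sets borel"
  shows "integrable lborel (\<lambda>z. indicator S z * k2 t (v z))"
proof (rule Bochner_Integration.integrable_bound)
  show "integrable lborel (\<lambda>z. t\<^sup>2 / 2 * (v z)\<^sup>2)" using v2_integrable by simp
  show "AE z in lborel. norm (indicator S z * k2 t (v z)) \<le> norm (t\<^sup>2 / 2 * (v z)\<^sup>2)"
    using k2_bound[of t] by (intro AE_I2) (auto simp: indicator_def abs_mult)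
qed simp

text \<open>Only an inequality, because \<open>Ftot\<close> also counts the singular mass.\<close>

lemma v2_total: "(LINT z|lborel. (v z)\<^sup>2) \<le> Ftot"
proof -
  have "ennreal (LINT z|lborel. (v z)\<^sup>2) = (\<integral>\<^sup>+z. ennreal ((v z)\<^sup>2) \<partial>lborel)"
    by (rule nn_integral_eq_integral[symmetric]) (auto simp: v2_integrable)
  also have "\<dots> \<le> emeasure \<mu> UNIV"
    using \<mu>_split[of UNIV] by simp
  also have "\<dots> = ennreal Ftot"
    using fin_\<mu> by (simp add: Ftot_def finite_measure.emeasure_eq_measure)
  finally show ?thesis using F_nonneg by (simp add: ennreal_le_iff)
qed

lemma set_v2_total: "S \<in> sets borel \<Longrightarrow> (LINT z|lborel. indicator S z * (v z)\<^sup>2) \<le> Ftot"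
  by (rule order_trans[OF integral_mono[OF set_v2_integrable v2_integrable] v2_total]) (auto simp: indicator_def)

lemma K2_le:
  assumes "S \<in> sets borel"
  shows "\<bar>K2 S t\<bar> \<le> t\<^sup>2 / 2 * Ftot"
proof -
  have "\<bar>K2 S t\<bar> \<le> (LINT z|lborel. t\<^sup>2 / 2 * (indicator S z * (v z)\<^sup>2))"
    unfolding K2_def
    using K2_integrable[OF assms] set_v2_integrable[OF assms] k2_bound[of t]
    by (intro integral_abs_bound_integral) (auto split: split_indicator)
  also have "\<dots> \<le> t\<^sup>2 / 2 * Ftot"
    using set_v2_total[OF assms] by (simp add: mult_left_mono)
  finally show ?thesis .
qed

text \<open>Fubini in time and space. \<open>W\<close> may jump in time when a set of positive
  measure breaks at once, so the equation for U is reached in integrated form.\<close>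

lemma W_has_integral:
  assumes S [measurable]: "S \<in> sets borel" and t: "0 \<le> t"
  shows "(W S has_integral K1 S t) {0..t}"
proof -
  let ?p = "indicator {0..t} :: real \<Rightarrow> real" and ?q = "\<lambda>z. indicator S z * (v z)\<^sup>2"
  let ?f = "\<lambda>s z. ?p s * ?q z * (if s * v z \<le> -2 then 1 else 0)"
  have p: "integrable lborel ?p"
    by (rule integrable_real_indicator) (auto simp: emeasure_lborel_Icc_eq)
  have f: "integrable (lborel \<Otimes>\<^sub>M lborel) (case_prod ?f)"
    by (rule Bochner_Integration.integrable_bound[OF integrable_tensor[OF p set_v2_integrable[OF S]]]) auto
  have i1: "(LINT z|lborel. ?f s z) = indicator {0..t} s *\<^sub>R W S s" for s
    unfolding W_def by (simp add: mult.assoc)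
  have i2: "(LINT s|lborel. ?f s z) = indicator S z * k1 t (v z)" for z
  proof -
    have "(LINT s|lborel. ?f s z) = (LINT s|lborel. ?q z * (?p s * (if s * v z \<le> -2 then 1 else 0)))"
      by (rule Bochner_Integration.integral_cong) (auto simp: mult_ac)
    also have "\<dots> = ?q z * (LINT s|lborel. ?p s * (if s * v z \<le> -2 then 1 else 0))"
      by (rule integral_mult_right_zero)
    finally show ?thesis using exposure_integral[OF t, of "v z"] by (simp add: mult.assoc)
  qed
  have si: "set_integrable lborel {0..t} (W S)"
    using lborel_pair.integrable_fst'[OF f] by (simp add: set_integrable_def i1)
  have "(LINT s:{0..t}|lborel. W S s) = K1 S t"
    unfolding set_lebesgue_integral_def i1[symmetric] K1_def i2[symmetric]
    by (rule lborel_pair.Fubini_integral[OF f, symmetric])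
  then show ?thesis
    using set_borel_integral_eq_integral[OF si] by (simp add: has_integral_integral)
qed

text \<open>Integrating \<open>k2_expansion\<close> bounds the error of the difference quotient by
  |s - t| * Ftot / 2. So \<open>K2\<close> is differentiable at every time, as the pointwise
  equation for y demands.\<close>

lemma K2_has_derivative:
  assumes S [measurable]: "S \<in> sets borel"
  shows "(K2 S has_real_derivative K1 S t) (at t)"
  unfolding has_field_derivative_iff
proof (rule LIM_zero_cancel, rule Lim_null_comparison)
  have "((\<lambda>s. \<bar>s - t\<bar> * Ftot / 2) \<longlongrightarrow> \<bar>t - t\<bar> * Ftot / 2) (at t)"
    by (rule tendsto_intros | simp)+
  then show "((\<lambda>s. \<bar>s - t\<bar> * Ftot / 2) \<longlongrightarrow> 0) (at t)" by simp
  show "\<forall>\<^sub>F s in at t. norm ((K2 S s - K2 S t) / (s - t) - K1 S t) \<le> \<bar>s - t\<bar> * Ftot / 2"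
    unfolding eventually_at_filter
  proof (intro always_eventually allI impI)
    fix s assume s: "s \<noteq> t"
    have "K2 S s - K2 S t - (s - t) * K1 S t = (LINT z|lborel. indicator S z * k2 s (v z)
        - indicator S z * k2 t (v z) - (s - t) * (indicator S z * k1 t (v z)))"
      unfolding K1_def K2_def using K1_integrable[OF S, of t] K2_integrable[OF S, of t] K2_integrable[OF S, of s]
      by simp
    also have "\<dots> = (LINT z|lborel. indicator S z * (k2 s (v z) - k2 t (v z) - (s - t) * k1 t (v z)))"
      by (rule Bochner_Integration.integral_cong) (auto simp: algebra_simps)
    finally have "\<bar>K2 S s - K2 S t - (s - t) * K1 S t\<bar>
        = \<bar>LINT z|lborel. indicator S z * (k2 s (v z) - k2 t (v z) - (s - t) * k1 t (v z))\<bar>"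
      by (rule arg_cong)
    also have "\<dots> \<le> (LINT z|lborel. (s - t)\<^sup>2 / 2 * (indicator S z * (v z)\<^sup>2))"
    proof (rule integral_abs_bound_integral)
      have "integrable lborel (\<lambda>z. indicator S z * k2 s (v z) - indicator S z * k2 t (v z) - (s - t) * (indicator S z * k1 t (v z)))"
        by (intro Bochner_Integration.integrable_diff integrable_mult_right K1_integrable K2_integrable S)
      also have "(\<lambda>z. indicator S z * k2 s (v z) - indicator S z * k2 t (v z) - (s - t) * (indicator S z * k1 t (v z)))
          = (\<lambda>z. indicator S z * (k2 s (v z) - k2 t (v z) - (s - t) * k1 t (v z)))"
        by (auto simp: algebra_simps)
      finally show "integrable lborel (\<lambda>z. indicator S z * (k2 s (v z) - k2 t (v z) - (s - t) * k1 t (v z)))" .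
      show "integrable lborel (\<lambda>z. (s - t)\<^sup>2 / 2 * (indicator S z * (v z)\<^sup>2))"
        by (intro integrable_mult_right set_v2_integrable S)
      show "\<bar>indicator S z * (k2 s (v z) - k2 t (v z) - (s - t) * k1 t (v z))\<bar>
          \<le> (s - t)\<^sup>2 / 2 * (indicator S z * (v z)\<^sup>2)" for z
        using k2_expansion[of s "v z" t] by (simp split: split_indicator)
    qed
    also have "\<dots> \<le> (s - t)\<^sup>2 / 2 * Ftot"
      using set_v2_total[OF S] by (simp add: mult_left_mono)
    also have "\<dots> = \<bar>s - t\<bar> * (\<bar>s - t\<bar> * Ftot / 2)"
    proof -
      have "(s - t)\<^sup>2 = \<bar>s - t\<bar> * \<bar>s - t\<bar>" by (simp add: power2_eq_square)
      then show ?thesis by (simp only: mult.assoc times_divide_eq_left times_divide_eq_right)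
    qed
    finally have "\<bar>K2 S s - K2 S t - (s - t) * K1 S t\<bar> \<le> \<bar>s - t\<bar> * (\<bar>s - t\<bar> * Ftot / 2)" .
    moreover have "(K2 S s - K2 S t) / (s - t) - K1 S t = (K2 S s - K2 S t - (s - t) * K1 S t) / (s - t)"
      using s by (simp add: field_simps)
    ultimately show "norm ((K2 S s - K2 S t) / (s - t) - K1 S t) \<le> \<bar>s - t\<bar> * Ftot / 2"
      using s by (simp add: abs_divide divide_le_eq mult.commute)
  qed
qed

section \<open>Breaking times and the closed form of the solution\<close>

lemma L_map_eq: "L_map (u, \<mu>) = (y0, U0, V0)"
  by (simp add: L_map_def y0_def[abs_def] U0_def[abs_def] V0_def[abs_def] Let_def)

lemma wderiv_measurable:
  assumes "primitive_of f g"
  shows "wderiv f \<in> borel_measurable borel"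
proof -
  obtain \<psi> \<psi>' where "cutoff_pair \<psi> \<psi>'" using cutoff by blast
  then have "primitive_of f (wderiv f)" using assms by (rule wderiv_primitive_of(1))
  then show ?thesis unfolding primitive_of_def by (blast intro: locally_integrable_measurable)
qed

abbreviation broken :: "real \<Rightarrow> real set" where
  "broken t \<equiv> {\<omega>. ereal t \<ge> breaking_time (y0, U0, V0) \<omega> \<and> breaking_time (y0, U0, V0) \<omega> > 0}"

lemma broken_sets [measurable]: "broken t \<in> sets borel"
proof -
  note [measurable] = wderiv_measurable[OF y_primitive] wderiv_measurable[OF U_primitive]
  have [measurable]: "breaking_time (y0, U0, V0) \<in> borel_measurable borel"
    unfolding breaking_time_def by simp
  show ?thesis by measurable
qed

text \<open>Off \<open>N\<close> the weight is positive and cancels in the quotient of the two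
  derivatives, leaving -2 / v. On \<open>N\<close> both derivatives vanish, the breaking time is 0,
  and the requirement that it be positive excludes the label.\<close>

lemma AE_breaking:
  assumes t: "0 \<le> t"
  shows "AE \<eta> in lborel. \<eta> \<in> broken t \<longleftrightarrow> y0 \<eta> \<notin> N \<and> t * v (y0 \<eta>) \<le> -2"
proof -
  obtain \<psi> \<psi>' where c: "cutoff_pair \<psi> \<psi>'" using cutoff by blast
  show ?thesis
    using wderiv_primitive_of(2)[OF c y_primitive] wderiv_primitive_of(2)[OF c U_primitive]
  proof eventually_elim
    case (elim \<eta>)
    let ?a = "v (y0 \<eta>)" and ?w = "w (y0 \<eta>)"
    show ?case
    proof (cases "y0 \<eta> \<in> N")
      case True
      then have "?w = 0" by (simp add: w_def)
      then show ?thesis using True elim by (simp add: breaking_time_def)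
    next
      case False
      then have w: "0 < ?w" by (simp add: w_def add_pos_nonneg)
      show ?thesis
      proof (cases "?a < 0")
        case True
        then have "?a * ?w < 0" using w by (simp add: mult_neg_pos)
        then have "breaking_time (y0, U0, V0) \<eta> = ereal (- 2 / ?a)"
          using elim w by (simp add: breaking_time_def)
        moreover have "0 < - 2 / ?a" using True by (simp add: field_simps)
        moreover have "- 2 / ?a \<le> t \<longleftrightarrow> t * ?a \<le> -2" using True by (simp add: field_simps)
        ultimately show ?thesis using False by simp
      next
        case nn: False
        then have "\<not> ?a * ?w < 0" using w by (simp add: not_less)
        then have "breaking_time (y0, U0, V0) \<eta> = \<infinity>"
          using elim w by (simp add: breaking_time_def)
        moreover have "0 \<le> t * ?a" using nn t by simp
        then have "\<not> t * ?a \<le> -2" by linarith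
        ultimately show ?thesis by simp
      qed
    qed
  qed
qed

text \<open>In this candidate for V the label integral of the dissipated energy has been moved to a
  position integral. \<open>Us\<close> and \<open>ys\<close> arise from it by integrating once and
  twice in time.\<close>

definition Vs :: "real \<Rightarrow> real \<Rightarrow> real \<Rightarrow> real" where
  "Vs \<alpha> t \<xi> = V0 \<xi> - \<alpha> * W {..y0 \<xi>} t"

definition Us :: "real \<Rightarrow> real \<Rightarrow> real \<Rightarrow> real" where
  "Us \<alpha> t \<xi> = U0 \<xi> + t * (V0 \<xi> / 2 - Ftot / 4) - \<alpha> * (K1 {..y0 \<xi>} t / 2 - K1 UNIV t / 4)"

definition ys :: "real \<Rightarrow> real \<Rightarrow> real \<Rightarrow> real" where
  "ys \<alpha> t \<xi> = y0 \<xi> + t * U0 \<xi> + t\<^sup>2 / 2 * (V0 \<xi> / 2 - Ftot / 4)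
     - \<alpha> * (K2 {..y0 \<xi>} t / 2 - K2 UNIV t / 4)"

text \<open>Off \<open>N\<close> one has 1 - w = v^2 w, so the dissipated part of the label density
  is a function of position times \<open>w\<close>, and the change of variables applies to
  it.\<close>

lemma Vs_eq:
  assumes t: "0 \<le> t"
  shows "(LINT \<eta>:{..\<xi>}|lborel. (1 - \<alpha> * indicator (broken t) \<eta>) * wderiv V0 \<eta>) = Vs \<alpha> t \<xi>"
proof -
  obtain \<psi> \<psi>' where c: "cutoff_pair \<psi> \<psi>'" using cutoff by blast
  note [measurable] = wderiv_measurable[OF V_primitive]
  let ?h = "\<lambda>z. (v z)\<^sup>2 * (if t * v z \<le> -2 then 1 else 0)"
  have hi: "integrable lborel ?h" using W_integrable[of UNIV t] by simp
  have i2: "set_integrable lborel {..\<xi>} (\<lambda>\<eta>. ?h (y0 \<eta>) * w (y0 \<eta>))"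
    unfolding set_integrable_def by (rule integrable_mult_indicator[OF _ integral_push(1)[OF hi]]) simp
  have "(LINT \<eta>:{..\<xi>}|lborel. (1 - \<alpha> * indicator (broken t) \<eta>) * wderiv V0 \<eta>)
      = (LINT \<eta>:{..\<xi>}|lborel. (1 - w (y0 \<eta>)) - \<alpha> * (?h (y0 \<eta>) * w (y0 \<eta>)))"
    unfolding set_lebesgue_integral_def
  proof (rule integral_cong_AE)
    show "AE \<eta> in lborel. indicator {..\<xi>} \<eta> *\<^sub>R ((1 - \<alpha> * indicator (broken t) \<eta>) * wderiv V0 \<eta>)
        = indicator {..\<xi>} \<eta> *\<^sub>R ((1 - w (y0 \<eta>)) - \<alpha> * (?h (y0 \<eta>) * w (y0 \<eta>)))"
      using AE_breaking[OF t] wderiv_primitive_of(2)[OF c V_primitive]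
    proof eventually_elim
      case (elim \<eta>)
      have b: "indicator (broken t) \<eta> = (if y0 \<eta> \<notin> N \<and> t * v (y0 \<eta>) \<le> -2 then 1 else (0::real))"
        using elim(1) by (simp add: indicator_def)
      have "1 - w (y0 \<eta>) = (v (y0 \<eta>))\<^sup>2 * w (y0 \<eta>)" if "y0 \<eta> \<notin> N"
      proof -
        have "1 + (v (y0 \<eta>))\<^sup>2 \<noteq> 0" by (smt (verit) zero_le_power2)
        then show ?thesis using that by (simp add: w_def field_simps)
      qed
      then have "?h (y0 \<eta>) * w (y0 \<eta>) = (if y0 \<eta> \<notin> N \<and> t * v (y0 \<eta>) \<le> -2 then 1 - w (y0 \<eta>) else 0)"
        by (simp add: w_def)
      then show ?case unfolding b elim(2) by (simp add: algebra_simps)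
    qed
  qed measurable
  also have "\<dots> = (LINT \<eta>:{..\<xi>}|lborel. (1 - w (y0 \<eta>))) - (LINT \<eta>:{..\<xi>}|lborel. \<alpha> * (?h (y0 \<eta>) * w (y0 \<eta>)))"
    by (rule set_integral_diff(2)[OF V_integral(1)]) (use i2 in simp)
  also have "\<dots> = V0 \<xi> - \<alpha> * (LINT x:{..y0 \<xi>}|lborel. ?h x)"
    by (simp only: V_integral(2) set_integral_push_atMost[OF hi] set_integral_mult_right)
  also have "(LINT x:{..y0 \<xi>}|lborel. ?h x) = W {..y0 \<xi>} t"
    by (simp add: W_def set_lebesgue_integral_def)
  finally show ?thesis by (simp add: Vs_def)
qed

lemma Vs_at_top: "(Vs \<alpha> t \<longlongrightarrow> Ftot - \<alpha> * W UNIV t) at_top"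
proof -
  have "((\<lambda>x. W {..x} t) \<longlongrightarrow> W UNIV t) at_top"
    using tendsto_integral_at_top[OF _ W_integrable[of UNIV t]] by (simp add: W_def)
  then have "((\<lambda>\<xi>. W {..y0 \<xi>} t) \<longlongrightarrow> W UNIV t) at_top"
    by (rule filterlim_compose[OF _ y_at_top])
  then show ?thesis
    unfolding Vs_def[abs_def] by (intro tendsto_intros V_at_top)
qed

lemma U_equation:
  assumes t: "0 \<le> t"
  shows "((\<lambda>s. Vs \<alpha> s \<xi> / 2 - (Ftot - \<alpha> * W UNIV s) / 4) has_integral (Us \<alpha> t \<xi> - U0 \<xi>)) {0..t}"
proof -
  have "((\<lambda>s. (V0 \<xi> / 2 - Ftot / 4) - \<alpha> * (W {..y0 \<xi>} s * (1/2) - W UNIV s * (1/4))) has_integral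
      ((t - 0) *\<^sub>R (V0 \<xi> / 2 - Ftot / 4) - \<alpha> * (K1 {..y0 \<xi>} t * (1/2) - K1 UNIV t * (1/4)))) {0..t}"
    using t
    by (intro has_integral_diff has_integral_mult_right has_integral_mult_left W_has_integral)
      (use has_integral_const_real[of "V0 \<xi> / 2 - Ftot / 4" 0 t] in auto)
  then show ?thesis
    by (simp add: Vs_def Us_def algebra_simps diff_divide_distrib add_divide_distrib)
qed

lemma ys_derivative: "((\<lambda>s. ys \<alpha> s \<xi>) has_real_derivative Us \<alpha> t \<xi>) (at t)"
  unfolding ys_def Us_def
  by (rule derivative_eq_intros K2_has_derivative refl | simp)+

lemma solution:
  shows "is_solution \<alpha> (y0, U0, V0) (ys \<alpha>) (Us \<alpha>) (Vs \<alpha>)"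
  unfolding is_solution_def prod.case
proof (intro exI[of _ "\<lambda>t. Ftot - \<alpha> * W UNIV t"] conjI allI impI)
  have "K2 S 0 = 0" for S by (simp add: K2_def k2_def)
  then show "ys \<alpha> 0 \<xi> = y0 \<xi>" for \<xi> by (simp add: ys_def)
next
  fix t \<xi> :: real assume t: "0 \<le> t"
  show "((\<lambda>s. ys \<alpha> s \<xi>) has_real_derivative Us \<alpha> t \<xi>) (at t within {0..})"
    by (rule has_field_derivative_at_within[OF ys_derivative])
  show "((\<lambda>s. Vs \<alpha> s \<xi> / 2 - (Ftot - \<alpha> * W UNIV s) / 4) has_integral Us \<alpha> t \<xi> - U0 \<xi>) {0..t}"
    by (rule U_equation[OF t])
  show "Vs \<alpha> t \<xi> = (LINT \<eta>:{..\<xi>}|lborel. (1 - \<alpha> * indicator (broken t) \<eta>) * wderiv V0 \<eta>)"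
    by (rule Vs_eq[OF t, symmetric])
  show "(Vs \<alpha> t \<longlongrightarrow> Ftot - \<alpha> * W UNIV t) at_top" by (rule Vs_at_top)
qed

text \<open>The system is a cascade. V is prescribed by the initial data alone, which fixes its
  limit; then U is determined as a time integral, and y has a prescribed derivative and initial
  value.\<close>

lemma solution_unique:
  assumes sol: "is_solution \<alpha> (y0, U0, V0) y U V" and t: "0 \<le> t"
  shows "y t = ys \<alpha> t" "U t = Us \<alpha> t" "V t = Vs \<alpha> t"
proof -
  obtain Vinf where *: "\<forall>\<xi>. y 0 \<xi> = y0 \<xi>"
    "\<forall>t\<ge>0. \<forall>\<xi>. ((\<lambda>s. y s \<xi>) has_real_derivative U t \<xi>) (at t within {0..})"
    "\<forall>t\<ge>0. \<forall>\<xi>. ((\<lambda>s. V s \<xi> / 2 - Vinf s / 4) has_integral (U t \<xi> - U0 \<xi>)) {0..t}"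
    "\<forall>t\<ge>0. \<forall>\<xi>. V t \<xi> = (LINT \<eta>:{..\<xi>}|lborel.
      (1 - \<alpha> * indicator (broken t) \<eta>)
        * wderiv V0 \<eta>)"
    "\<forall>t\<ge>0. (V t \<longlongrightarrow> Vinf t) at_top"
    using sol unfolding is_solution_def prod.case by blast
  have y_init: "y 0 \<xi> = y0 \<xi>" for \<xi> using *(1) by blast
  have yd: "((\<lambda>s. y s \<xi>) has_real_derivative U t \<xi>) (at t within {0..})" if "0 \<le> t" for t \<xi>
    using *(2) that by blast
  have Ui: "((\<lambda>s. V s \<xi> / 2 - Vinf s / 4) has_integral (U t \<xi> - U0 \<xi>)) {0..t}" if "0 \<le> t" for t \<xi>
    using *(3) that by blast
  have Veq: "V t \<xi> = Vs \<alpha> t \<xi>" if "0 \<le> t" for t \<xi>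
    by (simp only: *(4)[rule_format, OF that] Vs_eq[OF that])
  have Vl: "(V t \<longlongrightarrow> Vinf t) at_top" if "0 \<le> t" for t
    using *(5) that by blast
  have Vi: "Vinf t = Ftot - \<alpha> * W UNIV t" if "0 \<le> t" for t
  proof -
    have "V t = Vs \<alpha> t" using Veq[OF that] by auto
    then show ?thesis using Vl[OF that] Vs_at_top[of \<alpha> t] tendsto_unique[OF trivial_limit_at_top_linorder] by metis
  qed
  have Ueq: "U t \<xi> = Us \<alpha> t \<xi>" if "0 \<le> t" for t \<xi>
  proof -
    have "((\<lambda>s. V s \<xi> / 2 - Vinf s / 4) has_integral (Us \<alpha> t \<xi> - U0 \<xi>)) {0..t}"
      using U_equation[OF that, of \<alpha> \<xi>] by (rule has_integral_eq[rotated]) (simp add: Veq Vi)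
    then show ?thesis using has_integral_unique[OF Ui[OF that, of \<xi>]] by fastforce
  qed
  have "y t \<xi> = ys \<alpha> t \<xi>" for \<xi>
  proof -
    have "\<exists>c. \<forall>s\<in>{0..}. y s \<xi> - ys \<alpha> s \<xi> = c"
    proof (rule has_field_derivative_zero_constant)
      fix s :: real assume "s \<in> {0..}"
      then show "((\<lambda>s. y s \<xi> - ys \<alpha> s \<xi>) has_real_derivative 0) (at s within {0..})"
        using DERIV_diff[OF yd[of s \<xi>] has_field_derivative_at_within[OF ys_derivative[of \<alpha> \<xi> s]]] Ueq[of s \<xi>]
        by simp
    qed simp
    then obtain c where c: "\<And>s. 0 \<le> s \<Longrightarrow> y s \<xi> - ys \<alpha> s \<xi> = c" by auto
    moreover have "ys \<alpha> 0 \<xi> = y0 \<xi>" by (simp add: ys_def K2_def k2_def)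
    ultimately show ?thesis using c[of 0] c[OF t] y_init by simp
  qed
  then show "y t = ys \<alpha> t" "U t = Us \<alpha> t" "V t = Vs \<alpha> t" using Ueq[OF t] Veq[OF t] by auto
qed

lemma S_op_eq:
  assumes "0 \<le> t"
  shows "S_op \<alpha> t (L_map (u, \<mu>)) = (ys \<alpha> t, Us \<alpha> t, Vs \<alpha> t)"
  unfolding S_op_def L_map_eq
proof (rule the_equality)
  show "\<exists>y U V. is_solution \<alpha> (y0, U0, V0) y U V \<and> (ys \<alpha> t, Us \<alpha> t, Vs \<alpha> t) = (y t, U t, V t)"
    using solution by blast
qed (use solution_unique[OF _ assms] in auto)

end

section \<open>Eulerian solutions at positive times\<close>

lemma primitive_of_atMost:
  fixes h :: "real \<Rightarrow> real"
  assumes h: "integrable lborel h"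
  shows "primitive_of (\<lambda>x. LINT z|lborel. indicator {..x} z * h z) h"
  unfolding primitive_of_def locally_integrable_def
proof (intro conjI allI impI)
  have [measurable]: "h \<in> borel_measurable borel" using h by auto
  have i: "integrable lborel (\<lambda>z. indicator S z * h z)" if "S \<in> sets borel" for S
    using integrable_mult_indicator[OF _ h, of S] that by simp
  show "set_integrable lborel {a..b} h" for a b using i by (simp add: set_integrable_def)
  fix a b :: real assume ab: "a \<le> b"
  have "(LINT z|lborel. indicator {..b} z * h z) - (LINT z|lborel. indicator {..a} z * h z)
      = (LINT z|lborel. indicator {..b} z * h z - indicator {..a} z * h z)"
    using i by simp
  also have "\<dots> = (LINT z|lborel. indicator {a..b} z * h z)"
  proof (rule integral_cong_AE)
    show "AE z in lborel. indicator {..b} z * h z - indicator {..a} z * h z = indicator {a..b} z * h z"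
      using AE_lborel_singleton[of a] by eventually_elim (use ab in \<open>auto simp: indicator_def\<close>)
  qed auto
  finally show "(LINT z|lborel. indicator {..b} z * h z) - (LINT z|lborel. indicator {..a} z * h z)
      = (LINT x:{a..b}|lborel. h x)"
    by (simp add: set_lebesgue_integral_def)
qed

text \<open>For every \<open>l\<close> this is the contribution of a particle with slope \<open>a\<close> to \<open>\<Delta>y - 2 l \<Delta>U + l\<^sup>2 \<Delta>V0\<close> at time \<open>t\<close>.\<close>

lemma quadratic_form_nonneg:
  assumes "0 \<le> \<alpha>" "\<alpha> \<le> 1"
  shows "0 \<le> 1 + (t - 2 * l) * a + (t\<^sup>2 / 4 + l\<^sup>2 - l * t) * a\<^sup>2 + (- (\<alpha> / 2)) * k2 t a + (l * \<alpha>) * k1 t a"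
    (is "0 \<le> ?q")
proof (cases "t * a \<le> -2")
  case True
  \<comment> \<open>A convex combination of the case \<alpha> = 0, the square of the conservative
    problem, and the case \<alpha> = 1.\<close>
  have "?q = (1 - \<alpha>) * (1 + t * a / 2 - l * a)\<^sup>2 + \<alpha> * (l * a)\<^sup>2"
    using True by (simp add: k1_def k2_def power2_eq_square field_simps)
  then show ?thesis using assms by simp
next
  case False
  then have "max 0 (- (t * a) - 2) = 0" by simp
  then have "?q = (1 + t * a / 2 - l * a)\<^sup>2"
    by (simp add: k1_def k2_def power2_eq_square field_simps)
  then show ?thesis by simp
qed

context eulerian_pair
begin

lemma K1_primitive: "primitive_of (\<lambda>x. K1 {..x} t) (\<lambda>z. k1 t (v z))"
  unfolding K1_def using K1_integrable[of UNIV t] by (intro primitive_of_atMost) simp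

lemma K2_primitive: "primitive_of (\<lambda>x. K2 {..x} t) (\<lambda>z. k2 t (v z))"
  unfolding K2_def using K2_integrable[of UNIV t] by (intro primitive_of_atMost) simp

text \<open>The pointwise quadratic form is integrated over [y0 a, y0 b]. The rest of the increment
  of \<open>V0\<close>, due to singular mass, enters with coefficient (t/2 - l)^2 and is
  nonnegative. The discriminant then gives the first claim and the constant coefficient the second.
  The initial \<open>V0\<close> serves instead of the current V because its increments are bounded
  by \<open>Ftot\<close> anyway.\<close>

lemma solution_increments:
  assumes \<alpha>: "0 \<le> \<alpha>" "\<alpha> \<le> 1" and ab: "a \<le> b"
  shows "(Us \<alpha> t b - Us \<alpha> t a)\<^sup>2 \<le> (ys \<alpha> t b - ys \<alpha> t a) * Ftot" "ys \<alpha> t a \<le> ys \<alpha> t b"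
proof -
  let ?i = "\<lambda>z. indicator {y0 a..y0 b} z :: real"
  have ll: "y0 a \<le> y0 b" using ab by (rule y_mono)
  have i: "integrable lborel ?i" "integrable lborel (\<lambda>z. ?i z * v z)" "integrable lborel (\<lambda>z. ?i z * (v z)\<^sup>2)"
      "integrable lborel (\<lambda>z. ?i z * k1 t (v z))" "integrable lborel (\<lambda>z. ?i z * k2 t (v z))"
    using u_v set_v2_integrable K1_integrable K2_integrable
    by (auto simp: primitive_of_def locally_integrable_def set_integrable_def emeasure_lborel_Icc_eq)
  have d1: "(LINT z|lborel. ?i z) = y0 b - y0 a" using ll by simp
  have d2: "(LINT z|lborel. ?i z * v z) = U0 b - U0 a"
    using primitive_ofD[OF u_v ll] by (simp add: U0_def set_lebesgue_integral_def)
  have d3: "(LINT z|lborel. ?i z * k1 t (v z)) = K1 {..y0 b} t - K1 {..y0 a} t"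
    using primitive_ofD[OF K1_primitive ll] by (simp add: set_lebesgue_integral_def)
  have d4: "(LINT z|lborel. ?i z * k2 t (v z)) = K2 {..y0 b} t - K2 {..y0 a} t"
    using primitive_ofD[OF K2_primitive ll] by (simp add: set_lebesgue_integral_def)
  define E where "E = (LINT z|lborel. ?i z * (v z)\<^sup>2)"
  have sE: "set_integrable lborel {y0 a..y0 b} (\<lambda>z. (v z)\<^sup>2)" using i(3) by (simp add: set_integrable_def)
  \<comment> \<open>\<open>E\<close> sees only the absolutely continuous energy: v^2 w equals 1 - w
    off \<open>N\<close>, and is 0 on \<open>N\<close> where 1 - w is 1.\<close>
  have E_le: "E \<le> V0 b - V0 a"
  proof -
    have "E = (LINT \<xi>:{a..b}|lborel. (v (y0 \<xi>))\<^sup>2 * w (y0 \<xi>))"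
      using set_integral_push(2)[OF sE ab] by (simp add: E_def set_lebesgue_integral_def)
    also have "\<dots> \<le> (LINT \<xi>:{a..b}|lborel. 1 - w (y0 \<xi>))"
    proof (rule set_integral_mono[OF set_integral_push(1)[OF sE ab]])
      show "set_integrable lborel {a..b} (\<lambda>\<xi>. 1 - w (y0 \<xi>))"
        using V_primitive by (simp add: primitive_of_def locally_integrable_def)
      show "(v (y0 \<xi>))\<^sup>2 * w (y0 \<xi>) \<le> 1 - w (y0 \<xi>)" for \<xi>
      proof -
        have "0 < 1 + (v (y0 \<xi>))\<^sup>2" by (simp add: add_pos_nonneg)
        then show ?thesis by (simp add: w_def field_simps)
      qed
    qed
    also have "\<dots> = V0 b - V0 a" using primitive_ofD[OF V_primitive ab] by simp
    finally show ?thesis .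
  qed
  have main: "0 \<le> (ys \<alpha> t b - ys \<alpha> t a) - 2 * l * (Us \<alpha> t b - Us \<alpha> t a) + l\<^sup>2 * (V0 b - V0 a)" for l
  proof -
    let ?c = "t\<^sup>2 / 4 + l\<^sup>2 - l * t"
    let ?q = "\<lambda>z. ?i z + (t - 2 * l) * (?i z * v z) + ?c * (?i z * (v z)\<^sup>2)
        + (- (\<alpha> / 2)) * (?i z * k2 t (v z)) + (l * \<alpha>) * (?i z * k1 t (v z))"
    have "0 \<le> (LINT z|lborel. ?q z)"
    proof (rule integral_nonneg_AE, rule AE_I2)
      fix z
      have "?q z = ?i z * (1 + (t - 2 * l) * v z + ?c * (v z)\<^sup>2 + (- (\<alpha> / 2)) * k2 t (v z) + (l * \<alpha>) * k1 t (v z))"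
        by (simp split: split_indicator)
      then show "0 \<le> ?q z" using quadratic_form_nonneg[OF \<alpha>, of t l "v z"] by simp
    qed
    also have "(LINT z|lborel. ?q z) = (y0 b - y0 a) + (t - 2 * l) * (U0 b - U0 a) + ?c * E
        + (- (\<alpha> / 2)) * (K2 {..y0 b} t - K2 {..y0 a} t) + (l * \<alpha>) * (K1 {..y0 b} t - K1 {..y0 a} t)"
      unfolding E_def d1[symmetric] d2[symmetric] d3[symmetric] d4[symmetric]
      using i by (simp del: integral_indicator)
    also have "\<dots> + ?c * (V0 b - V0 a - E) = (ys \<alpha> t b - ys \<alpha> t a) - 2 * l * (Us \<alpha> t b - Us \<alpha> t a) + l\<^sup>2 * (V0 b - V0 a)"
      by (simp add: ys_def Us_def algebra_simps add_divide_distrib diff_divide_distrib)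
    moreover have "0 \<le> ?c * (V0 b - V0 a - E)"
    proof -
      have "?c = (t / 2 - l)\<^sup>2" by (simp add: power2_eq_square field_simps)
      then show ?thesis using E_le by simp
    qed
    ultimately show ?thesis by linarith
  qed
  have V: "0 \<le> V0 b - V0 a" "V0 b - V0 a \<le> Ftot"
    using V_mono[OF ab] V_bounds(4)[of b] V_bounds(3)[of a] by auto
  from discriminant_le[OF main V(1)]
  have "(Us \<alpha> t b - Us \<alpha> t a)\<^sup>2 \<le> (ys \<alpha> t b - ys \<alpha> t a) * (V0 b - V0 a)" "0 \<le> ys \<alpha> t b - ys \<alpha> t a"
    by auto
  moreover from this(2) V(2) have "(ys \<alpha> t b - ys \<alpha> t a) * (V0 b - V0 a) \<le> (ys \<alpha> t b - ys \<alpha> t a) * Ftot"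
    by (rule mult_left_mono[rotated])
  ultimately show "(Us \<alpha> t b - Us \<alpha> t a)\<^sup>2 \<le> (ys \<alpha> t b - ys \<alpha> t a) * Ftot" "ys \<alpha> t a \<le> ys \<alpha> t b"
    by auto
qed

lemma solution_Holder:
  assumes "0 \<le> \<alpha>" "\<alpha> \<le> 1"
  shows "(Us \<alpha> t b - Us \<alpha> t a)\<^sup>2 \<le> \<bar>ys \<alpha> t b - ys \<alpha> t a\<bar> * Ftot"
proof (cases "a \<le> b")
  case True
  then show ?thesis using solution_increments[OF assms True] by simp
next
  case False
  then have "b \<le> a" by simp
  from solution_increments[OF assms this] show ?thesis by (simp add: power2_commute)
qed

text \<open>Cauchy-Schwarz for 1 and v on [a, b], read off from the discriminant of the integral of
  (1 - l v)^2.\<close>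

lemma u_Holder:
  assumes "a \<le> b"
  shows "(u b - u a)\<^sup>2 \<le> (b - a) * (LINT z|lborel. indicator {a..b} z * (v z)\<^sup>2)"
proof (rule discriminant_le(1))
  have i: "integrable lborel (indicator {a..b} :: real \<Rightarrow> real)" "integrable lborel (\<lambda>z. indicator {a..b} z * v z)"
      "integrable lborel (\<lambda>z. indicator {a..b} z * (v z)\<^sup>2)"
    using u_v set_v2_integrable
    by (auto simp: primitive_of_def locally_integrable_def set_integrable_def emeasure_lborel_Icc_eq)
  show "0 \<le> (LINT z|lborel. indicator {a..b} z * (v z)\<^sup>2)" by simp
  fix l :: real
  have "0 \<le> (LINT z|lborel. indicator {a..b} z * (1 - l * v z)\<^sup>2)" by simp
  also have "\<dots> = (LINT z|lborel. indicator {a..b} z - 2 * l * (indicator {a..b} z * v z) + l\<^sup>2 * (indicator {a..b} z * (v z)\<^sup>2))"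
    by (rule Bochner_Integration.integral_cong) (auto simp: power2_eq_square algebra_simps)
  also have "\<dots> = (LINT z|lborel. indicator {a..b} z) - 2 * l * (LINT z|lborel. indicator {a..b} z * v z)
      + l\<^sup>2 * (LINT z|lborel. indicator {a..b} z * (v z)\<^sup>2)"
    using i by (simp del: integral_indicator)
  also have "(LINT z|lborel. indicator {a..b} z * v z) = u b - u a"
    using primitive_ofD[OF u_v assms] by (simp add: set_lebesgue_integral_def)
  finally show "0 \<le> b - a - 2 * l * (u b - u a) + l\<^sup>2 * (LINT z|lborel. indicator {a..b} z * (v z)\<^sup>2)"
    using assms by simp
qed

lemma u_Holder': "(u b - u a)\<^sup>2 \<le> \<bar>b - a\<bar> * Ftot"
proof -
  have *: "(u b - u a)\<^sup>2 \<le> (b - a) * Ftot" if "a \<le> b" for a b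
    using u_Holder[OF that] mult_left_mono[OF set_v2_total[of "{a..b}"], of "b - a"] that by simp
  show ?thesis using *[of a b] *[of b a] by (cases "a \<le> b") (auto simp: power2_commute)
qed

section \<open>Characteristics cover the line; the Eulerian solution\<close>

lemma ys_continuous: "continuous_on UNIV (ys \<alpha> t)"
proof -
  have "continuous_on UNIV (\<lambda>\<xi>. K2 {..y0 \<xi>} t)"
    by (rule continuous_on_compose2[OF primitive_of_continuous[OF K2_primitive] y_continuous]) simp
  then show ?thesis
    unfolding ys_def
    by (intro continuous_intros y_continuous primitive_of_continuous[OF U_primitive] primitive_of_continuous[OF V_primitive]) simp_all
qed

lemma Us_continuous: "continuous_on UNIV (Us \<alpha> t)"
proof -
  have "continuous_on UNIV (\<lambda>\<xi>. K1 {..y0 \<xi>} t)"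
    by (rule continuous_on_compose2[OF primitive_of_continuous[OF K1_primitive] y_continuous]) simp
  then show ?thesis
    unfolding Us_def
    by (intro continuous_intros primitive_of_continuous[OF U_primitive] primitive_of_continuous[OF V_primitive]) simp_all
qed

text \<open>By the Hoelder bound \<open>U0\<close> grows at most like the square root of |y0|, so
  half of |y0| absorbs it and \<open>ys\<close> still tends to both infinities. The intermediate
  value theorem does the rest.\<close>

lemma ys_surj:
  assumes t: "0 \<le> t"
  shows "\<exists>\<xi>. ys \<alpha> t \<xi> = x"
proof -
  \<comment> \<open>In order: the value u 0, the remainder of the arithmetic-geometric mean
    inequality for t * |U0 - u 0|, the term with \<open>V0\<close>, and the two terms with
    \<open>K2\<close>.\<close>
  define C where "C = t * \<bar>u 0\<bar> + t\<^sup>2 * Ftot / 2 + t\<^sup>2 / 2 * Ftot + \<bar>\<alpha>\<bar> * (t\<^sup>2 / 2 * Ftot)"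
  have close: "\<bar>ys \<alpha> t \<xi> - y0 \<xi>\<bar> \<le> \<bar>y0 \<xi>\<bar> / 2 + C" for \<xi>
  proof -
    have "t * \<bar>U0 \<xi> - u 0\<bar> \<le> \<bar>y0 \<xi>\<bar> / 2 + t\<^sup>2 * Ftot / 2"
    proof (rule power2_le_imp_le)
      have "(t * \<bar>U0 \<xi> - u 0\<bar>)\<^sup>2 \<le> t\<^sup>2 * (\<bar>y0 \<xi>\<bar> * Ftot)"
        using u_Holder'[of "y0 \<xi>" 0] by (simp add: U0_def power_mult_distrib mult_left_mono)
      also have "\<dots> = 4 * ((\<bar>y0 \<xi>\<bar> / 2) * (t\<^sup>2 * Ftot / 2))" by simp
      also have "\<dots> \<le> (\<bar>y0 \<xi>\<bar> / 2 + t\<^sup>2 * Ftot / 2)\<^sup>2"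
      proof -
        have "0 \<le> (\<bar>y0 \<xi>\<bar> / 2 - t\<^sup>2 * Ftot / 2)\<^sup>2" by simp
        then show ?thesis by (simp add: power2_eq_square algebra_simps)
      qed
      finally show "(t * \<bar>U0 \<xi> - u 0\<bar>)\<^sup>2 \<le> (\<bar>y0 \<xi>\<bar> / 2 + t\<^sup>2 * Ftot / 2)\<^sup>2" .
    qed (use F_nonneg in simp)
    moreover have "\<bar>t * U0 \<xi>\<bar> \<le> t * \<bar>U0 \<xi> - u 0\<bar> + t * \<bar>u 0\<bar>"
      using t by (simp add: abs_mult mult_left_mono flip: distrib_left)
    moreover have "\<bar>t\<^sup>2 / 2 * (V0 \<xi> / 2 - Ftot / 4)\<bar> \<le> t\<^sup>2 / 2 * Ftot"
      unfolding abs_mult using V_bounds(3,4)[of \<xi>] by (intro mult_mono) auto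
    moreover have "\<bar>\<alpha> * (K2 {..y0 \<xi>} t / 2 - K2 UNIV t / 4)\<bar> \<le> \<bar>\<alpha>\<bar> * (t\<^sup>2 / 2 * Ftot)"
    proof -
      have "\<bar>K2 {..y0 \<xi>} t\<bar> \<le> t\<^sup>2 / 2 * Ftot" "\<bar>K2 UNIV t\<bar> \<le> t\<^sup>2 / 2 * Ftot"
        by (rule K2_le, simp)+
      then have "\<bar>K2 {..y0 \<xi>} t / 2 - K2 UNIV t / 4\<bar> \<le> t\<^sup>2 / 2 * Ftot" by linarith
      then show ?thesis unfolding abs_mult by (rule mult_left_mono) simp
    qed
    ultimately show ?thesis unfolding ys_def C_def by linarith
  qed
  have C: "0 \<le> C" using t F_nonneg by (simp add: C_def)
  \<comment> \<open>At a one has y0 \<le> a, at b one has y0 \<ge> b - Ftot; in both cases |y0| / 2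
    - C is at least |x|.\<close>
  define a where "a = - (2 * (\<bar>x\<bar> + C))"
  define b where "b = Ftot + 2 * (\<bar>x\<bar> + C)"
  have "ys \<alpha> t a \<le> x" using close[of a] y_bounds(2)[of a] C by (simp add: a_def abs_if split: if_splits)
  moreover have "x \<le> ys \<alpha> t b" using close[of b] y_bounds(1)[of b] C by (simp add: b_def abs_if split: if_splits)
  moreover have "a \<le> b" using C F_nonneg by (simp add: a_def b_def)
  ultimately have "\<exists>\<xi>\<ge>a. \<xi> \<le> b \<and> ys \<alpha> t \<xi> = x"
    by (intro IVT' continuous_on_subset[OF ys_continuous]) auto
  then show ?thesis by blast
qed

abbreviation uT :: "real \<Rightarrow> real \<Rightarrow> real \<Rightarrow> real" where
  "uT \<alpha> t \<equiv> fst (T_op \<alpha> t (u, \<mu>))"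

text \<open>The description operator in \<open>M_map\<close> is well defined: labels at the same
  position have the same U by \<open>solution_Holder\<close>.\<close>

lemma T_op_eq:
  assumes \<alpha>: "0 \<le> \<alpha>" "\<alpha> \<le> 1" and t: "0 \<le> t"
  shows "uT \<alpha> t (ys \<alpha> t \<xi>) = Us \<alpha> t \<xi>"
proof -
  have "uT \<alpha> t (ys \<alpha> t \<xi>) = (THE v. \<forall>\<eta>. ys \<alpha> t \<xi> = ys \<alpha> t \<eta> \<longrightarrow> v = Us \<alpha> t \<eta>)"
    by (simp add: T_op_def M_map_def S_op_eq[OF t])
  also have "\<dots> = Us \<alpha> t \<xi>"
  proof (rule the_equality)
    show "\<forall>\<eta>. ys \<alpha> t \<xi> = ys \<alpha> t \<eta> \<longrightarrow> Us \<alpha> t \<xi> = Us \<alpha> t \<eta>"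
    proof (intro allI impI)
      fix \<eta> assume "ys \<alpha> t \<xi> = ys \<alpha> t \<eta>"
      then have "(Us \<alpha> t \<xi> - Us \<alpha> t \<eta>)\<^sup>2 \<le> 0" using solution_Holder[OF \<alpha>, of t \<xi> \<eta>] by simp
      then show "Us \<alpha> t \<xi> = Us \<alpha> t \<eta>" by simp
    qed
  qed blast
  finally show ?thesis .
qed

text \<open>Every point is reached by some label, so the Lagrangian bound transfers, with a constant
  independent of t.\<close>

lemma T_op_Holder:
  assumes \<alpha>: "0 \<le> \<alpha>" "\<alpha> \<le> 1" and t: "0 \<le> t"
  shows "\<bar>uT \<alpha> t x - uT \<alpha> t x'\<bar> \<le> sqrt (\<bar>x - x'\<bar> * Ftot)"
proof -
  obtain \<xi> \<eta> where "ys \<alpha> t \<xi> = x" "ys \<alpha> t \<eta> = x'" using ys_surj[OF t] by metis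
  then show ?thesis
    using solution_Holder[OF \<alpha>, of t \<xi> \<eta>] T_op_eq[OF \<alpha> t, of \<xi>] T_op_eq[OF \<alpha> t, of \<eta>]
    by (auto intro!: real_le_rsqrt)
qed

lemma T_op_continuous:
  assumes \<alpha>: "0 \<le> \<alpha>" "\<alpha> \<le> 1" and t: "0 \<le> t"
  shows "continuous_on UNIV (uT \<alpha> t)"
proof -
  have "isCont (uT \<alpha> t) x" for x
    unfolding isCont_def
  proof (rule LIM_zero_cancel, rule Lim_null_comparison)
    show "\<forall>\<^sub>F z in at x. norm (uT \<alpha> t z - uT \<alpha> t x) \<le> sqrt (\<bar>z - x\<bar> * Ftot)"
      using T_op_Holder[OF assms] by simp
    have "((\<lambda>z. sqrt (\<bar>z - x\<bar> * Ftot)) \<longlongrightarrow> sqrt (\<bar>x - x\<bar> * Ftot)) (at x)"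
      by (intro tendsto_intros)
    then show "((\<lambda>z. sqrt (\<bar>z - x\<bar> * Ftot)) \<longlongrightarrow> 0) (at x)" by simp
  qed
  then show ?thesis by (simp add: continuous_at_imp_continuous_on)
qed

end

section \<open>Energy estimates from the Nikolskii bound\<close>

text \<open>Stated with the nonnegative integral so that Tonelli applies freely. The constant is
  squared because the seminorm controls a norm.\<close>

locale shift_bound =
  fixes v :: "real \<Rightarrow> real" and C \<beta> :: real
  assumes meas_v [measurable]: "v \<in> borel_measurable borel"
    and shift: "0 < h \<Longrightarrow> h \<le> 2 \<Longrightarrow>
      (\<integral>\<^sup>+x. ennreal ((v (x + h) - v x)\<^sup>2) \<partial>lborel) \<le> ennreal (C\<^sup>2 * h powr (2 * \<beta>))"
    and \<beta>_pos: "0 < \<beta>"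
begin

lemma shift_abs:
  assumes "\<bar>k\<bar> \<le> h" "h \<le> 2" "0 < h"
  shows "(\<integral>\<^sup>+x. ennreal ((v (x + k) - v x)\<^sup>2) \<partial>lborel) \<le> ennreal (C\<^sup>2 * h powr (2 * \<beta>))"
proof -
  have mono: "ennreal (C\<^sup>2 * \<bar>k\<bar> powr (2 * \<beta>)) \<le> ennreal (C\<^sup>2 * h powr (2 * \<beta>))"
    using assms \<beta>_pos by (intro ennreal_leI mult_left_mono powr_mono2) auto
  consider "k = 0" | "0 < k" | "k < 0" by linarith
  then show ?thesis
  proof cases
    case 2
    then show ?thesis using shift[of k] assms mono by (auto intro: order_trans)
  next
    case 3
    have "(\<integral>\<^sup>+x. ennreal ((v (x + k) - v x)\<^sup>2) \<partial>lborel)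
        = (\<integral>\<^sup>+x. ennreal ((v (x + - k + k) - v (x + - k))\<^sup>2) \<partial>lborel)"
      using nn_integral_real_affine[of "\<lambda>x. ennreal ((v (x + k) - v x)\<^sup>2)" 1 "- k"] by (simp add: add.commute)
    also have "\<dots> = (\<integral>\<^sup>+x. ennreal ((v (x + - k) - v x)\<^sup>2) \<partial>lborel)"
      by (simp add: power2_commute)
    also have "\<dots> \<le> ennreal (C\<^sup>2 * \<bar>k\<bar> powr (2 * \<beta>))"
      using shift[of "- k"] 3 assms by simp
    finally show ?thesis using mono by (rule order_trans)
  qed simp
qed

text \<open>With z = x + k and the order of integration exchanged, each shift |k| \<le> h costs at
  most the translation bound, and these shifts have total length 2 h.\<close>

lemma two_point_bound:
  assumes "0 < h" "h \<le> 2"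
  shows "(\<integral>\<^sup>+x. (\<integral>\<^sup>+z. ennreal ((v x - v z)\<^sup>2) * indicator {x - h..x + h} z \<partial>lborel) \<partial>lborel)
    \<le> ennreal (2 * h * (C\<^sup>2 * h powr (2 * \<beta>)))"
proof -
  have "(\<integral>\<^sup>+z. ennreal ((v x - v z)\<^sup>2) * indicator {x - h..x + h} z \<partial>lborel)
      = (\<integral>\<^sup>+k. ennreal ((v (x + k) - v x)\<^sup>2) * indicator {- h..h} k \<partial>lborel)" for x
  proof -
    have "(\<integral>\<^sup>+z. ennreal ((v x - v z)\<^sup>2) * indicator {x - h..x + h} z \<partial>lborel)
        = (\<integral>\<^sup>+k. ennreal ((v x - v (x + k))\<^sup>2) * indicator {x - h..x + h} (x + k) \<partial>lborel)"
      using nn_integral_real_affine[of "\<lambda>z. ennreal ((v x - v z)\<^sup>2) * indicator {x - h..x + h} z" 1 x] by simp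
    also have "\<dots> = (\<integral>\<^sup>+k. ennreal ((v (x + k) - v x)\<^sup>2) * indicator {- h..h} k \<partial>lborel)"
      by (intro nn_integral_cong) (auto simp: power2_commute split: split_indicator)
    finally show ?thesis .
  qed
  then have "(\<integral>\<^sup>+x. (\<integral>\<^sup>+z. ennreal ((v x - v z)\<^sup>2) * indicator {x - h..x + h} z \<partial>lborel) \<partial>lborel)
      = (\<integral>\<^sup>+x. (\<integral>\<^sup>+k. ennreal ((v (x + k) - v x)\<^sup>2) * indicator {- h..h} k \<partial>lborel) \<partial>lborel)"
    by simp
  also have "\<dots> = (\<integral>\<^sup>+k. (\<integral>\<^sup>+x. ennreal ((v (x + k) - v x)\<^sup>2) * indicator {- h..h} k \<partial>lborel) \<partial>lborel)"
    by (rule lborel_pair.Fubini') measurable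
  also have "\<dots> \<le> (\<integral>\<^sup>+k. ennreal (C\<^sup>2 * h powr (2 * \<beta>)) * indicator {- h..h} k \<partial>lborel)"
    using shift_abs[OF _ assms(2,1)] by (intro nn_integral_mono) (auto simp: nn_integral_multc split: split_indicator)
  also have "\<dots> = ennreal (C\<^sup>2 * h powr (2 * \<beta>)) * ennreal (2 * h)"
    using assms by (simp add: nn_integral_cmult_indicator)
  also have "\<dots> = ennreal (2 * h * (C\<^sup>2 * h powr (2 * \<beta>)))"
    using assms by (simp add: ennreal_mult' [symmetric] mult.commute)
  finally show ?thesis .
qed

text \<open>Averaging over all translations by at most \<open>\<delta>\<close> compares the energy in a small set with the total energy.\<close>

lemma small_set_energy:
  assumes S [measurable]: "S \<in> sets borel" and h: "emeasure lborel S = ennreal h" "0 \<le> h"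
    and \<delta>: "0 < \<delta>" "\<delta> \<le> 2" and F: "(\<integral>\<^sup>+x. ennreal ((v x)\<^sup>2) \<partial>lborel) \<le> ennreal F" "0 \<le> F"
  shows "ennreal \<delta> * (\<integral>\<^sup>+x. ennreal ((v x)\<^sup>2) * indicator S x \<partial>lborel)
    \<le> ennreal (2 * h * F + 2 * \<delta> * (C\<^sup>2 * \<delta> powr (2 * \<beta>)))"
proof -
  have "ennreal \<delta> * (\<integral>\<^sup>+x. ennreal ((v x)\<^sup>2) * indicator S x \<partial>lborel)
      = (\<integral>\<^sup>+k. (\<integral>\<^sup>+x. ennreal ((v x)\<^sup>2) * indicator S x \<partial>lborel) * indicator {0..\<delta>} k \<partial>lborel)"
    using \<delta> by (subst nn_integral_cmult_indicator) (auto simp: mult.commute)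
  also have "\<dots> = (\<integral>\<^sup>+k. (\<integral>\<^sup>+x. ennreal ((v x)\<^sup>2) * indicator S x * indicator {0..\<delta>} k \<partial>lborel) \<partial>lborel)"
    by (simp add: nn_integral_multc)
  also have "\<dots> \<le> (\<integral>\<^sup>+k. (\<integral>\<^sup>+x. 2 * (ennreal ((v (x + k))\<^sup>2) * indicator S x * indicator {0..\<delta>} k)
      + 2 * (ennreal ((v (x + k) - v x)\<^sup>2) * indicator {0..\<delta>} k) \<partial>lborel) \<partial>lborel)"
  proof (intro nn_integral_mono)
    fix k x
    have "(v x)\<^sup>2 \<le> 2 * (v (x + k))\<^sup>2 + 2 * (v (x + k) - v x)\<^sup>2"
    proof -
      have "0 \<le> (2 * v (x + k) - v x)\<^sup>2" by simp
      then show ?thesis by (simp add: power2_eq_square algebra_simps)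
    qed
    then have "ennreal ((v x)\<^sup>2) \<le> ennreal (2 * (v (x + k))\<^sup>2 + 2 * (v (x + k) - v x)\<^sup>2)"
      by (rule ennreal_leI)
    also have "\<dots> = 2 * ennreal ((v (x + k))\<^sup>2) + 2 * ennreal ((v (x + k) - v x)\<^sup>2)"
      by (simp add: ennreal_plus ennreal_mult)
    finally show "ennreal ((v x)\<^sup>2) * indicator S x * indicator {0..\<delta>} k
        \<le> 2 * (ennreal ((v (x + k))\<^sup>2) * indicator S x * indicator {0..\<delta>} k)
      + 2 * (ennreal ((v (x + k) - v x)\<^sup>2) * indicator {0..\<delta>} k)"
      by (auto split: split_indicator)
  qed
  also have "\<dots> = 2 * (\<integral>\<^sup>+k. (\<integral>\<^sup>+x. ennreal ((v (x + k))\<^sup>2) * indicator S x * indicator {0..\<delta>} k \<partial>lborel) \<partial>lborel)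
      + 2 * (\<integral>\<^sup>+k. (\<integral>\<^sup>+x. ennreal ((v (x + k) - v x)\<^sup>2) * indicator {0..\<delta>} k \<partial>lborel) \<partial>lborel)"
    by (simp add: nn_integral_add nn_integral_cmult)
  also have "\<dots> \<le> 2 * ennreal (F * h) + 2 * ennreal (C\<^sup>2 * \<delta> powr (2 * \<beta>) * \<delta>)"
  proof (intro add_mono mult_left_mono)
    \<comment> \<open>For fixed x the shifted points sweep out at most the whole line, which costs
      F; then only the length h of S remains.\<close>
    have "(\<integral>\<^sup>+k. (\<integral>\<^sup>+x. ennreal ((v (x + k))\<^sup>2) * indicator S x * indicator {0..\<delta>} k \<partial>lborel) \<partial>lborel)
        = (\<integral>\<^sup>+x. (\<integral>\<^sup>+k. ennreal ((v (x + k))\<^sup>2) * indicator S x * indicator {0..\<delta>} k \<partial>lborel) \<partial>lborel)"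
      by (rule lborel_pair.Fubini'[symmetric]) measurable
    also have "\<dots> \<le> (\<integral>\<^sup>+x. ennreal F * indicator S x \<partial>lborel)"
    proof (rule nn_integral_mono)
      fix x
      have "(\<integral>\<^sup>+k. ennreal ((v (x + k))\<^sup>2) * indicator S x * indicator {0..\<delta>} k \<partial>lborel)
          \<le> (\<integral>\<^sup>+k. ennreal ((v (x + k))\<^sup>2) * indicator S x \<partial>lborel)"
        by (intro nn_integral_mono) (auto split: split_indicator)
      also have "\<dots> = (\<integral>\<^sup>+k. ennreal ((v (x + k))\<^sup>2) \<partial>lborel) * indicator S x"
        by (rule nn_integral_multc) measurable
      also have "(\<integral>\<^sup>+k. ennreal ((v (x + k))\<^sup>2) \<partial>lborel) = (\<integral>\<^sup>+x. ennreal ((v x)\<^sup>2) \<partial>lborel)"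
        using nn_integral_real_affine[of "\<lambda>x. ennreal ((v x)\<^sup>2)" 1 x] by simp
      also have "\<dots> * indicator S x \<le> ennreal F * indicator S x"
        using F(1) by (intro mult_right_mono) auto
      finally show "(\<integral>\<^sup>+k. ennreal ((v (x + k))\<^sup>2) * indicator S x * indicator {0..\<delta>} k \<partial>lborel) \<le> ennreal F * indicator S x" .
    qed
    also have "\<dots> = ennreal (F * h)"
      using h F by (simp add: nn_integral_cmult_indicator ennreal_mult)
    finally show "(\<integral>\<^sup>+k. (\<integral>\<^sup>+x. ennreal ((v (x + k))\<^sup>2) * indicator S x * indicator {0..\<delta>} k \<partial>lborel) \<partial>lborel) \<le> ennreal (F * h)" .
    have "(\<integral>\<^sup>+k. (\<integral>\<^sup>+x. ennreal ((v (x + k) - v x)\<^sup>2) * indicator {0..\<delta>} k \<partial>lborel) \<partial>lborel)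
        \<le> (\<integral>\<^sup>+k. ennreal (C\<^sup>2 * \<delta> powr (2 * \<beta>)) * indicator {0..\<delta>} k \<partial>lborel)"
      using shift_abs[OF _ \<delta>(2,1)] by (intro nn_integral_mono) (auto simp: nn_integral_multc split: split_indicator)
    also have "\<dots> = ennreal (C\<^sup>2 * \<delta> powr (2 * \<beta>) * \<delta>)"
      using \<delta> by (simp add: nn_integral_cmult_indicator ennreal_mult)
    finally show "(\<integral>\<^sup>+k. (\<integral>\<^sup>+x. ennreal ((v (x + k) - v x)\<^sup>2) * indicator {0..\<delta>} k \<partial>lborel) \<partial>lborel)
        \<le> ennreal (C\<^sup>2 * \<delta> powr (2 * \<beta>) * \<delta>)" .
  qed auto
  also have "\<dots> = ennreal (2 * h * F + 2 * \<delta> * (C\<^sup>2 * \<delta> powr (2 * \<beta>)))"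
    using h F \<delta> by (simp add: ennreal_plus ennreal_mult mult_ac)
  finally show ?thesis .
qed

end

section \<open>The projection\<close>

lemma countable_cells_nn_integral:
  fixes c :: "real \<Rightarrow> int" and f :: "real \<Rightarrow> ennreal"
  assumes [measurable]: "c \<in> measurable borel (count_space UNIV)" "f \<in> borel_measurable borel"
  shows "(\<integral>\<^sup>+x. f x * indicator {x. c x \<in> J} x \<partial>lborel)
    = (\<integral>\<^sup>+j. (\<integral>\<^sup>+x. f x * indicator {x. c x = j} x \<partial>lborel) \<partial>count_space J)"
proof -
  have s: "{x. c x \<in> J} \<in> sets borel" for J
    using measurable_sets[OF assms(1), of J] by (simp add: vimage_def)
  have s': "{x. c x = j} \<in> sets borel" for j using s[of "{j}"] by simp
  have "emeasure (density lborel f) (\<Union>j\<in>J. {x. c x = j})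
      = (\<integral>\<^sup>+j. emeasure (density lborel f) {x. c x = j} \<partial>count_space J)"
    using s' by (intro emeasure_UN_countable) (auto simp: disjoint_family_on_def)
  moreover have "(\<Union>j\<in>J. {x. c x = j}) = {x. c x \<in> J}" by auto
  ultimately show ?thesis using s s' by (simp add: emeasure_density)
qed

locale projection = eulerian_pair u v \<mu> \<sigma> N + shift_bound v C \<beta>
  for u v :: "real \<Rightarrow> real" and \<mu> \<sigma> :: "real measure" and N :: "real set" and C \<beta> :: real +
  fixes s :: "int \<Rightarrow> real" and dx :: real
  assumes dx: "0 < dx" "dx \<le> 1" and sign: "s j = 1 \<or> s j = -1" and C_nonneg: "0 \<le> C" and \<beta>_le: "\<beta> \<le> 1"
begin

interpretation \<mu>: finite_measure \<mu> by (rule fin_\<mu>)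

abbreviation l :: "int \<Rightarrow> real" where "l j \<equiv> grid dx (2 * j)"
abbreviation c :: "int \<Rightarrow> real" where "c j \<equiv> grid dx (2 * j + 1)"
abbreviation r :: "int \<Rightarrow> real" where "r j \<equiv> grid dx (2 * j + 2)"

abbreviation I :: "int \<Rightarrow> real set" where "I j \<equiv> {l j<..r j}"

lemma grid_simps: "c j = l j + dx" "r j = l j + 2 * dx" "l (j + 1) = r j"
  by (simp_all add: grid_def algebra_simps)

lemma cell_iff: "cell dx x = j \<longleftrightarrow> x \<in> I j"
proof -
  have "cell dx x = j \<longleftrightarrow> \<lceil>x / (2 * dx)\<rceil> = j + 1" by (auto simp: cell_def)
  also have "\<dots> \<longleftrightarrow> of_int j < x / (2 * dx) \<and> x / (2 * dx) \<le> of_int j + 1"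
    by (subst ceiling_eq_iff) simp
  also have "\<dots> \<longleftrightarrow> x \<in> I j" using dx by (simp add: grid_def field_simps)
  finally show ?thesis .
qed

lemma cell_eq: "l j < x \<Longrightarrow> x \<le> r j \<Longrightarrow> cell dx x = j"
  by (simp add: cell_iff)

lemma in_cell: "l (cell dx x) < x" "x \<le> r (cell dx x)"
  using cell_iff[of x "cell dx x"] by auto

lemma cell_measurable [measurable]: "cell dx \<in> measurable borel (count_space UNIV)"
  unfolding cell_def[abs_def] by measurable

lemma l_mono: "i \<le> j \<Longrightarrow> l i \<le> l j"
  using dx by (simp add: grid_def)

lemma l_less_iff: "l i < l j \<longleftrightarrow> i < j"
  using dx by (simp add: grid_def)

lemma cell_less_iff: "cell dx x < k \<longleftrightarrow> x \<le> l k"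
proof
  assume "cell dx x < k"
  then have "l (cell dx x + 1) \<le> l k" by (intro l_mono) simp
  then show "x \<le> l k" using in_cell(2)[of x] by (simp add: grid_simps)
next
  assume "x \<le> l k"
  then have "l (cell dx x) < l k" using in_cell(1)[of x] by simp
  then show "cell dx x < k" by (simp only: l_less_iff)
qed

section \<open>Slope and energy of the projected data\<close>

definition Fac :: "real \<Rightarrow> real" where "Fac x = (LINT z|lborel. indicator {..x} z * (v z)\<^sup>2)"

text \<open>\<open>m j\<close> is the mean and \<open>q j\<close> the standard deviation of v over
  cell j. A function equal to m - q on one half of the cell and m + q on the other has the same
  first two moments as v.\<close>

definition m :: "int \<Rightarrow> real" where "m = D_even dx u"
definition q :: "int \<Rightarrow> real" where "q = q_even dx u Fac"

definition vd :: "real \<Rightarrow> real" where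
  "vd x = (let j = cell dx x in if x \<le> c j then m j - s j * q j else m j + s j * q j)"

definition ud :: "real \<Rightarrow> real" where "ud = proj_u s dx u Fac"

lemma vd_measurable [measurable]: "vd \<in> borel_measurable borel"
proof -
  have [measurable]: "(\<lambda>x. f (cell dx x)) \<in> borel_measurable borel" for f :: "int \<Rightarrow> real"
    by (rule measurable_compose[OF cell_measurable]) simp
  show ?thesis unfolding vd_def Let_def by measurable
qed

lemma Fac_primitive: "primitive_of Fac (\<lambda>z. (v z)\<^sup>2)"
  unfolding Fac_def[abs_def] by (rule primitive_of_atMost[OF v2_integrable])

definition E :: "int \<Rightarrow> real" where "E j = (LINT z|lborel. indicator (I j) z * (v z)\<^sup>2)"

lemma integral_Ioc_Icc:
  fixes f :: "real \<Rightarrow> real"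
  assumes [measurable]: "f \<in> borel_measurable borel"
  shows "(LINT z|lborel. indicator {a<..b} z * f z) = (LINT z:{a..b}|lborel. f z)"
  unfolding set_lebesgue_integral_def
proof (rule integral_cong_AE)
  show "AE z in lborel. indicator {a<..b} z * f z = indicator {a..b} z *\<^sub>R f z"
    using AE_lborel_singleton[of a] by eventually_elim (auto simp: indicator_def)
qed auto

lemma E_eq: "E j = Fac (r j) - Fac (l j)"
  using primitive_ofD[OF Fac_primitive, of "l j" "r j"] dx integral_Ioc_Icc[of "\<lambda>z. (v z)\<^sup>2" "l j" "r j"]
  by (simp add: E_def grid_simps)

lemma m_integral: "(LINT z|lborel. indicator (I j) z * v z) = 2 * dx * m j"
  using primitive_ofD[OF u_v, of "l j" "r j"] dx integral_Ioc_Icc[of v "l j" "r j"]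
  by (simp add: m_def D_even_def grid_simps)

text \<open>Cauchy-Schwarz on the cell makes the radicand of \<open>q_even\<close> nonnegative, so
  its square root is a genuine one.\<close>

lemma q_sq: "2 * dx * ((m j)\<^sup>2 + (q j)\<^sup>2) = E j" "0 \<le> q j"
proof -
  have "(u (r j) - u (l j))\<^sup>2 \<le> 2 * dx * E j"
    using u_Holder[of "l j" "r j"] dx integral_Ioc_Icc[of "\<lambda>z. (v z)\<^sup>2" "l j" "r j"]
    by (simp add: E_def grid_simps set_lebesgue_integral_def)
  moreover have "u (r j) - u (l j) = 2 * dx * m j" using dx by (simp add: m_def D_even_def)
  ultimately have "(2 * dx)\<^sup>2 * (m j)\<^sup>2 \<le> 2 * dx * E j" by (simp add: power_mult_distrib)
  then have "2 * dx * (2 * dx * (m j)\<^sup>2) \<le> 2 * dx * E j" by (simp add: power2_eq_square mult_ac)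
  then have le: "2 * dx * (m j)\<^sup>2 \<le> E j" using dx by simp
  have q: "q j = sqrt (E j / (2 * dx) - (m j)\<^sup>2)"
    by (simp add: q_def q_even_def m_def[symmetric] D_even_def[of dx Fac] E_eq)
  have nn: "0 \<le> E j / (2 * dx) - (m j)\<^sup>2" using le dx by (simp add: field_simps)
  then have "(q j)\<^sup>2 = E j / (2 * dx) - (m j)\<^sup>2" by (simp add: q)
  then show "2 * dx * ((m j)\<^sup>2 + (q j)\<^sup>2) = E j" using dx by (simp add: field_simps)
  show "0 \<le> q j" using nn by (simp add: q)
qed

lemma s_sq [simp]: "s j * s j = 1" "(s j)\<^sup>2 = 1" "\<bar>s j\<bar> = 1" "s j * (s j * x) = x"
  using sign[of j] by auto

text \<open>The value at \<open>l j\<close> is left open because that point belongs to the preceding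
  cell. The \<open>min\<close> and \<open>max\<close> with \<open>c j\<close> measure how much of
  [a, b] lies in each half.\<close>

lemma step_integral:
  fixes A B :: real
  assumes ab: "l j \<le> a" "a \<le> b" "b \<le> r j" and f: "\<And>x. l j < x \<Longrightarrow> x \<le> c j \<Longrightarrow> f x = A"
    "\<And>x. c j < x \<Longrightarrow> x \<le> r j \<Longrightarrow> f x = B"
  shows "(LINT z:{a..b}|lborel. f z) = A * (min b (c j) - min a (c j)) + B * (max b (c j) - max a (c j))"
    and "set_integrable lborel {a..b} f"
proof -
  let ?g = "\<lambda>z. A * indicator {min a (c j)..min b (c j)} z + B * indicator {max a (c j)..max b (c j)} z"
  have ae: "AE z in lborel. indicator {a..b} z *\<^sub>R f z = ?g z"
    using AE_lborel_singleton[of a] AE_lborel_singleton[of b] AE_lborel_singleton[of "c j"]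
    by eventually_elim (use ab f in \<open>auto simp: indicator_def min_def max_def\<close>)
  have gi: "integrable lborel ?g" by (simp add: emeasure_lborel_Icc_eq)
  have "indicator {a..b} z *\<^sub>R f z = (if z \<in> {a..b} then if z = l j then f (l j) else if z \<le> c j then A else B else 0)" for z
    using ab f[of z] by (cases "z = l j") (auto simp: indicator_def)
  then have "(\<lambda>z. indicator {a..b} z *\<^sub>R f z) \<in> borel_measurable borel"
    by (simp only:) measurable
  then have fm: "(\<lambda>z. indicator {a..b} z *\<^sub>R f z) \<in> borel_measurable lborel"
    by simp
  show "set_integrable lborel {a..b} f"
    unfolding set_integrable_def using gi by (subst integrable_cong_AE[OF fm _ ae]) auto
  have "(LINT z:{a..b}|lborel. f z) = (LINT z|lborel. ?g z)"
    unfolding set_lebesgue_integral_def by (rule integral_cong_AE[OF fm _ ae]) auto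
  also have "\<dots> = A * (min b (c j) - min a (c j)) + B * (max b (c j) - max a (c j))"
    using ab by (simp add: emeasure_lborel_Icc_eq min_def max_def)
  finally show "(LINT z:{a..b}|lborel. f z) = A * (min b (c j) - min a (c j)) + B * (max b (c j) - max a (c j))" .
qed

lemma vd_left: "l j < x \<Longrightarrow> x \<le> c j \<Longrightarrow> vd x = m j - s j * q j"
  and vd_right: "c j < x \<Longrightarrow> x \<le> r j \<Longrightarrow> vd x = m j + s j * q j"
  using cell_eq[of j x] dx by (auto simp: vd_def Let_def grid_simps)

lemma E_vd: "(LINT z|lborel. indicator (I j) z * (vd z)\<^sup>2) = E j"
proof -
  have "(LINT z|lborel. indicator (I j) z * (vd z)\<^sup>2) = (LINT z:{l j..r j}|lborel. (vd z)\<^sup>2)"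
    by (rule integral_Ioc_Icc) simp
  also have "\<dots> = (m j - s j * q j)\<^sup>2 * dx + (m j + s j * q j)\<^sup>2 * dx"
    by (subst step_integral[where j=j and A="(m j - s j * q j)\<^sup>2" and B="(m j + s j * q j)\<^sup>2"])
      (use dx in \<open>auto simp: vd_left vd_right grid_simps min_def max_def\<close>)
  also have "\<dots> = 2 * dx * ((m j)\<^sup>2 + (q j)\<^sup>2)"
    by (simp add: power2_eq_square algebra_simps)
  finally show ?thesis by (simp add: q_sq)
qed

lemma cell_set: "{x. cell dx x = j} = I j"
  by (auto simp: cell_iff)

lemma cell_set': "{x. cell dx x \<in> {..<k}} = {..l k}"
  by (auto simp: cell_less_iff)

lemma vd_cell_bounded: "set_integrable lborel {l j..r j} (\<lambda>z. (vd z)\<^sup>2)"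
  by (rule step_integral(2)[where j=j and A="(m j - s j * q j)\<^sup>2" and B="(m j + s j * q j)\<^sup>2"])
    (use dx in \<open>auto simp: vd_left vd_right grid_simps\<close>)

lemma cell_energy:
  "(\<integral>\<^sup>+x. ennreal ((vd x)\<^sup>2) * indicator (I j) x \<partial>lborel) = ennreal (E j)"
  "(\<integral>\<^sup>+x. ennreal ((v x)\<^sup>2) * indicator (I j) x \<partial>lborel) = ennreal (E j)"
proof -
  have "integrable lborel (\<lambda>z. indicator (I j) z * (vd z)\<^sup>2)"
    by (rule Bochner_Integration.integrable_bound[OF vd_cell_bounded[of j, unfolded set_integrable_def]])
      (auto simp: indicator_def)
  then have "(\<integral>\<^sup>+x. ennreal (indicator (I j) x * (vd x)\<^sup>2) \<partial>lborel) = ennreal (E j)"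
    by (subst nn_integral_eq_integral) (auto simp: E_vd)
  moreover have "(\<integral>\<^sup>+x. ennreal (indicator (I j) x * (v x)\<^sup>2) \<partial>lborel) = ennreal (E j)"
    using set_v2_integrable[of "I j"] by (subst nn_integral_eq_integral) (auto simp: E_def)
  moreover have "ennreal (indicator (I j) x * a) = ennreal a * indicator (I j) x" for a x
    by (simp split: split_indicator)
  ultimately show "(\<integral>\<^sup>+x. ennreal ((vd x)\<^sup>2) * indicator (I j) x \<partial>lborel) = ennreal (E j)"
    "(\<integral>\<^sup>+x. ennreal ((v x)\<^sup>2) * indicator (I j) x \<partial>lborel) = ennreal (E j)"
    by simp_all
qed

lemma energy_cells:
  "(\<integral>\<^sup>+x. ennreal ((vd x)\<^sup>2) * indicator {x. cell dx x \<in> J} x \<partial>lborel)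
    = (\<integral>\<^sup>+x. ennreal ((v x)\<^sup>2) * indicator {x. cell dx x \<in> J} x \<partial>lborel)"
  by (subst (1 2) countable_cells_nn_integral) (simp_all add: cell_set cell_energy)

lemma energy_atMost:
  "(\<integral>\<^sup>+x. ennreal ((vd x)\<^sup>2) * indicator {..l k} x \<partial>lborel) = (\<integral>\<^sup>+x. ennreal ((v x)\<^sup>2) * indicator {..l k} x \<partial>lborel)"
  using energy_cells[of "{..<k}"] by (simp only: cell_set')

lemma energy_total:
  "(\<integral>\<^sup>+x. ennreal ((vd x)\<^sup>2) \<partial>lborel) = (\<integral>\<^sup>+x. ennreal ((v x)\<^sup>2) \<partial>lborel)"
  using energy_cells[of UNIV] by simp

lemma vd_L2: "square_integrable vd"
  unfolding square_integrable_def
proof (intro conjI vd_measurable integrableI_nonneg)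
  have "(\<integral>\<^sup>+x. ennreal ((v x)\<^sup>2) \<partial>lborel) < \<infinity>"
    using v2_integrable by (simp add: nn_integral_eq_integral)
  then show "(\<integral>\<^sup>+x. ennreal ((vd x)\<^sup>2) \<partial>lborel) < \<infinity>" by (simp add: energy_total)
qed auto

lemma ud_cell:
  assumes "l j \<le> x" "x \<le> r j"
  shows "ud x = u (l j) + (m j - s j * q j) * (min x (c j) - l j) + (m j + s j * q j) * (max x (c j) - c j)"
proof (cases "x = l j")
  case True
  \<comment> \<open>The point \<open>l j\<close> is the right end of cell j - 1, and the right-half
    formula there returns u (l j).\<close>
  have "cell dx (l j) = j - 1" by (subst cell_iff) (use dx in \<open>simp add: grid_def algebra_simps\<close>)
  moreover have "r (j - 1) = l j" "c (j - 1) = l j - dx" by (simp_all add: grid_def algebra_simps)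
  ultimately have "ud (l j) = u (l j)" using dx by (simp add: ud_def proj_u_def Let_def)
  then show ?thesis using True dx by (simp add: grid_simps)
next
  case False
  then have "cell dx x = j" using assms by (intro cell_eq) auto
  moreover have "u (r j) = u (l j) + 2 * dx * m j" using dx by (simp add: m_def D_even_def)
  ultimately show ?thesis using assms dx
    by (simp add: ud_def proj_u_def Let_def m_def[symmetric] q_def[symmetric] grid_simps min_def max_def)
      (simp add: algebra_simps)
qed

text \<open>Induction on the number of cells between a and b, splitting at the right end of the
  first one.\<close>

lemma cells_primitive_of:
  assumes g: "locally_integrable g"
    and fg: "\<And>j a b. l j \<le> a \<Longrightarrow> a \<le> b \<Longrightarrow> b \<le> r j \<Longrightarrow> f b - f a = (LINT z:{a..b}|lborel. g z)"
  shows "primitive_of f g"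
proof -
  have [measurable]: "g \<in> borel_measurable borel" using g by (rule locally_integrable_measurable)
  have split: "(LINT z:{a..b}|lborel. g z) + (LINT z:{b..e}|lborel. g z) = (LINT z:{a..e}|lborel. g z)"
    if "a \<le> b" "b \<le> e" for a b e
  proof -
    have "(LINT z:{a..b} \<union> {b..e}|lborel. g z) = (LINT z:{a..b}|lborel. g z) + (LINT z:{b..e}|lborel. g z)"
    proof (rule set_integral_Un_AE)
      show "AE x in lborel. \<not> (x \<in> {a..b} \<and> x \<in> {b..e})"
        using AE_lborel_singleton[of b] by eventually_elim auto
    qed (auto intro: locally_integrableD[OF g])
    moreover have "{a..b} \<union> {b..e} = {a..e}" using that by auto
    ultimately show ?thesis by simp
  qed
  have main: "f b - f a = (LINT z:{a..b}|lborel. g z)"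
    if "l i \<le> a" "a \<le> r i" "a \<le> b" "b \<le> l (i + int n)" for i n a b
    using that
  proof (induction n arbitrary: i a)
    case 0
    then have "a = b" by simp
    then show ?case using fg[of i a a] 0 dx by (simp add: grid_simps)
  next
    case (Suc n)
    show ?case
    proof (cases "b \<le> r i")
      case False
      have "f b - f (r i) = (LINT z:{r i..b}|lborel. g z)"
      proof (rule Suc.IH)
        show "l (i + 1) \<le> r i" by (simp only: grid_simps(3) order_refl)
        show "r i \<le> r (i + 1)" using dx by (simp add: grid_def)
        show "r i \<le> b" using False by simp
        show "b \<le> l (i + 1 + int n)" using Suc.prems(4) by (simp add: add_ac)
      qed
      moreover have "f (r i) - f a = (LINT z:{a..r i}|lborel. g z)"
        using Suc.prems by (intro fg[of i]) auto
      ultimately show ?thesis using split[of a "r i" b] Suc.prems False by simp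
    qed (use Suc.prems fg in blast)
  qed
  show ?thesis
    unfolding primitive_of_def
  proof (intro conjI g allI impI)
    fix a b :: real assume ab: "a \<le> b"
    define n where "n = nat (cell dx b + 1 - cell dx a)"
    have "cell dx a \<le> cell dx b" using cell_less_iff[of a "cell dx b + 1"] in_cell(2)[of b] ab
      by (simp add: grid_simps)
    then have "b \<le> l (cell dx a + int n)" using in_cell(2)[of b] by (simp add: n_def grid_simps)
    then show "f b - f a = (LINT z:{a..b}|lborel. g z)"
      using in_cell[of a] ab by (intro main[of "cell dx a"]) auto
  qed
qed

lemma ud_primitive: "primitive_of ud vd"
proof (rule cells_primitive_of)
  show "locally_integrable vd" using vd_L2 by (rule square_integrable_imp_locally_integrable)
  fix j a b assume ab: "l j \<le> a" "a \<le> b" "b \<le> r j"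
  have "(LINT z:{a..b}|lborel. vd z) = (m j - s j * q j) * (min b (c j) - min a (c j)) + (m j + s j * q j) * (max b (c j) - max a (c j))"
    by (rule step_integral(1)[OF ab]) (auto simp: vd_left vd_right)
  then show "ud b - ud a = (LINT z:{a..b}|lborel. vd z)"
    using ab ud_cell[of j a] ud_cell[of j b] by (simp add: algebra_simps)
qed

end

section \<open>Uniqueness of measures and of Lebesgue decompositions\<close>

lemma emeasure_eq_distr_fun:
  assumes "sets M = sets borel" "finite_measure M" "a < b"
  shows "emeasure M {a..<b} = ennreal (distr_fun M b - distr_fun M a)"
proof -
  interpret finite_measure M by fact
  have "{a..<b} = {..<b} - {..<a}" using assms by auto
  then have "measure M {a..<b} = measure M {..<b} - measure M {..<a}"
    using assms by (simp only:) (rule finite_measure_Diff, auto)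
  then show ?thesis by (simp add: emeasure_eq_measure distr_fun_def)
qed

lemma measure_of_distr_fun_eq:
  assumes "sets M = sets borel" "finite_measure M" "distr_fun M = F"
  shows "measure_of_distr_fun F = M"
  unfolding measure_of_distr_fun_def
proof (rule the_equality)
  fix M' assume M': "sets M' = sets borel \<and> finite_measure M' \<and> distr_fun M' = F"
  show "M' = M"
    by (rule measure_eqI_Ico) (use assms M' in \<open>auto simp: emeasure_eq_distr_fun\<close>)
qed (use assms in simp)

text \<open>On the union of the two null sets both absolutely continuous parts vanish, and off it
  both singular parts do, so each part is a restriction of \<open>\<mu>\<close>. This gives meaning
  to the descriptions in \<open>ac_part\<close> and \<open>sing_part\<close>.\<close>

lemma lebesgue_decomposition_unique:
  assumes "lebesgue_decomposition \<mu> a s" "lebesgue_decomposition \<mu> a' s'"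
  shows "a = a'" "s = s'"
proof -
  have *: "emeasure a A = emeasure \<mu> (A - (N \<union> N')) \<and> emeasure s A = emeasure \<mu> (A \<inter> (N \<union> N'))"
    if d: "lebesgue_decomposition \<mu> a s" and N: "N \<in> null_sets lborel" "N' \<in> null_sets lborel" "emeasure s (- N) = 0"
      and A: "A \<in> sets borel" for a s N N' A
  proof -
    let ?N = "N \<union> N'"
    have sets: "sets a = sets borel" "sets s = sets borel" and add: "\<And>A. A \<in> sets borel \<Longrightarrow> emeasure \<mu> A = emeasure a A + emeasure s A"
      and ac: "absolutely_continuous lborel a"
      using d by (auto simp: lebesgue_decomposition_def)
    have Nb: "N \<in> sets borel" "N' \<in> sets borel" using N(1,2) by (auto simp: null_sets_def)
    then have Nb': "?N \<in> sets borel" by simp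
    have "A \<inter> ?N \<in> null_sets lborel"
      using N A by (auto intro!: null_set_Int1)
    then have a0: "emeasure a (A \<inter> ?N) = 0"
      using ac by (auto simp: absolutely_continuous_def)
    have "emeasure s (A - ?N) \<le> emeasure s (- N)"
      using Nb Nb' A by (intro emeasure_mono) (auto simp: sets)
    then have s0: "emeasure s (A - ?N) = 0" using N by simp
    have "emeasure a A = emeasure a (A \<inter> ?N) + emeasure a (A - ?N)"
      using A Nb Nb' by (subst plus_emeasure) (auto simp: sets Int_Diff_Un)
    moreover have "emeasure s A = emeasure s (A \<inter> ?N) + emeasure s (A - ?N)"
      using A Nb Nb' by (subst plus_emeasure) (auto simp: sets Int_Diff_Un)
    ultimately show ?thesis using add[of "A - ?N"] add[of "A \<inter> ?N"] A Nb Nb' a0 s0 by simp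
  qed
  obtain N where N: "N \<in> null_sets lborel" "emeasure s (- N) = 0"
    using assms(1) by (auto simp: lebesgue_decomposition_def)
  obtain N' where N': "N' \<in> null_sets lborel" "emeasure s' (- N') = 0"
    using assms(2) by (auto simp: lebesgue_decomposition_def)
  have s: "sets a = sets borel" "sets s = sets borel" "sets a' = sets borel" "sets s' = sets borel"
    using assms by (auto simp: lebesgue_decomposition_def)
  show "a = a'"
    by (rule measure_eqI) (use *[OF assms(1) N(1) N'(1) N(2)] *[OF assms(2) N'(1) N(1) N'(2)] s in \<open>auto simp: Un_commute\<close>)
  show "s = s'"
    by (rule measure_eqI) (use *[OF assms(1) N(1) N'(1) N(2)] *[OF assms(2) N'(1) N(1) N'(2)] s in \<open>auto simp: Un_commute\<close>)
qed

lemma ac_sing_part: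
  assumes "lebesgue_decomposition \<mu> a s"
  shows "ac_part \<mu> = a" "sing_part \<mu> = s"
  unfolding ac_part_def sing_part_def
  using assms lebesgue_decomposition_unique by (blast intro: the_equality)+

lemma distr_fun_density:
  assumes "square_integrable g"
  shows "distr_fun (density lborel (\<lambda>x. ennreal ((g x)\<^sup>2))) x = (LINT z|lborel. indicator {..x} z * (g z)\<^sup>2)"
proof -
  have [measurable]: "g \<in> borel_measurable borel" and i: "integrable lborel (\<lambda>x. (g x)\<^sup>2)"
    using assms by (auto simp: square_integrable_def)
  have "emeasure (density lborel (\<lambda>x. ennreal ((g x)\<^sup>2))) {..<x} = (\<integral>\<^sup>+z. ennreal ((g z)\<^sup>2) * indicator {..<x} z \<partial>lborel)"
    by (simp add: emeasure_density)
  also have "\<dots> = (\<integral>\<^sup>+z. ennreal (indicator {..x} z * (g z)\<^sup>2) \<partial>lborel)"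
  proof (rule nn_integral_cong_AE)
    show "AE z in lborel. ennreal ((g z)\<^sup>2) * indicator {..<x} z = ennreal (indicator {..x} z * (g z)\<^sup>2)"
      using AE_lborel_singleton[of x] by eventually_elim (auto simp: indicator_def)
  qed
  also have "\<dots> = ennreal (LINT z|lborel. indicator {..x} z * (g z)\<^sup>2)"
    using integrable_mult_indicator[OF _ i, of "{..x}"] by (intro nn_integral_eq_integral) auto
  finally show ?thesis by (simp add: distr_fun_def measure_def)
qed

section \<open>The projected measure\<close>

context projection
begin

text \<open>The projection moves the singular mass of \<open>[l j, r j)\<close> to \<open>l j\<close>.\<close>

definition \<pi> :: "real \<Rightarrow> real" where "\<pi> x = l \<lfloor>x / (2 * dx)\<rfloor>"

lemma \<pi>_measurable [measurable]: "\<pi> \<in> borel_measurable borel"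
  unfolding \<pi>_def[abs_def] grid_def by measurable

text \<open>\<open>\<pi>\<close> uses cells closed on the left, \<open>cell\<close> cells closed on
  the right. The difference fits left-continuous distribution functions: the mass below x becomes
  the old mass strictly below the right end of the cell of x.\<close>

lemma \<pi>_less_iff: "\<pi> z < x \<longleftrightarrow> z < r (cell dx x)"
proof -
  define i where "i = \<lfloor>z / (2 * dx)\<rfloor>"
  have "cell dx x < i \<longleftrightarrow> x \<le> l i" by (rule cell_less_iff)
  then have "\<pi> z < x \<longleftrightarrow> i \<le> cell dx x" by (auto simp: \<pi>_def i_def)
  also have "\<dots> \<longleftrightarrow> i < cell dx x + 1" by simp
  also have "\<dots> \<longleftrightarrow> z / (2 * dx) < of_int (cell dx x + 1)" unfolding i_def by (rule floor_less_iff)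
  also have "\<dots> \<longleftrightarrow> z < r (cell dx x)" using dx by (simp add: grid_def field_simps)
  finally show ?thesis .
qed

definition \<sigma>d :: "real measure" where "\<sigma>d = distr \<sigma> borel \<pi>"

definition \<mu>d :: "real measure" where
  "\<mu>d = measure_add (density lborel (\<lambda>x. ennreal ((vd x)\<^sup>2))) \<sigma>d"

lemma \<sigma>d_emeasure: "A \<in> sets borel \<Longrightarrow> emeasure \<sigma>d A = emeasure \<sigma> (\<pi> -` A)"
  using sets_\<sigma> by (simp add: \<sigma>d_def emeasure_distr sets_eq_imp_space_eq cong: measurable_cong_sets)

lemma \<mu>d_split: "A \<in> sets borel \<Longrightarrow>
  emeasure \<mu>d A = (\<integral>\<^sup>+x. ennreal ((vd x)\<^sup>2) * indicator A x \<partial>lborel) + emeasure \<sigma>d A"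
  by (simp add: \<mu>d_def emeasure_measure_add \<sigma>d_def emeasure_density)

lemma sets_\<mu>d: "sets \<mu>d = sets borel"
  by (simp add: \<mu>d_def sets_measure_add \<sigma>d_def)

lemma \<mu>d_total: "emeasure \<mu>d UNIV = emeasure \<mu> UNIV"
  by (simp add: \<mu>d_split \<mu>_split \<sigma>d_emeasure energy_total)

lemma \<mu>d_finite: "finite_measure \<mu>d"
proof
  show "emeasure \<mu>d (space \<mu>d) \<noteq> \<infinity>"
    using \<mu>d_total sets_\<mu>d fin_\<mu> by (simp add: sets_eq_imp_space_eq finite_measure.emeasure_eq_measure)
qed

definition Nd :: "real set" where "Nd = range l"

text \<open>Makes all results on the explicit solution available for the projected data with the
  prefix \<open>d\<close>. The new singular mass sits on the countable set of even grid
  points.\<close>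

sublocale d: eulerian_pair ud vd \<mu>d \<sigma>d Nd
proof (rule eulerian_pair.intro)
  show "primitive_of ud vd" by (rule ud_primitive)
  show "\<exists>\<psi> \<psi>'. cutoff_pair \<psi> \<psi>'" by (rule cutoff)
  show "square_integrable vd" by (rule vd_L2)
  show "sets \<sigma>d = sets borel" by (simp add: \<sigma>d_def)
  show "sets \<mu>d = sets borel" by (rule sets_\<mu>d)
  show "finite_measure \<mu>d" by (rule \<mu>d_finite)
  have c: "countable Nd" by (simp add: Nd_def)
  then show "Nd \<in> null_sets lborel" by (rule countable_imp_null_set_lborel)
  have "\<pi> -` (- Nd) = {}" by (auto simp: Nd_def \<pi>_def)
  moreover have "- Nd \<in> sets borel"
    using countable_imp_null_set_lborel[OF c] by (auto simp: null_sets_def)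
  ultimately show "emeasure \<sigma>d (- Nd) = 0" by (simp add: \<sigma>d_emeasure)
qed (rule \<mu>d_split)

lemma Ftot_d: "d.Ftot = Ftot"
  using \<mu>d_total by (simp add: d.Ftot_def Ftot_def measure_def)

lemma Fac_eq: "distr_fun (density lborel (\<lambda>x. ennreal ((v x)\<^sup>2))) = Fac"
  using distr_fun_density[OF v_L2] by (auto simp: Fac_def)

lemma vd_energy_atMost: "(LINT z|lborel. indicator {..l k} z * (vd z)\<^sup>2) = Fac (l k)"
proof -
  have e: "ennreal (LINT z|lborel. indicator {..l k} z * (g z)\<^sup>2) = (\<integral>\<^sup>+z. ennreal ((g z)\<^sup>2) * indicator {..l k} z \<partial>lborel)"
    if "integrable lborel (\<lambda>z. indicator {..l k} z * (g z)\<^sup>2)" for g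
    using that by (subst nn_integral_eq_integral[symmetric]) (auto intro!: nn_integral_cong split: split_indicator)
  have "ennreal (LINT z|lborel. indicator {..l k} z * (vd z)\<^sup>2) = ennreal (Fac (l k))"
    using e[of v] e[of vd] set_v2_integrable d.set_v2_integrable energy_atMost[of k] by (simp add: Fac_def)
  then show ?thesis by (simp add: Fac_def)
qed

lemma proj_Fac_eq: "(LINT z|lborel. indicator {..x} z * (vd z)\<^sup>2) = proj_Fac s dx u Fac x"
proof -
  define j where "j = cell dx x"
  have x: "l j < x" "x \<le> r j" using in_cell[of x] by (auto simp: j_def)
  have "(LINT z|lborel. indicator {..x} z * (vd z)\<^sup>2) - Fac (l j) = (LINT z:{l j..x}|lborel. (vd z)\<^sup>2)"
    using primitive_ofD[OF primitive_of_atMost[OF d.v2_integrable], of "l j" x] x by (simp add: vd_energy_atMost)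
  also have "\<dots> = (m j - s j * q j)\<^sup>2 * (min x (c j) - min (l j) (c j)) + (m j + s j * q j)\<^sup>2 * (max x (c j) - max (l j) (c j))"
    by (rule step_integral(1)[where j=j]) (use x in \<open>auto simp: vd_left vd_right\<close>)
  finally have 1: "(LINT z|lborel. indicator {..x} z * (vd z)\<^sup>2) = Fac (l j) + \<dots>" by simp
  have "Fac (r j) = Fac (l j) + 2 * dx * ((m j)\<^sup>2 + (q j)\<^sup>2)"
    using q_sq(1)[of j] E_eq[of j] by simp
  \<comment> \<open>The starting value prescribed on the right half is the value of the left-half
    formula at the midpoint, so the two pieces join continuously.\<close>
  then have 2: "(Fac (r j) + Fac (l j)) / 2 - s j * (2 * q j * m j * dx) = Fac (l j) + (m j - s j * q j)\<^sup>2 * dx"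
    by (simp add: power2_diff power_mult_distrib algebra_simps)
  show ?thesis
    unfolding 1 proj_Fac_def Let_def j_def[symmetric] m_def[symmetric] q_def[symmetric] 2
    using dx by (simp add: grid_simps)
qed

lemma distr_fun_\<sigma>d: "distr_fun \<sigma>d x = proj_Fsing dx (distr_fun \<sigma>) x"
proof -
  have "\<pi> -` {..<x} = {..<r (cell dx x)}" by (auto simp: \<pi>_less_iff)
  then show ?thesis by (simp add: distr_fun_def proj_Fsing_def measure_def \<sigma>d_emeasure)
qed

lemma distr_fun_\<mu>d: "distr_fun \<mu>d x = proj_Fac s dx u Fac x + proj_Fsing dx (distr_fun \<sigma>) x"
proof -
  have fin: "emeasure (density lborel (\<lambda>x. ennreal ((vd x)\<^sup>2))) {..<x} \<noteq> \<infinity>" "emeasure \<sigma>d {..<x} \<noteq> \<infinity>"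
    using \<mu>d_finite \<mu>d_split[of "{..<x}"] finite_measure.emeasure_finite[OF \<mu>d_finite, of "{..<x}"]
    by (auto simp: emeasure_density top_unique)
  have "emeasure \<mu>d {..<x} = emeasure (density lborel (\<lambda>x. ennreal ((vd x)\<^sup>2))) {..<x} + emeasure \<sigma>d {..<x}"
    by (simp add: \<mu>d_split emeasure_density)
  then have "distr_fun \<mu>d x = distr_fun (density lborel (\<lambda>x. ennreal ((vd x)\<^sup>2))) x + distr_fun \<sigma>d x"
    using fin by (simp add: distr_fun_def measure_def enn2real_plus less_top)
  then show ?thesis by (simp add: distr_fun_density[OF vd_L2] proj_Fac_eq distr_fun_\<sigma>d)
qed

lemma P_op_eq:
  assumes "ac_part \<mu> = density lborel (\<lambda>x. ennreal ((v x)\<^sup>2))" "sing_part \<mu> = \<sigma>"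
  shows "P_op s dx (u, \<mu>) = (ud, \<mu>d)"
proof -
  have "measure_of_distr_fun (\<lambda>x. proj_Fac s dx u Fac x + proj_Fsing dx (distr_fun \<sigma>) x) = \<mu>d"
    using sets_\<mu>d \<mu>d_finite distr_fun_\<mu>d by (intro measure_of_distr_fun_eq) auto
  then show ?thesis by (simp add: P_op_def Let_def assms Fac_eq ud_def)
qed

text \<open>The slope is changed without altering the energy of any cell, and \<open>\<pi>\<close>
  moves no singular mass across an even grid point.\<close>

lemma G_grid: "d.G (l j) = G (l j)"
proof -
  have "distr_fun \<mu>d (l j) = distr_fun \<mu> (l j)"
  proof -
    have c: "r (cell dx (l j)) = l j"
    proof -
      have "cell dx (l j) = j - 1" by (subst cell_iff) (use dx in \<open>simp add: grid_def algebra_simps\<close>)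
      then show ?thesis by (simp add: grid_def)
    qed
    have "\<pi> -` {..<l j} = {..<l j}" by (auto simp: \<pi>_less_iff c)
    moreover have "(\<integral>\<^sup>+x. ennreal ((f x)\<^sup>2) * indicator {..<l j} x \<partial>lborel) = (\<integral>\<^sup>+x. ennreal ((f x)\<^sup>2) * indicator {..l j} x \<partial>lborel)" for f
      by (rule nn_integral_cong_AE) (use AE_lborel_singleton[of "l j"] in \<open>eventually_elim, auto simp: indicator_def\<close>)
    ultimately have "emeasure \<mu>d {..<l j} = emeasure \<mu> {..<l j}"
      by (simp add: \<mu>d_split \<mu>_split \<sigma>d_emeasure energy_atMost)
    then show ?thesis by (simp add: distr_fun_def measure_def)
  qed
  then show ?thesis by (simp add: d.G_def G_def distr_fun_def)
qed

text \<open>By \<open>y_less_iff\<close> the position of a characteristic relative to a grid point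
  depends only on the value of \<open>G\<close> there, which is the same for both data.\<close>

lemma y_same_cell: "\<exists>j. y0 \<xi> \<in> {l j..r j} \<and> d.y0 \<xi> \<in> {l j..r j}"
proof -
  define j where "j = cell dx (y0 \<xi>)"
  \<comment> \<open>If \<open>y0 \<xi>\<close> is exactly the right end of its cell, the next cell
    has to be taken, since the comparison works with intervals closed on the left.\<close>
  define i where "i = (if y0 \<xi> < l (j + 1) then j else j + 1)"
  have y: "l i \<le> y0 \<xi>" "y0 \<xi> < l (i + 1)"
    using in_cell[of "y0 \<xi>"] dx by (auto simp: i_def j_def grid_def algebra_simps)
  have "d.y0 \<xi> < l (i + 1)" using y(2) by (simp only: y_less_iff d.y_less_iff G_grid)
  moreover have "\<not> d.y0 \<xi> < l i" using y(1) unfolding d.y_less_iff G_grid y_less_iff[symmetric] by simp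
  ultimately show ?thesis using y by (intro exI[of _ i]) (auto simp: grid_simps)
qed

end

section \<open>Error estimates\<close>

context projection
begin

section \<open>Distance between the two slopes\<close>

lemma cell_moments:
  "integrable lborel (indicator (I j) :: real \<Rightarrow> real)" "(LINT z|lborel. indicator (I j) z) = 2 * dx"
  "integrable lborel (\<lambda>z. indicator (I j) z * v z)"
  "integrable lborel (\<lambda>z. indicator (I j) z * (v z)\<^sup>2)"
proof -
  show "integrable lborel (indicator (I j) :: real \<Rightarrow> real)" using dx by (simp add: grid_simps)
  show "(LINT z|lborel. indicator (I j) z) = 2 * dx" using dx by (simp add: grid_simps)
  show "integrable lborel (\<lambda>z. indicator (I j) z * (v z)\<^sup>2)" by (rule set_v2_integrable) simp
  have "set_integrable lborel {l j..r j} v" using u_v by (simp add: primitive_of_def locally_integrable_def)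
  then show "integrable lborel (\<lambda>z. indicator (I j) z * v z)"
    unfolding set_integrable_def by (rule Bochner_Integration.integrable_bound) (auto simp: indicator_def)
qed

lemma cell_quadratic_integral:
  "integrable lborel (\<lambda>z. indicator (I j) z * (a + b * v z + e * (v z)\<^sup>2))"
  "(LINT z|lborel. indicator (I j) z * (a + b * v z + e * (v z)\<^sup>2)) = a * (2 * dx) + b * (2 * dx * m j) + e * E j"
proof -
  let ?f = "\<lambda>z. a * indicator (I j) z + b * (indicator (I j) z * v z) + e * (indicator (I j) z * (v z)\<^sup>2)"
  have eq: "(\<lambda>z. indicator (I j) z * (a + b * v z + e * (v z)\<^sup>2)) = ?f"
    by (auto simp: algebra_simps)
  have "integrable lborel ?f"
    by (intro Bochner_Integration.integrable_add integrable_mult_right cell_moments)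
  then show "integrable lborel (\<lambda>z. indicator (I j) z * (a + b * v z + e * (v z)\<^sup>2))" by (simp only: eq)
  have "(LINT z|lborel. ?f z) = a * (LINT z|lborel. indicator (I j) z)
      + b * (LINT z|lborel. indicator (I j) z * v z) + e * (LINT z|lborel. indicator (I j) z * (v z)\<^sup>2)"
    using cell_moments(1,3,4)[of j] by (simp del: integral_indicator)
  then show "(LINT z|lborel. indicator (I j) z * (a + b * v z + e * (v z)\<^sup>2)) = a * (2 * dx) + b * (2 * dx * m j) + e * E j"
    by (simp only: eq cell_moments(2) m_integral E_def)
qed

lemma cell_nn_quadratic:
  assumes "\<And>z. g z = a + b * v z + e * (v z)\<^sup>2" "\<And>z. 0 \<le> g z"
  shows "(\<integral>\<^sup>+z. ennreal (g z) * indicator (I j) z \<partial>lborel) = ennreal (a * (2 * dx) + b * (2 * dx * m j) + e * E j)"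
proof -
  have "(\<integral>\<^sup>+z. ennreal (g z) * indicator (I j) z \<partial>lborel) = (\<integral>\<^sup>+z. ennreal (indicator (I j) z * g z) \<partial>lborel)"
    by (rule nn_integral_cong) (simp split: split_indicator)
  also have "\<dots> = ennreal (LINT z|lborel. indicator (I j) z * g z)"
    using cell_quadratic_integral(1)[of j a b e] assms by (intro nn_integral_eq_integral) auto
  finally show ?thesis using cell_quadratic_integral(2)[of j a b e] by (simp add: assms(1))
qed

text \<open>The variance identity: the double integral of (v x - v z)^2 is twice the squared length
  of the cell times the variance, 2 (2 dx)^2 q^2.\<close>

lemma cell_two_point:
  "(\<integral>\<^sup>+x. (\<integral>\<^sup>+z. ennreal ((v x - v z)\<^sup>2) * indicator (I j) z \<partial>lborel) * indicator (I j) x \<partial>lborel)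
    = ennreal (8 * dx\<^sup>2 * (q j)\<^sup>2)"
proof -
  have "(\<integral>\<^sup>+z. ennreal ((v x - v z)\<^sup>2) * indicator (I j) z \<partial>lborel)
      = ennreal ((v x)\<^sup>2 * (2 * dx) + (- 2 * v x) * (2 * dx * m j) + 1 * E j)" for x
    by (rule cell_nn_quadratic) (simp add: power2_eq_square algebra_simps, simp)
  moreover have "(\<integral>\<^sup>+x. ennreal ((v x)\<^sup>2 * (2 * dx) + (- 2 * v x) * (2 * dx * m j) + 1 * E j) * indicator (I j) x \<partial>lborel)
      = ennreal (E j * (2 * dx) + (- 2 * (2 * dx * m j)) * (2 * dx * m j) + 2 * dx * E j)"
  proof (rule cell_nn_quadratic)
    show "0 \<le> (v x)\<^sup>2 * (2 * dx) + (- 2 * v x) * (2 * dx * m j) + 1 * E j" for x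
    proof -
      have "(v x)\<^sup>2 * (2 * dx) + (- 2 * v x) * (2 * dx * m j) + 1 * E j = 2 * dx * ((v x - m j)\<^sup>2 + (q j)\<^sup>2)"
        unfolding q_sq(1)[symmetric] by (simp add: power2_eq_square algebra_simps)
      then show ?thesis using dx by simp
    qed
  qed (simp add: algebra_simps)
  moreover have "E j * (2 * dx) + (- 2 * (2 * dx * m j)) * (2 * dx * m j) + 2 * dx * E j = 8 * dx\<^sup>2 * (q j)\<^sup>2"
    unfolding q_sq(1)[symmetric] by (simp add: power2_eq_square algebra_simps)
  ultimately show ?thesis by simp
qed

text \<open>Both v and vd are compared with the mean; vd differs from it by exactly q in absolute
  value for either sign choice. Each squared deviation integrates to 2 dx q^2 and is counted
  twice.\<close>

lemma cell_L2_error: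
  "(\<integral>\<^sup>+x. ennreal ((v x - vd x)\<^sup>2) * indicator (I j) x \<partial>lborel) \<le> ennreal (8 * dx * (q j)\<^sup>2)"
proof -
  have "(\<integral>\<^sup>+x. ennreal ((v x - vd x)\<^sup>2) * indicator (I j) x \<partial>lborel)
      \<le> (\<integral>\<^sup>+x. ennreal (2 * (v x - m j)\<^sup>2 + 2 * (q j)\<^sup>2) * indicator (I j) x \<partial>lborel)"
  proof (rule nn_integral_mono)
    fix x
    have "(v x - vd x)\<^sup>2 \<le> 2 * (v x - m j)\<^sup>2 + 2 * (q j)\<^sup>2" if "x \<in> I j"
    proof -
      have "(vd x - m j)\<^sup>2 = (q j)\<^sup>2"
        using that vd_left[of j x] vd_right[of j x] by (cases "x \<le> c j") (auto simp: power_mult_distrib)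
      moreover have "0 \<le> ((v x - m j) + (vd x - m j))\<^sup>2" by simp
      ultimately show ?thesis by (simp add: power2_eq_square algebra_simps)
    qed
    then show "ennreal ((v x - vd x)\<^sup>2) * indicator (I j) x
        \<le> ennreal (2 * (v x - m j)\<^sup>2 + 2 * (q j)\<^sup>2) * indicator (I j) x"
      by (cases "x \<in> I j") (simp_all add: ennreal_leI del: ennreal_plus)
  qed
  also have "\<dots> = ennreal ((2 * (m j)\<^sup>2 + 2 * (q j)\<^sup>2) * (2 * dx) + (- 4 * m j) * (2 * dx * m j) + 2 * E j)"
    by (rule cell_nn_quadratic) (simp add: power2_eq_square algebra_simps, simp)
  also have "(2 * (m j)\<^sup>2 + 2 * (q j)\<^sup>2) * (2 * dx) + (- 4 * m j) * (2 * dx * m j) + 2 * E j = 8 * dx * (q j)\<^sup>2"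
    unfolding q_sq(1)[symmetric] by (simp add: power2_eq_square algebra_simps)
  finally show ?thesis .
qed

text \<open>Up to a factor dx, the squared error on a cell is bounded by the two-point integral over
  that cell. Points of one cell are at most 2 dx apart, so the sum over cells is at most
  \<open>two_point_bound\<close> with h = 2 dx.\<close>

lemma L2_error_nn:
  "(\<integral>\<^sup>+x. ennreal ((v x - vd x)\<^sup>2) \<partial>lborel) \<le> ennreal (4 * (C\<^sup>2 * (2 * dx) powr (2 * \<beta>)))"
proof -
  have lm [measurable]: "(\<lambda>x. l (cell dx x)) \<in> borel_measurable borel" "(\<lambda>x. r (cell dx x)) \<in> borel_measurable borel"
    by (rule measurable_compose[OF cell_measurable], simp)+
  let ?o = "\<lambda>x. (\<integral>\<^sup>+z. ennreal ((v x - v z)\<^sup>2) * (if l (cell dx x) < z \<and> z \<le> r (cell dx x) then 1 else 0) \<partial>lborel)"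
  have cells: "(\<integral>\<^sup>+x. f x \<partial>lborel) = (\<integral>\<^sup>+j. (\<integral>\<^sup>+x. f x * indicator (I j) x \<partial>lborel) \<partial>count_space UNIV)"
    if "f \<in> borel_measurable borel" for f
    using countable_cells_nn_integral[OF cell_measurable that, of UNIV] by (simp add: cell_set)
  have "ennreal dx * (\<integral>\<^sup>+x. ennreal ((v x - vd x)\<^sup>2) \<partial>lborel)
      = (\<integral>\<^sup>+x. ennreal dx * ennreal ((v x - vd x)\<^sup>2) \<partial>lborel)"
    by (rule nn_integral_cmult[symmetric]) simp
  also have "\<dots> = (\<integral>\<^sup>+j. (\<integral>\<^sup>+x. ennreal dx * ennreal ((v x - vd x)\<^sup>2) * indicator (I j) x \<partial>lborel) \<partial>count_space UNIV)"
    by (rule cells) simp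
  also have "\<dots> \<le> (\<integral>\<^sup>+j. (\<integral>\<^sup>+x. ?o x * indicator (I j) x \<partial>lborel) \<partial>count_space UNIV)"
  proof (rule nn_integral_mono)
    fix j
    have "(\<integral>\<^sup>+x. ennreal dx * ennreal ((v x - vd x)\<^sup>2) * indicator (I j) x \<partial>lborel)
        = ennreal dx * (\<integral>\<^sup>+x. ennreal ((v x - vd x)\<^sup>2) * indicator (I j) x \<partial>lborel)"
      by (simp add: mult.assoc nn_integral_cmult)
    also have "\<dots> \<le> ennreal dx * ennreal (8 * dx * (q j)\<^sup>2)"
      by (intro mult_left_mono cell_L2_error) simp
    also have "\<dots> = ennreal (8 * dx\<^sup>2 * (q j)\<^sup>2)"
      using dx by (simp add: ennreal_mult[symmetric] power2_eq_square mult_ac)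
    also have "\<dots> = (\<integral>\<^sup>+x. (\<integral>\<^sup>+z. ennreal ((v x - v z)\<^sup>2) * indicator (I j) z \<partial>lborel) * indicator (I j) x \<partial>lborel)"
      by (rule cell_two_point[symmetric])
    also have "\<dots> = (\<integral>\<^sup>+x. ?o x * indicator (I j) x \<partial>lborel)"
    proof (rule nn_integral_cong)
      fix x
      have "(\<integral>\<^sup>+z. ennreal ((v x - v z)\<^sup>2) * indicator (I j) z \<partial>lborel) = ?o x" if "x \<in> I j"
      proof -
        have "cell dx x = j" using that by (simp add: cell_iff)
        then show ?thesis by (intro nn_integral_cong) (auto simp: indicator_def)
      qed
      then show "(\<integral>\<^sup>+z. ennreal ((v x - v z)\<^sup>2) * indicator (I j) z \<partial>lborel) * indicator (I j) x
          = ?o x * indicator (I j) x"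
        by (cases "x \<in> I j") auto
    qed
    finally show "(\<integral>\<^sup>+x. ennreal dx * ennreal ((v x - vd x)\<^sup>2) * indicator (I j) x \<partial>lborel)
        \<le> (\<integral>\<^sup>+x. ?o x * indicator (I j) x \<partial>lborel)" .
  qed
  also have "\<dots> = (\<integral>\<^sup>+x. ?o x \<partial>lborel)"
    by (rule cells[symmetric]) measurable
  also have "\<dots> \<le> (\<integral>\<^sup>+x. (\<integral>\<^sup>+z. ennreal ((v x - v z)\<^sup>2) * indicator {x - 2 * dx..x + 2 * dx} z \<partial>lborel) \<partial>lborel)"
  proof (intro nn_integral_mono mult_left_mono)
    fix x z
    show "(if l (cell dx x) < z \<and> z \<le> r (cell dx x) then 1 else 0) \<le> (indicator {x - 2 * dx..x + 2 * dx} z :: ennreal)"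
      using in_cell[of x] dx by (auto simp: grid_simps indicator_def)
  qed simp
  also have "\<dots> \<le> ennreal (2 * (2 * dx) * (C\<^sup>2 * (2 * dx) powr (2 * \<beta>)))"
    by (rule two_point_bound) (use dx in auto)
  also have "\<dots> = ennreal dx * ennreal (4 * (C\<^sup>2 * (2 * dx) powr (2 * \<beta>)))"
    using dx by (subst ennreal_mult[symmetric]) (auto simp: mult_ac)
  finally show ?thesis
    using dx by (subst (asm) ennreal_mult_le_mult_iff) auto
qed

lemma L2_error:
  "integrable lborel (\<lambda>x. (v x - vd x)\<^sup>2)" "(LINT x|lborel. (v x - vd x)\<^sup>2) \<le> 16 * C\<^sup>2 * (dx powr \<beta>)\<^sup>2"
proof -
  \<comment> \<open>The factor 2 powr (2 * \<beta>) is at most 4 because \<beta> \<le> 1.\<close>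
  have le: "4 * (C\<^sup>2 * (2 * dx) powr (2 * \<beta>)) \<le> 16 * C\<^sup>2 * (dx powr \<beta>)\<^sup>2"
  proof -
    have "(2 * dx) powr (2 * \<beta>) = 2 powr (2 * \<beta>) * (dx powr \<beta>)\<^sup>2"
      using dx by (simp add: powr_mult power2_eq_square powr_add[symmetric])
    also have "\<dots> \<le> 2 powr 2 * (dx powr \<beta>)\<^sup>2"
      using \<beta>_le by (intro mult_right_mono powr_mono) auto
    finally have "(2 * dx) powr (2 * \<beta>) \<le> 4 * (dx powr \<beta>)\<^sup>2" by simp
    from mult_left_mono[OF this, of "4 * C\<^sup>2"] show ?thesis by (simp add: mult_ac)
  qed
  show i: "integrable lborel (\<lambda>x. (v x - vd x)\<^sup>2)"
    using L2_error_nn by (intro integrableI_nonneg) (auto intro: le_less_trans)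
  have "ennreal (LINT x|lborel. (v x - vd x)\<^sup>2) \<le> ennreal (4 * (C\<^sup>2 * (2 * dx) powr (2 * \<beta>)))"
    using L2_error_nn i by (simp add: nn_integral_eq_integral)
  then have "(LINT x|lborel. (v x - vd x)\<^sup>2) \<le> 4 * (C\<^sup>2 * (2 * dx) powr (2 * \<beta>))"
    by (subst (asm) ennreal_le_iff) auto
  with le show "(LINT x|lborel. (v x - vd x)\<^sup>2) \<le> 16 * C\<^sup>2 * (dx powr \<beta>)\<^sup>2" by linarith
qed

lemma K1_error:
  assumes t: "0 \<le> t" and S [measurable]: "S \<in> sets borel"
  shows "\<bar>K1 S t - d.K1 S t\<bar> \<le> t * (8 * C\<^sup>2 + 2 * Ftot) * dx powr \<beta>"
proof -
  \<comment> \<open>Weight for Young's inequality, of the order of the L2 distance of the slopes: it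
    balances |v - vd|^2 / lam against lam * (|v| + |vd|)^2, so both terms become of order
    lam.\<close>
  define lam where "lam = dx powr \<beta>"
  have lam: "0 < lam" using dx by (simp add: lam_def)
  let ?b = "\<lambda>z. t / 2 * ((v z - vd z)\<^sup>2 / lam + lam * (2 * (v z)\<^sup>2 + 2 * (vd z)\<^sup>2))"
  have "K1 S t - d.K1 S t = (LINT z|lborel. indicator S z * k1 t (v z) - indicator S z * k1 t (vd z))"
    unfolding K1_def d.K1_def using K1_integrable[OF S] d.K1_integrable[OF S] by simp
  then have "\<bar>K1 S t - d.K1 S t\<bar> = \<bar>LINT z|lborel. indicator S z * k1 t (v z) - indicator S z * k1 t (vd z)\<bar>"
    by (rule arg_cong)
  also have "\<dots> \<le> (LINT z|lborel. ?b z)"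
  proof (rule integral_abs_bound_integral)
    show "integrable lborel (\<lambda>z. indicator S z * k1 t (v z) - indicator S z * k1 t (vd z))"
      by (intro Bochner_Integration.integrable_diff K1_integrable d.K1_integrable S)
    show "integrable lborel ?b"
      by (intro integrable_mult_right Bochner_Integration.integrable_add integrable_divide L2_error(1) v2_integrable d.v2_integrable)
    fix z
    have "\<bar>k1 t (v z) - k1 t (vd z)\<bar> \<le> t * \<bar>v z - vd z\<bar> * (\<bar>v z\<bar> + \<bar>vd z\<bar>)" by (rule k1_diff[OF t])
    also have "\<dots> = t / 2 * (2 * \<bar>v z - vd z\<bar> * (\<bar>v z\<bar> + \<bar>vd z\<bar>))" by simp
    also have "\<dots> \<le> ?b z"
    proof (rule mult_left_mono)
      have sq: "(\<bar>v z\<bar> + \<bar>vd z\<bar>)\<^sup>2 \<le> 2 * (v z)\<^sup>2 + 2 * (vd z)\<^sup>2"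
      proof -
        have "0 \<le> (\<bar>v z\<bar> - \<bar>vd z\<bar>)\<^sup>2" by simp
        then show ?thesis by (simp add: power2_sum power2_diff)
      qed
      have "0 \<le> (\<bar>v z - vd z\<bar> - lam * (\<bar>v z\<bar> + \<bar>vd z\<bar>))\<^sup>2 / lam" using lam by simp
      also have "\<dots> = (v z - vd z)\<^sup>2 / lam - 2 * \<bar>v z - vd z\<bar> * (\<bar>v z\<bar> + \<bar>vd z\<bar>) + lam * (\<bar>v z\<bar> + \<bar>vd z\<bar>)\<^sup>2"
        using lam by (simp add: power2_diff power_mult_distrib add_divide_distrib diff_divide_distrib power2_eq_square[of lam])
      finally show "2 * \<bar>v z - vd z\<bar> * (\<bar>v z\<bar> + \<bar>vd z\<bar>) \<le> (v z - vd z)\<^sup>2 / lam + lam * (2 * (v z)\<^sup>2 + 2 * (vd z)\<^sup>2)"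
        using mult_left_mono[OF sq, of lam] lam by linarith
    qed (use t in simp)
    finally have "\<bar>k1 t (v z) - k1 t (vd z)\<bar> \<le> ?b z" .
    moreover have "0 \<le> ?b z" using t lam by simp
    ultimately show "\<bar>indicator S z * k1 t (v z) - indicator S z * k1 t (vd z)\<bar> \<le> ?b z"
      by (cases "z \<in> S") auto
  qed
  also have "\<dots> = t / 2 * ((LINT z|lborel. (v z - vd z)\<^sup>2) / lam + lam * (2 * (LINT z|lborel. (v z)\<^sup>2) + 2 * (LINT z|lborel. (vd z)\<^sup>2)))"
    using L2_error(1) v2_integrable d.v2_integrable by simp
  also have "\<dots> \<le> t / 2 * (16 * C\<^sup>2 * lam + lam * (2 * Ftot + 2 * Ftot))"
  proof (intro mult_left_mono add_mono)
    show "(LINT z|lborel. (v z - vd z)\<^sup>2) / lam \<le> 16 * C\<^sup>2 * lam"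
      using L2_error(2) lam by (simp add: divide_le_eq lam_def[symmetric] power2_eq_square mult_ac)
  qed (use v2_total d.v2_total t lam in \<open>auto simp: Ftot_d\<close>)
  also have "\<dots> = t * (8 * C\<^sup>2 + 2 * Ftot) * lam" by (simp add: algebra_simps)
  finally show ?thesis by (simp add: lam_def)
qed

section \<open>Errors along characteristics and in Eulerian coordinates\<close>

abbreviation \<rho> :: real where "\<rho> \<equiv> dx powr (\<beta> / 4)"

lemma \<rho>_bounds: "dx powr \<beta> \<le> \<rho>" "dx \<le> \<rho>" "sqrt dx \<le> \<rho>" "0 < \<rho>"
proof -
  have *: "dx powr a \<le> dx powr (\<beta> / 4)" if "\<beta> / 4 \<le> a" for a
    using that dx by (intro powr_mono') auto
  show "dx powr \<beta> \<le> \<rho>" by (rule *) (use \<beta>_pos in simp)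
  show "dx \<le> \<rho>" using *[of 1] \<beta>_le dx by simp
  show "sqrt dx \<le> \<rho>" using *[of "1/2"] \<beta>_le dx by (simp add: powr_half_sqrt)
qed (use dx in simp)

lemma sqrt_2dx: "sqrt (2 * dx) \<le> 2 * sqrt dx"
  using dx by (intro real_le_lsqrt) (auto simp: power_mult_distrib)

lemma E_bound: "E j \<le> (4 * Ftot + 4 * C\<^sup>2) * \<rho>"
proof -
  \<comment> \<open>The square of the averaging length is the cell length, so after division by
    \<delta> the first term of \<open>small_set_energy\<close> is of order \<delta> and the second
    of order dx powr \<beta>.\<close>
  define \<delta> where "\<delta> = sqrt (2 * dx)"
  have \<delta>: "0 < \<delta>" "\<delta> \<le> 2" "\<delta> * \<delta> = 2 * dx"
    using dx by (auto simp: \<delta>_def intro!: real_le_lsqrt)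
  have E0: "0 \<le> E j" unfolding E_def by (rule integral_nonneg_AE) simp
  have "(\<integral>\<^sup>+x. ennreal ((v x)\<^sup>2) \<partial>lborel) \<le> ennreal Ftot"
    using v2_total v2_integrable by (simp add: nn_integral_eq_integral ennreal_leI)
  from small_set_energy[of "I j" "2 * dx" \<delta>, OF _ _ _ \<delta>(1,2) this F_nonneg]
  have "ennreal (\<delta> * E j) \<le> ennreal (2 * (2 * dx) * Ftot + 2 * \<delta> * (C\<^sup>2 * \<delta> powr (2 * \<beta>)))"
    using dx \<delta> E0 by (simp add: grid_simps cell_energy[unfolded grid_simps] ennreal_mult)
  then have "\<delta> * E j \<le> 2 * (2 * dx) * Ftot + 2 * \<delta> * (C\<^sup>2 * \<delta> powr (2 * \<beta>))"
    using dx \<delta> F_nonneg by (subst (asm) ennreal_le_iff) auto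
  also have "\<dots> = \<delta> * (2 * \<delta> * Ftot + 2 * (C\<^sup>2 * \<delta> powr (2 * \<beta>)))"
    unfolding \<delta>(3)[symmetric] by (simp add: algebra_simps)
  finally have 1: "E j \<le> 2 * \<delta> * Ftot + 2 * (C\<^sup>2 * \<delta> powr (2 * \<beta>))"
    using \<delta>(1) by (simp only: mult_le_cancel_left_pos)
  have "\<delta> \<le> 2 * \<rho>" using sqrt_2dx \<rho>_bounds(3) by (simp add: \<delta>_def)
  then have 2: "2 * \<delta> * Ftot \<le> 2 * (2 * \<rho>) * Ftot"
    using F_nonneg by (intro mult_right_mono mult_left_mono) auto
  have "\<delta> powr (2 * \<beta>) = (2 * dx) powr \<beta>"
    using dx by (simp add: \<delta>_def powr_half_sqrt[symmetric] powr_powr)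
  also have "\<dots> = 2 powr \<beta> * dx powr \<beta>" using dx by (simp add: powr_mult)
  also have "\<dots> \<le> 2 powr 1 * \<rho>" using \<beta>_le by (intro mult_mono[OF powr_mono \<rho>_bounds(1)]) auto
  finally have "2 * (C\<^sup>2 * \<delta> powr (2 * \<beta>)) \<le> 2 * (C\<^sup>2 * (2 * \<rho>))"
    by (intro mult_left_mono) auto
  with 1 2 show ?thesis by (simp add: algebra_simps)
qed

text \<open>Both half-lines are cut at the common grid point \<open>l j\<close>. There
  \<open>K1_error\<close> applies; the pieces inside the cell cost at most t * E j each, since |k1 t
  a| \<le> t a^2 and both slopes have energy \<open>E j\<close> in the cell.\<close>

lemma K1_point_error:
  assumes t: "0 \<le> t" and x: "x \<in> {l j..r j}" "x' \<in> {l j..r j}"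
  shows "\<bar>K1 {..x} t - d.K1 {..x'} t\<bar> \<le> t * (16 * C\<^sup>2 + 10 * Ftot) * \<rho>"
proof -
  have near: "\<bar>LINT z|lborel. indicator {l j..a} z * k1 t (f z)\<bar> \<le> t * E j"
    if f: "(LINT z|lborel. indicator (I j) z * (f z)\<^sup>2) = E j"
      "integrable lborel (\<lambda>z. (f z)\<^sup>2)" "f \<in> borel_measurable borel" and a: "a \<le> r j" for f a
  proof -
    note [measurable] = f(3)
    have i: "integrable lborel (\<lambda>z. indicator {l j..r j} z * (f z)\<^sup>2)"
      using integrable_mult_indicator[OF _ f(2), of "{l j..r j}"] by simp
    have bd: "\<bar>indicator {l j..a} z * k1 t (f z)\<bar> \<le> t * (indicator {l j..r j} z * (f z)\<^sup>2)" for z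
      using k1_bound[of t "f z"] t a by (auto simp: indicator_def)
    have "\<bar>LINT z|lborel. indicator {l j..a} z * k1 t (f z)\<bar> \<le> (LINT z|lborel. t * (indicator {l j..r j} z * (f z)\<^sup>2))"
    proof (rule integral_abs_bound_integral)
      show "integrable lborel (\<lambda>z. t * (indicator {l j..r j} z * (f z)\<^sup>2))" using i by simp
      then show "integrable lborel (\<lambda>z. indicator {l j..a} z * k1 t (f z))"
        by (rule Bochner_Integration.integrable_bound)
          (use bd in \<open>auto intro!: AE_I2 order_trans[OF bd abs_ge_self] simp del: abs_mult\<close>)
    qed (rule bd)
    also have "\<dots> = t * E j"
      using f(1) integral_Ioc_Icc[of "\<lambda>z. (f z)\<^sup>2" "l j" "r j"] by (simp add: set_lebesgue_integral_def)
    finally show ?thesis .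
  qed
  have 1: "\<bar>K1 {..x} t - K1 {..l j} t\<bar> \<le> t * E j"
    using near[OF E_def[symmetric] v2_integrable v_measurable, of x] primitive_ofD[OF K1_primitive, of "l j" x t] x
    by (simp add: set_lebesgue_integral_def)
  have 2: "\<bar>d.K1 {..x'} t - d.K1 {..l j} t\<bar> \<le> t * E j"
    using near[OF E_vd d.v2_integrable vd_measurable, of x'] primitive_ofD[OF d.K1_primitive, of "l j" x' t] x
    by (simp add: set_lebesgue_integral_def)
  have 3: "\<bar>K1 {..l j} t - d.K1 {..l j} t\<bar> \<le> t * (8 * C\<^sup>2 + 2 * Ftot) * dx powr \<beta>"
    by (rule K1_error[OF t]) simp
  have 4: "t * (8 * C\<^sup>2 + 2 * Ftot) * dx powr \<beta> \<le> t * (8 * C\<^sup>2 + 2 * Ftot) * \<rho>"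
    using t F_nonneg \<rho>_bounds(1) by (intro mult_left_mono) auto
  have 5: "t * E j \<le> t * ((4 * Ftot + 4 * C\<^sup>2) * \<rho>)"
    using t E_bound by (intro mult_left_mono) auto
  have "t * (8 * C\<^sup>2 + 2 * Ftot) * \<rho> + 2 * (t * ((4 * Ftot + 4 * C\<^sup>2) * \<rho>)) = t * (16 * C\<^sup>2 + 10 * Ftot) * \<rho>"
    by (simp add: algebra_simps)
  with 1 2 3 4 5 show ?thesis by linarith
qed

lemma y_error: "\<bar>y0 \<xi> - d.y0 \<xi>\<bar> \<le> 2 * dx"
  using y_same_cell[of \<xi>] by (auto simp: grid_simps)

lemma ud_grid: "ud (l j) = u (l j)"
  using ud_cell[of j "l j"] dx by (simp add: grid_simps)

text \<open>u and ud agree at the grid point \<open>l j\<close>, and each varies by at most sqrt (2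
  * dx * Ftot) within the cell.\<close>

lemma U_error: "\<bar>U0 \<xi> - d.U0 \<xi>\<bar> \<le> 4 * sqrt Ftot * \<rho>"
proof -
  obtain j where j: "y0 \<xi> \<in> {l j..r j}" "d.y0 \<xi> \<in> {l j..r j}" using y_same_cell[of \<xi>] by blast
  have b: "sqrt (2 * dx * Ftot) \<le> 2 * sqrt Ftot * \<rho>"
  proof -
    have "sqrt (2 * dx * Ftot) = sqrt (2 * dx) * sqrt Ftot" by (rule real_sqrt_mult)
    also have "\<dots> \<le> (2 * \<rho>) * sqrt Ftot" using sqrt_2dx \<rho>_bounds(3) by (intro mult_right_mono) (auto simp: F_nonneg)
    finally show ?thesis by (simp add: mult_ac)
  qed
  have "\<bar>u (y0 \<xi>) - u (l j)\<bar> \<le> sqrt (2 * dx * Ftot)"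
  proof (rule real_le_rsqrt)
    have "(u (y0 \<xi>) - u (l j))\<^sup>2 \<le> \<bar>y0 \<xi> - l j\<bar> * Ftot" by (rule u_Holder')
    also have "\<dots> \<le> 2 * dx * Ftot" using j F_nonneg by (intro mult_right_mono) (auto simp: grid_simps)
    finally show "\<bar>u (y0 \<xi>) - u (l j)\<bar>\<^sup>2 \<le> 2 * dx * Ftot" by simp
  qed
  moreover have "\<bar>ud (d.y0 \<xi>) - ud (l j)\<bar> \<le> sqrt (2 * dx * Ftot)"
  proof (rule real_le_rsqrt)
    have "(ud (d.y0 \<xi>) - ud (l j))\<^sup>2 \<le> \<bar>d.y0 \<xi> - l j\<bar> * Ftot" using d.u_Holder' by (simp only: Ftot_d)
    also have "\<dots> \<le> 2 * dx * Ftot" using j F_nonneg by (intro mult_right_mono) (auto simp: grid_simps)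
    finally show "\<bar>ud (d.y0 \<xi>) - ud (l j)\<bar>\<^sup>2 \<le> 2 * dx * Ftot" by simp
  qed
  ultimately show ?thesis using b unfolding U0_def d.U0_def ud_grid by linarith
qed

text \<open>The first term comes from \<open>U_error\<close> and the 1 from the difference of
  \<open>V0\<close>. Half the bound of \<open>K1_point_error\<close> plus a quarter of that of
  \<open>K1_error\<close> gives 10 C^2 and 11/2 Ftot, rounded up to 6 Ftot.\<close>

definition C1 :: real where "C1 = 4 * sqrt Ftot + 1 + 10 * C\<^sup>2 + 6 * Ftot"

lemma C1_nonneg: "0 \<le> C1" using F_nonneg by (simp add: C1_def)

lemma Us_error:
  assumes \<alpha>: "0 \<le> \<alpha>" "\<alpha> \<le> 1" and t: "0 \<le> t"
  shows "\<bar>Us \<alpha> t \<xi> - d.Us \<alpha> t \<xi>\<bar> \<le> (1 + t) * C1 * \<rho>"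
proof -
  obtain j where j: "y0 \<xi> \<in> {l j..r j}" "d.y0 \<xi> \<in> {l j..r j}" using y_same_cell[of \<xi>] by blast
  define X where "X = K1 {..y0 \<xi>} t - d.K1 {..d.y0 \<xi>} t"
  define Y where "Y = K1 UNIV t - d.K1 UNIV t"
  have X: "\<bar>X\<bar> \<le> t * (16 * C\<^sup>2 + 10 * Ftot) * \<rho>" unfolding X_def by (rule K1_point_error[OF t j])
  have Y: "\<bar>Y\<bar> \<le> t * (8 * C\<^sup>2 + 2 * Ftot) * \<rho>"
  proof -
    have "\<bar>Y\<bar> \<le> t * (8 * C\<^sup>2 + 2 * Ftot) * dx powr \<beta>" unfolding Y_def by (rule K1_error[OF t]) simp
    also have "\<dots> \<le> t * (8 * C\<^sup>2 + 2 * Ftot) * \<rho>"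
      using t F_nonneg \<rho>_bounds(1) by (intro mult_left_mono) auto
    finally show ?thesis .
  qed
  have "\<bar>\<alpha> * (X / 2 - Y / 4)\<bar> \<le> 1 * (\<bar>X\<bar> / 2 + \<bar>Y\<bar> / 4)"
    unfolding abs_mult using \<alpha> by (intro mult_mono) auto
  also have "\<dots> \<le> t * (16 * C\<^sup>2 + 10 * Ftot) * \<rho> / 2 + t * (8 * C\<^sup>2 + 2 * Ftot) * \<rho> / 4"
    unfolding mult_1 by (intro add_mono divide_right_mono X Y) auto
  finally have K: "\<bar>\<alpha> * (X / 2 - Y / 4)\<bar> \<le> \<dots>" .
  have V: "\<bar>t * ((V0 \<xi> - d.V0 \<xi>) / 2)\<bar> \<le> t * \<rho>"
    unfolding abs_mult using y_error[of \<xi>] \<rho>_bounds(2) t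
    by (intro mult_mono) (auto simp: V0_def d.V0_def)
  have eq: "Us \<alpha> t \<xi> - d.Us \<alpha> t \<xi>
      = (U0 \<xi> - d.U0 \<xi>) + t * ((V0 \<xi> - d.V0 \<xi>) / 2) - \<alpha> * (X / 2 - Y / 4)"
    by (simp add: Us_def d.Us_def Ftot_d X_def Y_def algebra_simps diff_divide_distrib)
  have "\<bar>a + b - c\<bar> \<le> \<bar>a\<bar> + \<bar>b\<bar> + \<bar>c\<bar>" for a b c :: real by linarith
  then have "\<bar>Us \<alpha> t \<xi> - d.Us \<alpha> t \<xi>\<bar> \<le> \<bar>U0 \<xi> - d.U0 \<xi>\<bar> + \<bar>t * ((V0 \<xi> - d.V0 \<xi>) / 2)\<bar> + \<bar>\<alpha> * (X / 2 - Y / 4)\<bar>"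
    unfolding eq .
  also have "\<dots> \<le> 4 * sqrt Ftot * \<rho> + t * \<rho>
      + (t * (16 * C\<^sup>2 + 10 * Ftot) * \<rho> / 2 + t * (8 * C\<^sup>2 + 2 * Ftot) * \<rho> / 4)"
    by (rule add_mono[OF add_mono[OF U_error V] K])
  also have "\<dots> = 4 * sqrt Ftot * \<rho> + t * (1 + 10 * C\<^sup>2 + (11 / 2) * Ftot) * \<rho>"
    by (simp add: algebra_simps add_divide_distrib)
  also have "\<dots> \<le> C1 * \<rho> + t * C1 * \<rho>"
    using t F_nonneg \<rho>_bounds(4) by (intro add_mono mult_right_mono mult_left_mono) (auto simp: C1_def)
  also have "\<dots> = (1 + t) * C1 * \<rho>" by (simp add: algebra_simps)
  finally show ?thesis .
qed

text \<open>The time derivative of the difference is the U error, so the mean value inequality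
  suffices and \<open>K2\<close> is never compared. The summand 2 * \<rho> is the initial offset
  inside a cell.\<close>

lemma ys_error:
  assumes \<alpha>: "0 \<le> \<alpha>" "\<alpha> \<le> 1" and t: "0 \<le> t"
  shows "\<bar>ys \<alpha> t \<xi> - d.ys \<alpha> t \<xi>\<bar> \<le> (1 + t) * t * C1 * \<rho> + 2 * \<rho>"
proof -
  let ?D = "\<lambda>s. ys \<alpha> s \<xi> - d.ys \<alpha> s \<xi>"
  have "norm (?D t - ?D 0) \<le> (1 + t) * C1 * \<rho> * norm (t - 0)"
  proof (rule field_differentiable_bound[where S = "{0..t}" and f' = "\<lambda>s. Us \<alpha> s \<xi> - d.Us \<alpha> s \<xi>"])
    fix s assume s: "s \<in> {0..t}"
    show "(?D has_field_derivative Us \<alpha> s \<xi> - d.Us \<alpha> s \<xi>) (at s within {0..t})"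
      by (rule has_field_derivative_at_within) (intro DERIV_diff ys_derivative d.ys_derivative)
    have "\<bar>Us \<alpha> s \<xi> - d.Us \<alpha> s \<xi>\<bar> \<le> (1 + s) * C1 * \<rho>" using s by (intro Us_error \<alpha>) auto
    also have "\<dots> \<le> (1 + t) * C1 * \<rho>" using s C1_nonneg by (intro mult_right_mono) auto
    finally show "norm (Us \<alpha> s \<xi> - d.Us \<alpha> s \<xi>) \<le> (1 + t) * C1 * \<rho>" by simp
  qed (use t in auto)
  moreover have "?D 0 = y0 \<xi> - d.y0 \<xi>"
    by (simp add: ys_def d.ys_def K2_def d.K2_def k2_def)
  ultimately show ?thesis
    using y_error[of \<xi>] \<rho>_bounds(2) t by (simp add: mult_ac)
qed

text \<open>Follow the label that sits at x in the exact solution. At the projected position of this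
  label the difference is the U error; moving from there to x costs the square root of the y error,
  by the Hoelder bound of the projected solution.\<close>

lemma T_op_error:
  assumes \<alpha>: "0 \<le> \<alpha>" "\<alpha> \<le> 1" and t: "0 \<le> t"
  shows "\<bar>uT \<alpha> t x - d.uT \<alpha> t x\<bar>
    \<le> (C1 + sqrt Ftot * (sqrt C1 + sqrt 2)) * (1 + sqrt t + t) * dx powr (\<beta> / 8)"
proof -
  define \<rho>' where "\<rho>' = dx powr (\<beta> / 8)"
  have r: "0 < \<rho>'" "\<rho>' \<le> 1" "\<rho> = \<rho>' * \<rho>'"
    using dx \<beta>_pos by (auto simp: \<rho>'_def powr_add[symmetric] intro!: powr_le1)
  have r': "sqrt \<rho> = \<rho>'" unfolding r(3) using r(1) by simp
  obtain \<xi> where \<xi>: "ys \<alpha> t \<xi> = x" using ys_surj[OF t] by metis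
  have "\<bar>uT \<alpha> t x - d.uT \<alpha> t x\<bar>
      \<le> \<bar>Us \<alpha> t \<xi> - d.Us \<alpha> t \<xi>\<bar> + \<bar>d.uT \<alpha> t (d.ys \<alpha> t \<xi>) - d.uT \<alpha> t x\<bar>"
    using T_op_eq[OF \<alpha> t, of \<xi>] d.T_op_eq[OF \<alpha> t, of \<xi>] \<xi> by simp
  also have "\<dots> \<le> (1 + t) * C1 * \<rho> + sqrt (((1 + t) * t * C1 * \<rho> + 2 * \<rho>) * Ftot)"
  proof (rule add_mono[OF Us_error[OF \<alpha> t]])
    have "\<bar>d.uT \<alpha> t (d.ys \<alpha> t \<xi>) - d.uT \<alpha> t x\<bar> \<le> sqrt (\<bar>d.ys \<alpha> t \<xi> - x\<bar> * Ftot)"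
      using d.T_op_Holder[OF \<alpha> t, of "d.ys \<alpha> t \<xi>" x] by (simp only: Ftot_d)
    also have "\<dots> \<le> sqrt (((1 + t) * t * C1 * \<rho> + 2 * \<rho>) * Ftot)"
      using ys_error[OF \<alpha> t, of \<xi>] F_nonneg by (intro real_sqrt_le_mono mult_right_mono) (auto simp: \<xi> abs_minus_commute)
    finally show "\<bar>d.uT \<alpha> t (d.ys \<alpha> t \<xi>) - d.uT \<alpha> t x\<bar>
        \<le> sqrt (((1 + t) * t * C1 * \<rho> + 2 * \<rho>) * Ftot)" .
  qed
  also have "sqrt (((1 + t) * t * C1 * \<rho> + 2 * \<rho>) * Ftot) = sqrt (t * C1 + t\<^sup>2 * C1 + 2) * \<rho>' * sqrt Ftot"
  proof -
    have "((1 + t) * t * C1 * \<rho> + 2 * \<rho>) * Ftot = (t * C1 + t\<^sup>2 * C1 + 2) * \<rho> * Ftot"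
      by (simp add: power2_eq_square algebra_simps)
    then show ?thesis by (simp only: real_sqrt_mult r')
  qed
  \<comment> \<open>Subadditivity of the square root; the term t * C1 is the origin of sqrt t in the
    final rate.\<close>
  also have "sqrt (t * C1 + t\<^sup>2 * C1 + 2) \<le> (sqrt C1 + sqrt 2) * (1 + sqrt t + t)"
  proof -
    have "sqrt (t * C1 + t\<^sup>2 * C1 + 2) \<le> sqrt (t * C1 + t\<^sup>2 * C1) + sqrt 2"
      using t C1_nonneg by (intro sqrt_add_le_add_sqrt) auto
    also have "sqrt (t * C1 + t\<^sup>2 * C1) \<le> sqrt (t * C1) + sqrt (t\<^sup>2 * C1)"
      using t C1_nonneg by (intro sqrt_add_le_add_sqrt) auto
    also have "sqrt (t * C1) + sqrt (t\<^sup>2 * C1) + sqrt 2 = sqrt C1 * (sqrt t + t) + sqrt 2 * 1"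
      using t by (simp add: real_sqrt_mult algebra_simps)
    also have "\<dots> \<le> sqrt C1 * (1 + sqrt t + t) + sqrt 2 * (1 + sqrt t + t)"
      using t C1_nonneg by (intro add_mono mult_left_mono) auto
    finally show ?thesis by (simp add: algebra_simps)
  qed
  also have "(1 + t) * C1 * \<rho> \<le> (1 + sqrt t + t) * C1 * \<rho>'"
    using t C1_nonneg r by (intro mult_mono) (auto intro: mult_left_le)
  finally show ?thesis
    using r(1) F_nonneg by (simp add: \<rho>'_def[symmetric] algebra_simps mult_right_mono)
qed

end

text \<open>Membership in \<open>B2\<close> bounds both suprema in the seminorm, which would
  otherwise be arbitrary values. The estimate for h then follows by taking t = h in the outer
  supremum.\<close>

lemma B2_shift:
  assumes v: "v \<in> B2 \<beta>" and \<beta>: "0 < \<beta>"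
  shows "0 < h \<Longrightarrow> h \<le> 2 \<Longrightarrow> l2norm (shift_diff h v) \<le> B2_seminorm \<beta> v * h powr \<beta>"
    and "0 \<le> B2_seminorm \<beta> v"
proof -
  obtain K where K: "0 < K" "\<And>h. h \<in> {0<..2} \<Longrightarrow> l2norm (shift_diff h v) \<le> K * h powr \<beta>"
    using v by (auto simp: B2_def)
  let ?i = "\<lambda>t. SUP h\<in>{0..t}. l2norm (shift_diff h v)"
  have inner: "l2norm (shift_diff h v) \<le> K * t powr \<beta>" if "h \<in> {0..t}" "0 < t" "t \<le> 2" for h t
  proof (cases "h = 0")
    case True
    have "l2norm (shift_diff 0 v) = 0" by (simp add: l2norm_def shift_diff_def)
    then show ?thesis using True K by simp
  next
    case False
    then have "l2norm (shift_diff h v) \<le> K * h powr \<beta>" using that by (intro K) auto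
    also have "\<dots> \<le> K * t powr \<beta>" using that K \<beta> by (intro mult_left_mono powr_mono2) auto
    finally show ?thesis .
  qed
  have le_i: "l2norm (shift_diff h v) \<le> ?i t" if "h \<in> {0..t}" "0 < t" "t \<le> 2" for h t
    by (rule cSUP_upper[OF that(1)]) (rule bdd_aboveI2[OF inner[OF _ that(2,3)]])
  have i_le: "t powr (- \<beta>) * ?i t \<le> K" if "t \<in> {0<..2}" for t
  proof -
    have "?i t \<le> K * t powr \<beta>" using that by (intro cSUP_least inner) auto
    then have "t powr (- \<beta>) * ?i t \<le> t powr (- \<beta>) * (K * t powr \<beta>)" by (intro mult_left_mono) auto
    also have "\<dots> = K" using that by (simp add: powr_minus)
    finally show ?thesis .
  qed
  have B: "h powr (- \<beta>) * ?i h \<le> B2_seminorm \<beta> v" if "0 < h" "h \<le> 2" for h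
    unfolding B2_seminorm_def by (rule cSUP_upper) (use that in simp, rule bdd_aboveI2[OF i_le])
  show "l2norm (shift_diff h v) \<le> B2_seminorm \<beta> v * h powr \<beta>" if "0 < h" "h \<le> 2"
  proof -
    have "h powr (- \<beta>) * l2norm (shift_diff h v) \<le> h powr (- \<beta>) * ?i h"
      using that by (intro mult_left_mono le_i) auto
    with B[OF that] have "h powr (- \<beta>) * l2norm (shift_diff h v) \<le> B2_seminorm \<beta> v" by linarith
    then have "h powr (- \<beta>) * l2norm (shift_diff h v) * h powr \<beta> \<le> B2_seminorm \<beta> v * h powr \<beta>"
      by (rule mult_right_mono) simp
    then show ?thesis using that by (simp add: powr_minus field_simps)
  qed
  have "0 \<le> l2norm (shift_diff 0 v)" by (simp add: l2norm_def)
  also have "\<dots> \<le> ?i 1" by (rule le_i) auto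
  finally show "0 \<le> B2_seminorm \<beta> v" using B[of 1] by simp
qed

lemma B2_shift_bound:
  assumes v: "v \<in> B2 \<beta>" and \<beta>: "0 < \<beta>"
  shows "shift_bound v (B2_seminorm \<beta> v) \<beta>"
proof
  have sq: "square_integrable v" using v by (simp add: B2_def)
  then show m [measurable]: "v \<in> borel_measurable borel" by (simp add: square_integrable_def)
  show "0 < \<beta>" by fact
  fix h :: real assume h: "0 < h" "h \<le> 2"
  have i: "integrable lborel (\<lambda>x. (v x)\<^sup>2)" using sq by (simp add: square_integrable_def)
  have ish: "integrable lborel (\<lambda>x. (v (x + h))\<^sup>2)"
    using lborel_integrable_real_affine[OF i, of 1 h] by (simp add: add.commute)
  have "integrable lborel (\<lambda>x. 2 * (v (x + h))\<^sup>2 + 2 * (v x)\<^sup>2)"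
    by (intro Bochner_Integration.integrable_add integrable_mult_right i ish)
  \<comment> \<open>Without integrability the integral inside \<open>l2norm\<close> would be 0 by
    default and the bound would say nothing about the nonnegative integral.\<close>
  then have id: "integrable lborel (\<lambda>x. (v (x + h) - v x)\<^sup>2)"
  proof (rule Bochner_Integration.integrable_bound)
    show "AE x in lborel. norm ((v (x + h) - v x)\<^sup>2) \<le> norm (2 * (v (x + h))\<^sup>2 + 2 * (v x)\<^sup>2)"
    proof (rule AE_I2)
      fix x
      have "0 \<le> (v (x + h) + v x)\<^sup>2" by simp
      then have "(v (x + h) - v x)\<^sup>2 \<le> 2 * (v (x + h))\<^sup>2 + 2 * (v x)\<^sup>2"
        by (simp add: power2_sum power2_diff)
      then show "norm ((v (x + h) - v x)\<^sup>2) \<le> norm (2 * (v (x + h))\<^sup>2 + 2 * (v x)\<^sup>2)"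
        by simp
    qed
  qed simp
  let ?I = "LINT x|lborel. (v (x + h) - v x)\<^sup>2"
  have "sqrt ?I \<le> B2_seminorm \<beta> v * h powr \<beta>"
    using B2_shift(1)[OF v \<beta> h] by (simp add: l2norm_def shift_diff_def)
  then have "(sqrt ?I)\<^sup>2 \<le> (B2_seminorm \<beta> v * h powr \<beta>)\<^sup>2" by (rule power_mono) simp
  also have "\<dots> = (B2_seminorm \<beta> v)\<^sup>2 * h powr (2 * \<beta>)"
    by (simp add: power2_eq_square powr_add[symmetric])
  finally have "?I \<le> (B2_seminorm \<beta> v)\<^sup>2 * h powr (2 * \<beta>)" by simp
  then show "(\<integral>\<^sup>+x. ennreal ((v (x + h) - v x)\<^sup>2) \<partial>lborel) \<le> ennreal ((B2_seminorm \<beta> v)\<^sup>2 * h powr (2 * \<beta>))"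
    using id by (simp add: nn_integral_eq_integral ennreal_leI)
qed

text \<open>Continuity supplies the measurability under which the essential supremum is bounded by a
  pointwise bound.\<close>

lemma linfnorm_le:
  assumes "continuous_on UNIV f" "\<And>x. \<bar>f x\<bar> \<le> c"
  shows "linfnorm f \<le> ereal c"
proof -
  have [measurable]: "f \<in> borel_measurable borel" using assms(1) by (rule borel_measurable_continuous_onI)
  show ?thesis unfolding linfnorm_def by (rule esssup_I) (use assms(2) in auto)
qed

theorem theorem4p11:
  shows "\<exists>C1 C2 D :: real \<Rightarrow> real \<Rightarrow> real \<Rightarrow> real.
    \<forall>(\<alpha>::real) (\<beta>::real) (u :: real \<Rightarrow> real) (\<mu> :: real measure)
      (dx::real) (s :: int \<Rightarrow> real) (t::real).
      0 \<le> \<alpha> \<and> \<alpha> \<le> 1 \<and> 0 < \<beta> \<and> \<beta> \<le> 1 \<and>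
      (u, \<mu>) \<in> eulerian \<and> wderiv u \<in> B2 \<beta> \<and> sc_part \<mu> = null_measure borel \<and>
      0 < dx \<and> dx \<le> 1 \<and> (\<forall>j. s j = 1 \<or> s j = -1) \<and> 0 < t \<longrightarrow>
      (let Finf = measure \<mu> UNIV;
           N = B2_seminorm \<beta> (wderiv u);
           (y, U, V) = S_op \<alpha> t (L_map (u, \<mu>));
           (ydx, Udx, Vdx) = S_op \<alpha> t (L_map (P_op s dx (u, \<mu>)));
           (ut, \<mu>t) = T_op \<alpha> t (u, \<mu>);
           (udx, \<mu>dx) = T_op \<alpha> t (P_op s dx (u, \<mu>))
       in linfnorm (\<lambda>\<xi>. U \<xi> - Udx \<xi>)
            \<le> ereal ((1 + t) * C1 \<beta> Finf N * dx powr (\<beta> / 4)) \<and>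
          linfnorm (\<lambda>\<xi>. y \<xi> - ydx \<xi>)
            \<le> ereal ((1 + t) * t * C2 \<beta> Finf N * dx powr (\<beta> / 4) + 2 * dx powr (\<beta> / 4)) \<and>
          linfnorm (\<lambda>x. ut x - udx x)
            \<le> ereal (D \<beta> Finf N * (1 + sqrt t + t) * dx powr (\<beta> / 8)))"
proof -
  \<comment> \<open>One function serves for both Lagrangian estimates, since the bound for y is the
    U bound integrated in time.\<close>
  define C :: "real \<Rightarrow> real \<Rightarrow> real \<Rightarrow> real" where "C \<beta> F N = 4 * sqrt F + 1 + 10 * N\<^sup>2 + 6 * F" for \<beta> F N
  define D :: "real \<Rightarrow> real \<Rightarrow> real \<Rightarrow> real" where "D \<beta> F N = C \<beta> F N + sqrt F * (sqrt (C \<beta> F N) + sqrt 2)" for \<beta> F N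
  show ?thesis
  proof (rule exI[of _ C], rule exI[of _ C], rule exI[of _ D], intro allI impI, elim conjE)
    fix \<alpha> \<beta> :: real and u :: "real \<Rightarrow> real" and \<mu> :: "real measure" and dx :: real and s :: "int \<Rightarrow> real" and t :: real
    assume \<alpha>: "0 \<le> \<alpha>" "\<alpha> \<le> 1" and \<beta>: "0 < \<beta>" "\<beta> \<le> 1" and eul: "(u, \<mu>) \<in> eulerian"
      and B2: "wderiv u \<in> B2 \<beta>" and dx: "0 < dx" "dx \<le> 1" and s: "\<forall>j. s j = 1 \<or> s j = -1" and t: "0 < t"
    let ?v = "wderiv u"
    obtain \<sigma> where u: "u \<in> E2" and \<mu>: "sets \<mu> = sets borel" "finite_measure \<mu>"
      and dec: "lebesgue_decomposition \<mu> (density lborel (\<lambda>x. ennreal ((?v x)\<^sup>2))) \<sigma>"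
      using eul by (auto simp: eulerian_def)
    obtain N where N: "N \<in> null_sets lborel" "emeasure \<sigma> (- N) = 0"
      using dec by (auto simp: lebesgue_decomposition_def)
    interpret projection u ?v \<mu> \<sigma> N "B2_seminorm \<beta> ?v" \<beta> s dx
    proof (intro projection.intro eulerian_pair.intro B2_shift_bound[OF B2 \<beta>(1)] projection_axioms.intro)
      show sq: "square_integrable ?v" using B2 by (simp add: B2_def)
      then have [measurable]: "?v \<in> borel_measurable borel" by (simp add: square_integrable_def)
      show "emeasure \<mu> A = (\<integral>\<^sup>+x. ennreal ((?v x)\<^sup>2) * indicator A x \<partial>lborel) + emeasure \<sigma> A"
        if "A \<in> sets borel" for A
        using dec that by (simp add: lebesgue_decomposition_def emeasure_density)
      show "sets \<sigma> = sets borel" using dec by (simp add: lebesgue_decomposition_def)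
    qed (use E2_primitive_of[OF u] \<mu> N s dx \<beta> B2_shift(2)[OF B2 \<beta>(1)] in auto)
    have P: "P_op s dx (u, \<mu>) = (ud, \<mu>d)"
      by (rule P_op_eq[OF ac_sing_part[OF dec]])
    have t0: "0 \<le> t" using t by simp
    have C1_eq: "C1 = C \<beta> (measure \<mu> UNIV) (B2_seminorm \<beta> ?v)"
      by (simp add: C1_def C_def Ftot_def)
    have 1: "linfnorm (\<lambda>\<xi>. Us \<alpha> t \<xi> - d.Us \<alpha> t \<xi>) \<le> ereal ((1 + t) * C1 * dx powr (\<beta> / 4))"
      by (intro linfnorm_le continuous_on_diff Us_continuous d.Us_continuous Us_error \<alpha> t0)
    have 2: "linfnorm (\<lambda>\<xi>. ys \<alpha> t \<xi> - d.ys \<alpha> t \<xi>) \<le> ereal ((1 + t) * t * C1 * dx powr (\<beta> / 4) + 2 * dx powr (\<beta> / 4))"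
      by (intro linfnorm_le continuous_on_diff ys_continuous d.ys_continuous ys_error \<alpha> t0)
    have 3: "linfnorm (\<lambda>x. uT \<alpha> t x - d.uT \<alpha> t x)
        \<le> ereal ((C1 + sqrt Ftot * (sqrt C1 + sqrt 2)) * (1 + sqrt t + t) * dx powr (\<beta> / 8))"
      by (intro linfnorm_le continuous_on_diff T_op_continuous d.T_op_continuous T_op_error \<alpha> t0)
    show "let Finf = measure \<mu> UNIV;
           N = B2_seminorm \<beta> (wderiv u);
           (y, U, V) = S_op \<alpha> t (L_map (u, \<mu>));
           (ydx, Udx, Vdx) = S_op \<alpha> t (L_map (P_op s dx (u, \<mu>)));
           (ut, \<mu>t) = T_op \<alpha> t (u, \<mu>);
           (udx, \<mu>dx) = T_op \<alpha> t (P_op s dx (u, \<mu>))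
       in linfnorm (\<lambda>\<xi>. U \<xi> - Udx \<xi>)
            \<le> ereal ((1 + t) * C \<beta> Finf N * dx powr (\<beta> / 4)) \<and>
          linfnorm (\<lambda>\<xi>. y \<xi> - ydx \<xi>)
            \<le> ereal ((1 + t) * t * C \<beta> Finf N * dx powr (\<beta> / 4) + 2 * dx powr (\<beta> / 4)) \<and>
          linfnorm (\<lambda>x. ut x - udx x)
            \<le> ereal (D \<beta> Finf N * (1 + sqrt t + t) * dx powr (\<beta> / 8))"
      using 1 2 3 unfolding Let_def P S_op_eq[OF t0] d.S_op_eq[OF t0] D_def C1_eq Ftot_def
      by (simp only: prod.case case_prod_beta fst_conv snd_conv)
  qed
qed

end
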